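(* Consider the Riemannian nonlinear programming problem (P) and an infinite run of the RSSQP algorithm described in the context. Suppose that (A1) $f$, $g$, $h$ are twice continuously differentiable on $\mathcal{M}$, and (A2) there exists $\nu>0$ such that $\frac{1}{\nu}\|u\|_{x_k}^2\le\langle M_k[u],u\rangle_{x_k}$ and $|\langle H_k[u],v\rangle_{x_k}|\le\nu\|u\|_{x_k}\|v\|_{x_k}$ for all $u,v\in T_{x_k}\mathcal{M}$ and all $k\in\mathbb{N}\cup\{0\}$. Suppose also that the generated sequence $\{x_k\}$ is bounded. Then $\{x_k\}$ has at least one accumulation point $x^{\ast}\in\mathcal{M}$ which satisfies one of the following assertions: (i) $x^{\ast}$ is a KKT point of (P); (ii) $x^{\ast}$ is an AKKT point of (P), and $\{(x_k,y_k,z_k)\}$ has a subsequence that is an AKKT sequence corresponding to $x^{\ast}$; (iii) $x^{\ast}$ is an infeasible point of (P), but is a stationary point of the feasibility problem of minimizing $J$ over $\mathcal{M}$, that is, $\mathrm{grad}\,J(x^{\ast})=0$. Moreover, if $x^{\ast}$ satisfies the ERCQ, then it is a KKT point of (P).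
   Context: Setting. $\mathcal{M}$ is a $d$-dimensional connected complete Riemannian manifold with metric $\langle\cdot,\cdot\rangle_x$, norm $\|\cdot\|_x$ on $T_x\mathcal{M}$, and Riemannian distance $d(\cdot,\cdot)$ (boundedness in $\mathcal{M}$ is with respect to it). $R\colon T\mathcal{M}\to\mathcal{M}$ is a retraction, $R_x=R|_{T_x\mathcal{M}}$ (so $R_x(0)=x$ and $\mathrm{D}R_x(0)$ is the identity on $T_x\mathcal{M}$). $f\colon\mathcal{M}\to\mathbb{R}$, $g\colon\mathcal{M}\to\mathbb{R}^m$, $h\colon\mathcal{M}\to\mathbb{R}^\ell$ are twice continuously differentiable. Problem (P): minimize $f(x)$ over $x\in\mathcal{M}$ subject to $g(x)=0$, $h(x)\ge0$ (componentwise). $\mathbb{N}$ is the set of positive integers; $\mathbb{R}^\ell_+=\{v\in\mathbb{R}^\ell: v\ge0\}$; $[v]_+$ is the componentwise maximum of $v$ and $0$; $P_S$ is the metric projection onto a closed convex set $S$; $\mathrm{D}g(x)^{\ast},\mathrm{D}h(x)^{\ast}$ are the adjoints of $\mathrm{D}g(x),\mathrm{D}h(x)$. $L(x,y,z)=f(x)-y^\top g(x)-z^\top h(x)$. For $\sigma>0$, $F(x;y,z,\sigma)=f(x)+\frac{1}{2\sigma}\|\sigma y-g(x)\|^2+\frac{1}{2\sigma}\|[\sigma z-h(x)]_+\|^2$, with gradient (in $x$) $\mathrm{grad}\,F$. For a constant $\theta\in(0,1)$ and $z\ge0$, $\Phi_\theta(x,y,z)=\|g(x)\|+\|[-h(x)]_+\|+\theta\|\mathrm{grad}_xL(x,y,z)\|_x+\theta|\langle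 z,h(x)\rangle|$, $\Psi_\theta(x,y,z)=\theta\|g(x)\|+\theta\|[-h(x)]_+\|+\|\mathrm{grad}_xL(x,y,z)\|_x+|\langle z,h(x)\rangle|$, $r(x,y,z)=\|g(x)\|+\|[-h(x)]_+\|+\|\mathrm{grad}_xL(x,y,z)\|_x+|\langle z,h(x)\rangle|$. RSSQP algorithm. Choose $\beta,\varepsilon,\theta\in(0,1)$, nonempty compact convex sets $C\subset\mathbb{R}^m$, $D\subset\mathbb{R}^\ell_+$, $x_0\in\mathcal{M}$, $y_0=\widehat y_0\in C$, $z_0=\widehat z_0\in D$, and $\sigma_0,\phi_0,\psi_0,\gamma_0>0$. For $k=0,1,2,\dots$: 1. Select a self-adjoint linear operator $H_k$ on $T_{x_k}\mathcal{M}$ such that $M_k:=H_k+\frac{1}{\sigma_k}\mathrm{D}g(x_k)^{\ast}\mathrm{D}g(x_k)$ is coercive. Set $s_k=\widehat y_k-\frac1{\sigma_k}g(x_k)$, $t_k=\widehat z_k-\frac1{\sigma_k}h(x_k)$. 2. Let $(\xi_k^{\ast},\eta_k^{\ast})\in T_{x_k}\mathcal{M}\times\mathbb{R}^\ell$ be the optimizer of: minimize $\langle\mathrm{grad} f(x_k)-\mathrm{D}g(x_k)^{\ast}[s_k],\xi\rangle_{x_k}+\frac12\langle M_k[\xi],\xi\rangle_{x_k}+\frac{\sigma_k}{2}\|\eta\|^2$ subject to $\mathrm{D}h(x_k)[\xi]+\sigma_k(\eta-t_k)\ge0$. 3. Set $p_k=\xi_k^{\ast}$, $\widetilde y_{k+1}=\widehat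 y_k-\frac1{\sigma_k}(g(x_k)+\mathrm{D}g(x_k)[\xi_k^{\ast}])$, $\widetilde z_{k+1}=\eta_k^{\ast}$. 4. Let $j_k$ be the smallest nonnegative integer $j$ with $F(R_{x_k}(\beta^{j}p_k);\widehat y_k,\widehat z_k,\sigma_k)\le F(x_k;\widehat y_k,\widehat z_k,\sigma_k)+\varepsilon\beta^{j}\langle\mathrm{grad}\,F(x_k;\widehat y_k,\widehat z_k,\sigma_k),p_k\rangle_{x_k}$; set $\alpha_k=\beta^{j_k}$ and $x_{k+1}=R_{x_k}(\alpha_kp_k)$. 5. Update (quantities not mentioned keep their value, i.e. index $k+1$ equals index $k$), using the first case that applies: Step 4.1: if $\Phi_\theta(x_{k+1},\widetilde y_{k+1},\widetilde z_{k+1})\le\frac12\phi_k$, $\widetilde y_{k+1}\in C$, $\widetilde z_{k+1}\in D$: set $y_{k+1}=\widehat y_{k+1}=\widetilde y_{k+1}$, $z_{k+1}=\widehat z_{k+1}=\widetilde z_{k+1}$, $\phi_{k+1}=\frac12\phi_k$. Step 4.2: else if $\Psi_\theta(x_{k+1},\widetilde y_{k+1},\widetilde z_{k+1})\le\frac12\psi_k$, $\widetilde y_{k+1}\in C$, $\widetilde z_{k+1}\in D$: set $y_{k+1}=\widehat y_{k+1}=\widetilde y_{k+1}$, $z_{k+1}=\widehat z_{k+1}=\widetilde z_{k+1}$, $\psi_{k+1}=\frac12\psi_k$. Step 4.3: else if $\|\mathrm{grad}\,F(x_{k+1};\widehat y_k,\widehat z_k,\sigma_k)\|_{x_{k+1}}\le\gamma_k$: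 set $y_{k+1}=\widehat y_k-\frac1{\sigma_k}g(x_{k+1})$, $z_{k+1}=[\widehat z_k-\frac1{\sigma_k}h(x_{k+1})]_+$, $\widehat y_{k+1}=P_C(\widehat y_k-\frac1{\sigma_k}g(x_{k+1}))$, $\widehat z_{k+1}=P_D(\widehat z_k-\frac1{\sigma_k}h(x_{k+1}))$, $\sigma_{k+1}=\min\{\frac12\sigma_k,r(x_k,y_k,z_k)^{3/2}\}$, $\gamma_{k+1}=\frac12\gamma_k$. Step 4.4: else: all of $y,z,\widehat y,\widehat z,\sigma,\phi,\psi,\gamma$ are unchanged. Standing assumption: the algorithm generates an infinite number of iterations, with $\sigma_k>0$ for all $k$. Optimality notions. $x\in\mathcal{M}$ is a KKT point of (P) if there are $y\in\mathbb{R}^m$, $z\in\mathbb{R}^\ell$ with $\mathrm{grad}_xL(x,y,z)=0$, $g(x)=0$, $h(x)\ge0$, $z\ge0$, $\langle z,h(x)\rangle=0$. $x\in\mathcal{M}$ is an AKKT point of (P) if $g(x)=0$, $h(x)\ge0$ and there are sequences $\{x_k\}\subset\mathcal{M}$, $\{y_k\}\subset\mathbb{R}^m$, $\{z_k\}\subset\mathbb{R}^\ell_+$ with $x_k\to x$, $\|\mathrm{grad}_xL(x_k,y_k,z_k)\|_{x_k}\to0$, $\langle z_k,[h(x_k)]_+\rangle\to0$; such $\{(x_k,y_k,z_k)\}$ is called an AKKT sequence corresponding to $x$. A point $x\in\mathcal{M}$ (not necessarily feasible) satisfies the extended Robinson constraint qualification (ERCQ) if $0\in\mathrm{int}\{(g(x)+\mathrm{D}g(x)[\xi],\,h(x)+\mathrm{D}h(x)[\xi]-w):\xi\in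 T_x\mathcal{M},\,w\in\mathbb{R}^\ell_+\}\subset\mathbb{R}^{m+\ell}$. The constraint violation function is $J(x)=\frac12\|g(x)\|^2+\frac12\|[-h(x)]_+\|^2$, which is continuously differentiable with $\mathrm{grad}\,J(x)=\mathrm{D}g(x)^{\ast}[g(x)]-\mathrm{D}h(x)^{\ast}[[-h(x)]_+]$. *)

theory Defs
  imports "HOL-Analysis.Analysis" "HOL-Library.Function_Algebras"
begin

section \<open>Pointwise vector space structure on functions\<close>

instantiation "fun" :: (type, real_vector) real_vector
begin

definition scaleR_fun_def: "scaleR a f = (\<lambda>x. a *\<^sub>R f x)"

instance
  by standard (simp_all add: scaleR_fun_def plus_fun_def scaleR_add_right scaleR_add_left)

end

lemma scaleR_fun_apply [simp]: "(a *\<^sub>R f) x = a *\<^sub>R f x"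
  by (simp add: scaleR_fun_def)

section \<open>Smooth manifolds\<close>

primrec Ck_on :: "nat \<Rightarrow> 'a::real_normed_vector set \<Rightarrow> ('a \<Rightarrow> 'b::real_normed_vector) \<Rightarrow> bool" where
  "Ck_on 0 S f \<longleftrightarrow> continuous_on S f"
| "Ck_on (Suc k) S f \<longleftrightarrow> (\<forall>x\<in>S. f differentiable (at x)) \<and>
     (\<forall>v. Ck_on k S (\<lambda>x. frechet_derivative f (at x) v))"

definition smooth_on :: "'a::real_normed_vector set \<Rightarrow> ('a \<Rightarrow> 'b::real_normed_vector) \<Rightarrow> bool" where
  "smooth_on S f \<longleftrightarrow> (\<forall>k. Ck_on k S f)"

text \<open>The points of the manifold are all elements of a type \<^typ>\<open>'p\<close>, which carries the manifold
  topology.  The model space is a Euclidean space \<^typ>\<open>'e\<close>; its dimension is the dimension of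
  the manifold.  The coordinate map of a chart is only meaningful on the domain of the chart.\<close>

datatype ('p, 'e) chart = Chart (cdom: "'p set") (cmap: "'p \<Rightarrow> 'e")

definition cinv :: "('p, 'e) chart \<Rightarrow> 'e \<Rightarrow> 'p" where
  "cinv c = inv_into (cdom c) (cmap c)"

definition smooth_atlas ::
  "('p::{t2_space,second_countable_topology}, 'e::euclidean_space) chart set \<Rightarrow> bool" where
  "smooth_atlas A \<longleftrightarrow>
     (\<Union>c\<in>A. cdom c) = UNIV \<and>
     (\<forall>c\<in>A. open (cdom c) \<and> open (cmap c ` cdom c) \<and>
        homeomorphism (cdom c) (cmap c ` cdom c) (cmap c) (cinv c)) \<and>
     (\<forall>c\<in>A. \<forall>c'\<in>A. smooth_on (cmap c ` (cdom c \<inter> cdom c')) (cmap c' \<circ> cinv c))"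

definition Ck_map :: "nat \<Rightarrow> ('p, 'e::real_normed_vector) chart set \<Rightarrow>
    ('p \<Rightarrow> 'b::real_normed_vector) \<Rightarrow> bool" where
  "Ck_map k A f \<longleftrightarrow> (\<forall>c\<in>A. Ck_on k (cmap c ` cdom c) (f \<circ> cinv c))"

text \<open>A tangent vector at \<open>x\<close> is the family of its coordinate vectors in all charts around \<open>x\<close>; these
  are related by the derivatives of the transition maps.  At charts that do not contain \<open>x\<close>, and
  outside the atlas, the family is \<open>0\<close>, so that the tangent space is a linear subspace
  of the function space on which the vector operations are pointwise.\<close>

type_synonym ('p, 'e) tvec = "('p, 'e) chart \<Rightarrow> 'e"

definition tangent_space ::
  "('p, 'e::real_normed_vector) chart set \<Rightarrow> 'p \<Rightarrow> ('p, 'e) tvec set" where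
  "tangent_space A x = {v.
     (\<forall>c. c \<notin> A \<or> x \<notin> cdom c \<longrightarrow> v c = 0) \<and>
     (\<forall>c\<in>A. \<forall>c'\<in>A. x \<in> cdom c \<and> x \<in> cdom c' \<longrightarrow>
        v c' = frechet_derivative (cmap c' \<circ> cinv c) (at (cmap c x)) (v c))}"

text \<open>The tangent vector at \<open>x\<close> whose coordinates in the chart \<open>c\<close> are \<open>u\<close>.\<close>

definition tvec_of ::
  "('p, 'e::real_normed_vector) chart set \<Rightarrow> ('p, 'e) chart \<Rightarrow> 'p \<Rightarrow> 'e \<Rightarrow> ('p, 'e) tvec" where
  "tvec_of A c x u = (\<lambda>c'. if c' \<in> A \<and> x \<in> cdom c'
     then frechet_derivative (cmap c' \<circ> cinv c) (at (cmap c x)) u else 0)"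

text \<open>The differential \<open>D f(x)[v]\<close>: the common value, over all charts around \<open>x\<close>, of the derivative
  of the coordinate expression of \<open>f\<close> in the direction of the coordinates of \<open>v\<close>.\<close>

definition mdiff :: "('p, 'e::real_normed_vector) chart set \<Rightarrow> ('p \<Rightarrow> 'b::real_normed_vector) \<Rightarrow>
    'p \<Rightarrow> ('p, 'e) tvec \<Rightarrow> 'b" where
  "mdiff A f x v = (THE w. \<forall>c\<in>A. x \<in> cdom c \<longrightarrow>
     w = frechet_derivative (f \<circ> cinv c) (at (cmap c x)) (v c))"

section \<open>Riemannian metrics\<close>

type_synonym ('p, 'e) metric_tensor = "'p \<Rightarrow> ('p, 'e) tvec \<Rightarrow> ('p, 'e) tvec \<Rightarrow> real"

definition riemannian_metric ::
  "('p, 'e::real_normed_vector) chart set \<Rightarrow> ('p, 'e) metric_tensor \<Rightarrow> bool" where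
  "riemannian_metric A G \<longleftrightarrow>
     (\<forall>x. \<forall>u\<in>tangent_space A x. \<forall>v\<in>tangent_space A x. \<forall>w\<in>tangent_space A x. \<forall>a b.
        G x u v = G x v u \<and>
        G x (a *\<^sub>R u + b *\<^sub>R v) w = a * G x u w + b * G x v w \<and>
        (u \<noteq> 0 \<longrightarrow> G x u u > 0)) \<and>
     (\<forall>c\<in>A. \<forall>u v. smooth_on (cmap c ` cdom c)
        (\<lambda>a. G (cinv c a) (tvec_of A c (cinv c a) u) (tvec_of A c (cinv c a) v)))"

definition rnorm :: "('p, 'e) metric_tensor \<Rightarrow> 'p \<Rightarrow> ('p, 'e) tvec \<Rightarrow> real" where
  "rnorm G x v = sqrt (G x v v)"

text \<open>Continuously differentiable curves on a closed interval, with one-sided derivatives at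
  the end points.\<close>

definition C1_curve_on :: "('p::topological_space, 'e::real_normed_vector) chart set \<Rightarrow>
    (real \<Rightarrow> 'p) \<Rightarrow> real \<Rightarrow> real \<Rightarrow> bool" where
  "C1_curve_on A \<gamma> a b \<longleftrightarrow> continuous_on {a..b} \<gamma> \<and>
     (\<forall>c\<in>A. (\<forall>t\<in>{t\<in>{a..b}. \<gamma> t \<in> cdom c}. (cmap c \<circ> \<gamma>) differentiable (at t within {a..b})) \<and>
        continuous_on {t\<in>{a..b}. \<gamma> t \<in> cdom c}
          (\<lambda>t. vector_derivative (cmap c \<circ> \<gamma>) (at t within {a..b})))"

definition piecewise_C1_curve :: "('p::topological_space, 'e::real_normed_vector) chart set \<Rightarrow>
    (real \<Rightarrow> 'p) \<Rightarrow> bool" where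
  "piecewise_C1_curve A \<gamma> \<longleftrightarrow>
     (\<exists>n. \<exists>\<tau>::nat \<Rightarrow> real. \<tau> 0 = 0 \<and> \<tau> n = 1 \<and>
        (\<forall>i<n. \<tau> i < \<tau> (Suc i) \<and> C1_curve_on A \<gamma> (\<tau> i) (\<tau> (Suc i))))"

definition velocity :: "('p, 'e::real_normed_vector) chart set \<Rightarrow> (real \<Rightarrow> 'p) \<Rightarrow> real \<Rightarrow>
    ('p, 'e) tvec" where
  "velocity A \<gamma> t = (\<lambda>c. if c \<in> A \<and> \<gamma> t \<in> cdom c
     then vector_derivative (cmap c \<circ> \<gamma>) (at t within {0..1}) else 0)"

text \<open>At the finitely many break points the velocity may be a junk value; this does not affect
  the integral.\<close>

definition curve_length :: "('p, 'e::real_normed_vector) chart set \<Rightarrow> ('p, 'e) metric_tensor \<Rightarrow>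
    (real \<Rightarrow> 'p) \<Rightarrow> real" where
  "curve_length A G \<gamma> = integral {0..1} (\<lambda>t. rnorm G (\<gamma> t) (velocity A \<gamma> t))"

definition rdist :: "('p::topological_space, 'e::real_normed_vector) chart set \<Rightarrow>
    ('p, 'e) metric_tensor \<Rightarrow> 'p \<Rightarrow> 'p \<Rightarrow> real" where
  "rdist A G p q =
     Inf {curve_length A G \<gamma> | \<gamma>. piecewise_C1_curve A \<gamma> \<and> \<gamma> 0 = p \<and> \<gamma> 1 = q}"

definition grad :: "('p, 'e::real_normed_vector) chart set \<Rightarrow> ('p, 'e) metric_tensor \<Rightarrow>
    ('p \<Rightarrow> real) \<Rightarrow> 'p \<Rightarrow> ('p, 'e) tvec" where
  "grad A G f x = (THE v. v \<in> tangent_space A x \<and>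
     (\<forall>u\<in>tangent_space A x. G x v u = mdiff A f x u))"

text \<open>\<open>D f(x)\<^sup>*[w]\<close>, the adjoint with respect to the Riemannian metric at \<open>x\<close>.\<close>

definition mdiff_adj :: "('p, 'e::real_normed_vector) chart set \<Rightarrow> ('p, 'e) metric_tensor \<Rightarrow>
    ('p \<Rightarrow> 'b::real_inner) \<Rightarrow> 'p \<Rightarrow> 'b \<Rightarrow> ('p, 'e) tvec" where
  "mdiff_adj A G f x w = (THE v. v \<in> tangent_space A x \<and>
     (\<forall>u\<in>tangent_space A x. G x v u = w \<bullet> mdiff A f x u))"

text \<open>A retraction is a smooth map from the tangent bundle to the manifold; \<open>R x\<close> is its
  restriction to the tangent space at \<open>x\<close>.  In the second condition, \<open>D R x (0)\<close> is
  read off in coordinates of a chart around \<open>x\<close>, and in the third one a chart \<open>c\<close> trivializes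
  the tangent bundle over its domain.\<close>

definition manifold_retraction :: "('p, 'e::real_normed_vector) chart set \<Rightarrow>
    ('p \<Rightarrow> ('p, 'e) tvec \<Rightarrow> 'p) \<Rightarrow> bool" where
  "manifold_retraction A R \<longleftrightarrow>
     (\<forall>x. R x 0 = x) \<and>
     (\<forall>x. \<forall>c\<in>A. x \<in> cdom c \<longrightarrow>
        ((\<lambda>u. cmap c (R x (tvec_of A c x u))) has_derivative (\<lambda>u. u)) (at 0)) \<and>
     (\<forall>c\<in>A. \<forall>c'\<in>A.
        let W = {(a, u). a \<in> cmap c ` cdom c \<and>
                   R (cinv c a) (tvec_of A c (cinv c a) u) \<in> cdom c'}
        in open W \<and>
           smooth_on W (\<lambda>(a, u). cmap c' (R (cinv c a) (tvec_of A c (cinv c a) u))))"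

definition self_adjoint_operator :: "('p, 'e::real_normed_vector) chart set \<Rightarrow>
    ('p, 'e) metric_tensor \<Rightarrow> 'p \<Rightarrow> (('p, 'e) tvec \<Rightarrow> ('p, 'e) tvec) \<Rightarrow> bool" where
  "self_adjoint_operator A G x H \<longleftrightarrow>
     (\<forall>u\<in>tangent_space A x. H u \<in> tangent_space A x) \<and>
     (\<forall>u\<in>tangent_space A x. \<forall>v\<in>tangent_space A x. \<forall>a b.
        H (a *\<^sub>R u + b *\<^sub>R v) = a *\<^sub>R H u + b *\<^sub>R H v \<and> G x (H u) v = G x u (H v))"

definition coercive_operator :: "('p, 'e::real_normed_vector) chart set \<Rightarrow>
    ('p, 'e) metric_tensor \<Rightarrow> 'p \<Rightarrow> (('p, 'e) tvec \<Rightarrow> ('p, 'e) tvec) \<Rightarrow> bool" where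
  "coercive_operator A G x M \<longleftrightarrow>
     (\<exists>\<mu>>0. \<forall>u\<in>tangent_space A x. \<mu> * (rnorm G x u)\<^sup>2 \<le> G x (M u) u)"

section \<open>The nonlinear program and its optimality notions\<close>

text \<open>The order on \<^typ>\<open>real^'n\<close> is the componentwise one.\<close>

definition pos_part :: "real^'n \<Rightarrow> real^'n" where
  "pos_part v = (\<chi> i. max (v $ i) 0)"

definition feasible :: "('p \<Rightarrow> real^'m) \<Rightarrow> ('p \<Rightarrow> real^'l) \<Rightarrow> 'p \<Rightarrow> bool" where
  "feasible g h x \<longleftrightarrow> g x = 0 \<and> 0 \<le> h x"

definition lagrangian :: "('p \<Rightarrow> real) \<Rightarrow> ('p \<Rightarrow> real^'m) \<Rightarrow> ('p \<Rightarrow> real^'l) \<Rightarrow>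
    'p \<Rightarrow> real^'m \<Rightarrow> real^'l \<Rightarrow> real" where
  "lagrangian f g h x y z = f x - y \<bullet> g x - z \<bullet> h x"

definition grad_lagrangian :: "('p, 'e::real_normed_vector) chart set \<Rightarrow> ('p, 'e) metric_tensor \<Rightarrow>
    ('p \<Rightarrow> real) \<Rightarrow> ('p \<Rightarrow> real^'m) \<Rightarrow> ('p \<Rightarrow> real^'l) \<Rightarrow>
    'p \<Rightarrow> real^'m \<Rightarrow> real^'l \<Rightarrow> ('p, 'e) tvec" where
  "grad_lagrangian A G f g h x y z = grad A G (\<lambda>x'. lagrangian f g h x' y z) x"

definition KKT_point :: "('p, 'e::real_normed_vector) chart set \<Rightarrow> ('p, 'e) metric_tensor \<Rightarrow>
    ('p \<Rightarrow> real) \<Rightarrow> ('p \<Rightarrow> real^'m) \<Rightarrow> ('p \<Rightarrow> real^'l) \<Rightarrow> 'p \<Rightarrow> bool" where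
  "KKT_point A G f g h x \<longleftrightarrow>
     (\<exists>y z. grad_lagrangian A G f g h x y z = 0 \<and> g x = 0 \<and> 0 \<le> h x \<and> 0 \<le> z \<and> z \<bullet> h x = 0)"

definition AKKT_sequence :: "('p::topological_space, 'e::real_normed_vector) chart set \<Rightarrow>
    ('p, 'e) metric_tensor \<Rightarrow> ('p \<Rightarrow> real) \<Rightarrow> ('p \<Rightarrow> real^'m) \<Rightarrow> ('p \<Rightarrow> real^'l) \<Rightarrow>
    'p \<Rightarrow> (nat \<Rightarrow> 'p) \<Rightarrow> (nat \<Rightarrow> real^'m) \<Rightarrow> (nat \<Rightarrow> real^'l) \<Rightarrow> bool" where
  "AKKT_sequence A G f g h x xs ys zs \<longleftrightarrow>
     (\<forall>k. 0 \<le> zs k) \<and>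
     xs \<longlonglongrightarrow> x \<and>
     (\<lambda>k. rnorm G (xs k) (grad_lagrangian A G f g h (xs k) (ys k) (zs k))) \<longlonglongrightarrow> 0 \<and>
     (\<lambda>k. zs k \<bullet> pos_part (h (xs k))) \<longlonglongrightarrow> 0"

definition AKKT_point :: "('p::topological_space, 'e::real_normed_vector) chart set \<Rightarrow>
    ('p, 'e) metric_tensor \<Rightarrow> ('p \<Rightarrow> real) \<Rightarrow> ('p \<Rightarrow> real^'m) \<Rightarrow> ('p \<Rightarrow> real^'l) \<Rightarrow>
    'p \<Rightarrow> bool" where
  "AKKT_point A G f g h x \<longleftrightarrow> feasible g h x \<and> (\<exists>xs ys zs. AKKT_sequence A G f g h x xs ys zs)"

definition ERCQ :: "('p, 'e::real_normed_vector) chart set \<Rightarrow>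
    ('p \<Rightarrow> real^'m) \<Rightarrow> ('p \<Rightarrow> real^'l) \<Rightarrow> 'p \<Rightarrow> bool" where
  "ERCQ A g h x \<longleftrightarrow>
     (0, 0) \<in> interior {(g x + mdiff A g x \<xi>, h x + mdiff A h x \<xi> - w) | \<xi> w.
                          \<xi> \<in> tangent_space A x \<and> 0 \<le> w}"

definition violation :: "('p \<Rightarrow> real^'m) \<Rightarrow> ('p \<Rightarrow> real^'l) \<Rightarrow> 'p \<Rightarrow> real" where
  "violation g h x = 1/2 * (norm (g x))\<^sup>2 + 1/2 * (norm (pos_part (- h x)))\<^sup>2"

section \<open>The RSSQP algorithm\<close>

definition merit :: "('p \<Rightarrow> real) \<Rightarrow> ('p \<Rightarrow> real^'m) \<Rightarrow> ('p \<Rightarrow> real^'l) \<Rightarrow>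
    real^'m \<Rightarrow> real^'l \<Rightarrow> real \<Rightarrow> 'p \<Rightarrow> real" where
  "merit f g h y z \<sigma> x = f x + 1 / (2*\<sigma>) * (norm (\<sigma> *\<^sub>R y - g x))\<^sup>2
     + 1 / (2*\<sigma>) * (norm (pos_part (\<sigma> *\<^sub>R z - h x)))\<^sup>2"

definition Phi_res :: "('p, 'e::real_normed_vector) chart set \<Rightarrow> ('p, 'e) metric_tensor \<Rightarrow>
    ('p \<Rightarrow> real) \<Rightarrow> ('p \<Rightarrow> real^'m) \<Rightarrow> ('p \<Rightarrow> real^'l) \<Rightarrow> real \<Rightarrow>
    'p \<Rightarrow> real^'m \<Rightarrow> real^'l \<Rightarrow> real" where
  "Phi_res A G f g h \<theta> x y z = norm (g x) + norm (pos_part (- h x))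
     + \<theta> * rnorm G x (grad_lagrangian A G f g h x y z) + \<theta> * \<bar>z \<bullet> h x\<bar>"

definition Psi_res :: "('p, 'e::real_normed_vector) chart set \<Rightarrow> ('p, 'e) metric_tensor \<Rightarrow>
    ('p \<Rightarrow> real) \<Rightarrow> ('p \<Rightarrow> real^'m) \<Rightarrow> ('p \<Rightarrow> real^'l) \<Rightarrow> real \<Rightarrow>
    'p \<Rightarrow> real^'m \<Rightarrow> real^'l \<Rightarrow> real" where
  "Psi_res A G f g h \<theta> x y z = \<theta> * norm (g x) + \<theta> * norm (pos_part (- h x))
     + rnorm G x (grad_lagrangian A G f g h x y z) + \<bar>z \<bullet> h x\<bar>"

definition KKT_res :: "('p, 'e::real_normed_vector) chart set \<Rightarrow> ('p, 'e) metric_tensor \<Rightarrow>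
    ('p \<Rightarrow> real) \<Rightarrow> ('p \<Rightarrow> real^'m) \<Rightarrow> ('p \<Rightarrow> real^'l) \<Rightarrow>
    'p \<Rightarrow> real^'m \<Rightarrow> real^'l \<Rightarrow> real" where
  "KKT_res A G f g h x y z = norm (g x) + norm (pos_part (- h x))
     + rnorm G x (grad_lagrangian A G f g h x y z) + \<bar>z \<bullet> h x\<bar>"

text \<open>The state of the algorithm at iteration \<open>k\<close>: the iterate \<open>x\<close>, the multipliers \<open>y, z\<close>, their
  safeguarded versions (hats), and the parameters \<open>\<sigma>, \<phi>, \<psi>, \<gamma>\<close>.\<close>

record ('p, 'm::finite, 'l::finite) rssqp_state =
  st_x :: 'p
  st_y :: "real^'m"
  st_z :: "real^'l"
  st_yh :: "real^'m"
  st_zh :: "real^'l"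
  st_sigma :: real
  st_phi :: real
  st_psi :: real
  st_gamma :: real

definition M_op :: "('p, 'e::real_normed_vector) chart set \<Rightarrow> ('p, 'e) metric_tensor \<Rightarrow>
    ('p \<Rightarrow> real^'m) \<Rightarrow> (('p, 'e) tvec \<Rightarrow> ('p, 'e) tvec) \<Rightarrow> ('p, 'm::finite, 'l::finite) rssqp_state \<Rightarrow>
    ('p, 'e) tvec \<Rightarrow> ('p, 'e) tvec" where
  "M_op A G g H s u =
     H u + (1 / st_sigma s) *\<^sub>R mdiff_adj A G g (st_x s) (mdiff A g (st_x s) u)"

definition subproblem_optimizer :: "('p, 'e::real_normed_vector) chart set \<Rightarrow>
    ('p, 'e) metric_tensor \<Rightarrow> ('p \<Rightarrow> real) \<Rightarrow> ('p \<Rightarrow> real^'m) \<Rightarrow> ('p \<Rightarrow> real^'l) \<Rightarrow>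
    (('p, 'e) tvec \<Rightarrow> ('p, 'e) tvec) \<Rightarrow> ('p, 'm::finite, 'l::finite) rssqp_state \<Rightarrow>
    ('p, 'e) tvec \<Rightarrow> real^'l \<Rightarrow> bool" where
  "subproblem_optimizer A G f g h H s \<xi>opt \<eta>opt \<longleftrightarrow>
     (let x = st_x s; \<sigma> = st_sigma s;
          sv = st_yh s - (1 / \<sigma>) *\<^sub>R g x;
          tv = st_zh s - (1 / \<sigma>) *\<^sub>R h x
      in is_arg_min
           (\<lambda>(\<xi>, \<eta>). G x (grad A G f x - mdiff_adj A G g x sv) \<xi>
              + 1/2 * G x (M_op A G g H s \<xi>) \<xi> + \<sigma>/2 * (norm \<eta>)\<^sup>2)
           (\<lambda>(\<xi>, \<eta>). \<xi> \<in> tangent_space A x \<and> 0 \<le> mdiff A h x \<xi> + \<sigma> *\<^sub>R (\<eta> - tv))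
           (\<xi>opt, \<eta>opt))"

definition armijo :: "('p, 'e::real_normed_vector) chart set \<Rightarrow> ('p, 'e) metric_tensor \<Rightarrow>
    ('p \<Rightarrow> ('p, 'e) tvec \<Rightarrow> 'p) \<Rightarrow>
    ('p \<Rightarrow> real) \<Rightarrow> ('p \<Rightarrow> real^'m) \<Rightarrow> ('p \<Rightarrow> real^'l) \<Rightarrow> real \<Rightarrow> real \<Rightarrow>
    ('p, 'm::finite, 'l::finite) rssqp_state \<Rightarrow> ('p, 'e) tvec \<Rightarrow> nat \<Rightarrow> bool" where
  "armijo A G R f g h \<beta> \<epsilon> s p j \<longleftrightarrow>
     (let x = st_x s; F = merit f g h (st_yh s) (st_zh s) (st_sigma s)
      in F (R x (\<beta>^j *\<^sub>R p)) \<le> F x + \<epsilon> * \<beta>^j * G x (grad A G F x) p)"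

text \<open>The update cases, given the new iterate \<open>x'\<close> and the trial multipliers \<open>ty, tz\<close>.\<close>

definition rssqp_update :: "('p, 'e::real_normed_vector) chart set \<Rightarrow> ('p, 'e) metric_tensor \<Rightarrow>
    ('p \<Rightarrow> real) \<Rightarrow> ('p \<Rightarrow> real^'m) \<Rightarrow> ('p \<Rightarrow> real^'l) \<Rightarrow> real \<Rightarrow>
    (real^'m) set \<Rightarrow> (real^'l) set \<Rightarrow> ('p, 'm::finite, 'l::finite) rssqp_state \<Rightarrow>
    'p \<Rightarrow> real^'m \<Rightarrow> real^'l \<Rightarrow> ('p, 'm::finite, 'l::finite) rssqp_state" where
  "rssqp_update A G f g h \<theta> C D s x' ty tz =
     (let \<sigma> = st_sigma s;
          ynew = st_yh s - (1 / \<sigma>) *\<^sub>R g x';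
          znew = st_zh s - (1 / \<sigma>) *\<^sub>R h x'
      in
      if Phi_res A G f g h \<theta> x' ty tz \<le> 1/2 * st_phi s \<and> ty \<in> C \<and> tz \<in> D then
        s\<lparr>st_x := x', st_y := ty, st_yh := ty, st_z := tz, st_zh := tz,
          st_phi := 1/2 * st_phi s\<rparr>
      else if Psi_res A G f g h \<theta> x' ty tz \<le> 1/2 * st_psi s \<and> ty \<in> C \<and> tz \<in> D then
        s\<lparr>st_x := x', st_y := ty, st_yh := ty, st_z := tz, st_zh := tz,
          st_psi := 1/2 * st_psi s\<rparr>
      else if rnorm G x' (grad A G (merit f g h (st_yh s) (st_zh s) \<sigma>) x') \<le> st_gamma s then
        s\<lparr>st_x := x', st_y := ynew, st_z := pos_part znew,
          st_yh := closest_point C ynew, st_zh := closest_point D znew,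
          st_sigma := min (1/2 * \<sigma>) (KKT_res A G f g h (st_x s) (st_y s) (st_z s) powr (3/2)),
          st_gamma := 1/2 * st_gamma s\<rparr>
      else s\<lparr>st_x := x'\<rparr>)"

definition rssqp_step :: "('p, 'e::real_normed_vector) chart set \<Rightarrow> ('p, 'e) metric_tensor \<Rightarrow>
    ('p \<Rightarrow> ('p, 'e) tvec \<Rightarrow> 'p) \<Rightarrow>
    ('p \<Rightarrow> real) \<Rightarrow> ('p \<Rightarrow> real^'m) \<Rightarrow> ('p \<Rightarrow> real^'l) \<Rightarrow> real \<Rightarrow> real \<Rightarrow> real \<Rightarrow>
    (real^'m) set \<Rightarrow> (real^'l) set \<Rightarrow> (('p, 'e) tvec \<Rightarrow> ('p, 'e) tvec) \<Rightarrow>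
    ('p, 'm::finite, 'l::finite) rssqp_state \<Rightarrow> ('p, 'm::finite, 'l::finite) rssqp_state \<Rightarrow> bool" where
  "rssqp_step A G R f g h \<beta> \<epsilon> \<theta> C D H s s' \<longleftrightarrow>
     self_adjoint_operator A G (st_x s) H \<and>
     coercive_operator A G (st_x s) (M_op A G g H s) \<and>
     (\<exists>p \<eta> j. subproblem_optimizer A G f g h H s p \<eta> \<and>
        armijo A G R f g h \<beta> \<epsilon> s p j \<and> (\<forall>i<j. \<not> armijo A G R f g h \<beta> \<epsilon> s p i) \<and>
        s' = rssqp_update A G f g h \<theta> C D s
               (R (st_x s) (\<beta>^j *\<^sub>R p))
               (st_yh s - (1 / st_sigma s) *\<^sub>R (g (st_x s) + mdiff A g (st_x s) p))
               \<eta>)"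

text \<open>An infinite run: \<open>S k\<close> is the state at the start of iteration \<open>k\<close> and \<open>H k\<close> the operator
  selected in iteration \<open>k\<close>.\<close>

definition rssqp_run :: "('p, 'e::real_normed_vector) chart set \<Rightarrow> ('p, 'e) metric_tensor \<Rightarrow>
    ('p \<Rightarrow> ('p, 'e) tvec \<Rightarrow> 'p) \<Rightarrow>
    ('p \<Rightarrow> real) \<Rightarrow> ('p \<Rightarrow> real^'m) \<Rightarrow> ('p \<Rightarrow> real^'l) \<Rightarrow> real \<Rightarrow> real \<Rightarrow> real \<Rightarrow>
    (real^'m) set \<Rightarrow> (real^'l) set \<Rightarrow> (nat \<Rightarrow> ('p, 'e) tvec \<Rightarrow> ('p, 'e) tvec) \<Rightarrow>
    (nat \<Rightarrow> ('p, 'm::finite, 'l::finite) rssqp_state) \<Rightarrow> bool" where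
  "rssqp_run A G R f g h \<beta> \<epsilon> \<theta> C D H S \<longleftrightarrow>
     \<beta> \<in> {0<..<1} \<and> \<epsilon> \<in> {0<..<1} \<and> \<theta> \<in> {0<..<1} \<and>
     C \<noteq> {} \<and> compact C \<and> convex C \<and>
     D \<noteq> {} \<and> compact D \<and> convex D \<and> D \<subseteq> {v. 0 \<le> v} \<and>
     st_y (S 0) = st_yh (S 0) \<and> st_yh (S 0) \<in> C \<and>
     st_z (S 0) = st_zh (S 0) \<and> st_zh (S 0) \<in> D \<and>
     0 < st_sigma (S 0) \<and> 0 < st_phi (S 0) \<and> 0 < st_psi (S 0) \<and> 0 < st_gamma (S 0) \<and>
     (\<forall>k. rssqp_step A G R f g h \<beta> \<epsilon> \<theta> C D (H k) (S k) (S (Suc k)))"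

end

(* A Lagrange multiplier update that is accepted infinitely often (Steps 4.1 and 4.2) drives a KKT
   residual to 0 while the multipliers stay in the compact set C x D, so an accumulation point is a
   KKT point.  If Step 4.3 is executed infinitely often, sigma tends to 0; either the limit is feasible
   and the iterates form an AKKT sequence, or multiplying the gradient of the merit function by sigma
   shows in the limit that the violation is stationary.  Otherwise the parameters are eventually
   constant and the method is a descent method for one fixed merit function: the slope along the
   search direction p is at most -|p|^2/nu, the line search forces p to 0 along a subsequence, and the
   optimality condition of the subproblem bounds the gradient of the merit function by a multiple of
   |p|, which would trigger Step 4.3.

   Accumulation points exist by the Hopf-Rinow theorem, in the version for length spaces: no geodesics
   are used, only that paths can be split at a point of prescribed arc length.  Tangent vectors are
   handled in charts throughout; the Riemannian metric enters through its continuity and the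
   equivalence of its norms with the coordinate norm near a point. *)

theory Submission
  imports Defs
begin

section \<open>Continuously differentiable functions\<close>

text \<open>The squared positive part limits the merit function to one continuous derivative, so a
  rejected trial step is exploited through the mean value theorem and continuity of the slope, not
  through a second-order expansion. Nor are there constants valid along the whole sequence: an
  accumulation point is fixed first, and norms and differentials are bounded near it. The
  differentials of the Lagrangian, the merit function and the violation share one form
  \<open>dlag a y z\<close>, where \<open>a\<close> weighs the objective. A single limit lemma
  therefore yields KKT points (weight 1), stationarity of the violation (weights \<sigma> tending to
  0) and the Fritz John limit in which the constraint qualification rules out a vanishing weight.
  Since tangent spaces vary along a sequence, a vector at the limit is carried to nearby points by
  keeping its coordinates in one chart. Distances are computed from the inductive relation
  \<open>joins\<close>, which is closed under concatenation; symmetry, the triangle inequality and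
  the splitting of paths then need no partitions.\<close>

lemma Ck_on_Suc_imp: "Ck_on (Suc k) S f \<Longrightarrow> Ck_on k S f"
proof (induction k arbitrary: f)
  case 0
  then show ?case
    by (auto intro!: continuous_at_imp_continuous_on differentiable_imp_continuous_within)
qed simp

lemma Ck_on_has_derivative:
  "Ck_on (Suc k) S f \<Longrightarrow> x \<in> S \<Longrightarrow> (f has_derivative frechet_derivative f (at x)) (at x)"
  by (simp add: frechet_derivative_works[symmetric])

text \<open>\<open>Ck_on\<close> gives continuity of the derivative for each fixed direction only.
  Expanding the direction in the finite basis upgrades this to joint continuity in point and
  direction.\<close>

lemma C1_derivative_tendsto:
  fixes f :: "'a::euclidean_space \<Rightarrow> 'b::real_normed_vector"
  assumes f: "Ck_on (Suc 0) S f" and S: "open S" "x \<in> S"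
    and X: "(X \<longlongrightarrow> x) F" and V: "(V \<longlongrightarrow> v) F"
  shows "((\<lambda>n. frechet_derivative f (at (X n)) (V n)) \<longlongrightarrow> frechet_derivative f (at x) v) F"
proof -
  have eq: "frechet_derivative f (at y) w = (\<Sum>b\<in>Basis. (w \<bullet> b) *\<^sub>R frechet_derivative f (at y) b)"
    if "y \<in> S" for y w
  proof -
    have "bounded_linear (frechet_derivative f (at y))"
      using Ck_on_has_derivative[OF f that] by (rule has_derivative_bounded_linear)
    then have l: "linear (frechet_derivative f (at y))"
      by (rule bounded_linear.linear)
    have "frechet_derivative f (at y) w = frechet_derivative f (at y) (\<Sum>b\<in>Basis. (w \<bullet> b) *\<^sub>R b)"
      by (simp add: euclidean_representation)
    also have "\<dots> = (\<Sum>b\<in>Basis. (w \<bullet> b) *\<^sub>R frechet_derivative f (at y) b)"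
      by (simp add: linear_sum[OF l] linear_scale[OF l])
    finally show ?thesis .
  qed
  have "isCont (\<lambda>y. frechet_derivative f (at y) b) x" for b
    using f S by (simp add: continuous_on_eq_continuous_at)
  then have "((\<lambda>n. frechet_derivative f (at (X n)) b) \<longlongrightarrow> frechet_derivative f (at x) b) F" for b
    using X by (rule isCont_tendsto_compose)
  then have lim: "((\<lambda>n. \<Sum>b\<in>Basis. (V n \<bullet> b) *\<^sub>R frechet_derivative f (at (X n)) b)
      \<longlongrightarrow> (\<Sum>b\<in>Basis. (v \<bullet> b) *\<^sub>R frechet_derivative f (at x) b)) F"
    by (intro tendsto_intros V)
  have "\<forall>\<^sub>F n in F. X n \<in> S"
    using X S by (rule topological_tendstoD)
  then have "\<forall>\<^sub>F n in F. (\<Sum>b\<in>Basis. (V n \<bullet> b) *\<^sub>R frechet_derivative f (at (X n)) b)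
      = frechet_derivative f (at (X n)) (V n)"
    by (rule eventually_mono) (rule eq[symmetric])
  from Lim_transform_eventually[OF lim this] show ?thesis
    by (subst eq[OF S(2)])
qed

section \<open>Calculus in charts\<close>

locale smooth_manifold =
  fixes A :: "('p::{t2_space,second_countable_topology}, 'e::euclidean_space) chart set"
  assumes atlas: "smooth_atlas A"
begin

lemma
  assumes "c \<in> A"
  shows open_cdom: "open (cdom c)"
    and open_cimage: "open (cmap c ` cdom c)"
    and chart_homeo: "homeomorphism (cdom c) (cmap c ` cdom c) (cmap c) (cinv c)"
  using atlas assms by (auto simp: smooth_atlas_def)

lemma cinv_cmap [simp]: "c \<in> A \<Longrightarrow> x \<in> cdom c \<Longrightarrow> cinv c (cmap c x) = x"
  using chart_homeo by (auto simp: homeomorphism_def)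

lemma cmap_cinv [simp]: "c \<in> A \<Longrightarrow> a \<in> cmap c ` cdom c \<Longrightarrow> cmap c (cinv c a) = a"
  by auto

lemma cinv_in [simp]: "c \<in> A \<Longrightarrow> a \<in> cmap c ` cdom c \<Longrightarrow> cinv c a \<in> cdom c"
  by auto

lemma continuous_cmap: "c \<in> A \<Longrightarrow> continuous_on (cdom c) (cmap c)"
  and continuous_cinv: "c \<in> A \<Longrightarrow> continuous_on (cmap c ` cdom c) (cinv c)"
  using chart_homeo by (auto simp: homeomorphism_def)

lemma isCont_cmap: "c \<in> A \<Longrightarrow> x \<in> cdom c \<Longrightarrow> isCont (cmap c) x"
  using continuous_cmap open_cdom continuous_on_eq_continuous_at by blast

lemma isCont_cinv: "c \<in> A \<Longrightarrow> a \<in> cmap c ` cdom c \<Longrightarrow> isCont (cinv c) a"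
  using continuous_cinv open_cimage continuous_on_eq_continuous_at by blast

lemma chart_around: obtains c where "c \<in> A" "x \<in> cdom c"
  using atlas unfolding smooth_atlas_def by (metis UNIV_I UN_iff)

lemma open_chart_image:
  assumes "c \<in> A" "open U" shows "open (cmap c ` (cdom c \<inter> U))"
proof -
  have "cmap c ` (cdom c \<inter> U) = cmap c ` cdom c \<inter> cinv c -` U"
    using assms by auto
  then show ?thesis
    using continuous_open_preimage[OF continuous_cinv open_cimage \<open>open U\<close>] assms by simp
qed

lemma open_chart_preimage:
  assumes "c \<in> A" "open U" shows "open {x \<in> cdom c. cmap c x \<in> U}"
  using continuous_open_preimage[OF continuous_cmap open_cdom \<open>open U\<close>] assms
  by (simp add: vimage_def Int_def)

lemma transition_C1:
  assumes "c \<in> A" "c' \<in> A"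
  shows "Ck_on (Suc 0) (cmap c ` (cdom c \<inter> cdom c')) (cmap c' \<circ> cinv c)"
  using atlas assms unfolding smooth_atlas_def smooth_on_def by blast

section \<open>Transition derivatives, tangent vectors and differentials\<close>

abbreviation dtrans :: "('p, 'e) chart \<Rightarrow> ('p, 'e) chart \<Rightarrow> 'p \<Rightarrow> 'e \<Rightarrow> 'e" where
  "dtrans c c' x \<equiv> frechet_derivative (cmap c' \<circ> cinv c) (at (cmap c x))"

lemma transition_derivative:
  assumes "c \<in> A" "c' \<in> A" "x \<in> cdom c" "x \<in> cdom c'"
  shows "((cmap c' \<circ> cinv c) has_derivative dtrans c c' x) (at (cmap c x))"
  using Ck_on_has_derivative[OF transition_C1] assms by blast

lemma linear_dtrans:
  assumes "c \<in> A" "c' \<in> A" "x \<in> cdom c" "x \<in> cdom c'"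
  shows "linear (dtrans c c' x)"
  using transition_derivative[OF assms] has_derivative_linear by blast

text \<open>Chain rule through the transition map. The composition agrees with
  \<open>f \<circ> cinv c\<close> only on the overlap of the two charts, which is open, so the
  derivative carries over.\<close>

lemma change_of_chart:
  assumes c: "c \<in> A" "c' \<in> A" "x \<in> cdom c" "x \<in> cdom c'"
    and D: "((f \<circ> cinv c') has_derivative D) (at (cmap c' x))"
  shows "((f \<circ> cinv c) has_derivative (\<lambda>u. D (dtrans c c' x u))) (at (cmap c x))"
proof -
  have "((f \<circ> cinv c') has_derivative D) (at ((cmap c' \<circ> cinv c) (cmap c x)))"
    using D c by simp
  from diff_chain_at[OF transition_derivative[OF c] this]
  have "((f \<circ> cinv c') \<circ> (cmap c' \<circ> cinv c) has_derivative D \<circ> dtrans c c' x) (at (cmap c x))" .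
  then have "(f \<circ> cinv c has_derivative D \<circ> dtrans c c' x) (at (cmap c x))"
    by (rule has_derivative_transform_within_open[where s="cmap c ` (cdom c \<inter> cdom c')"])
       (use c open_chart_image open_cdom in auto)
  then show ?thesis by (simp add: o_def)
qed

lemma dtrans_self:
  assumes "c \<in> A" "x \<in> cdom c"
  shows "dtrans c c x = (\<lambda>u. u)"
proof -
  have "((cmap c \<circ> cinv c) has_derivative (\<lambda>u. u)) (at (cmap c x))"
    by (rule has_derivative_transform_within_open[where s="cmap c ` cdom c" and f="\<lambda>u. u"])
       (use assms open_cimage in auto)
  then show ?thesis by (simp add: frechet_derivative_at[symmetric])
qed

text \<open>The cocycle rule, obtained from \<open>change_of_chart\<close> with a coordinate map as
  the function; it is what makes the family \<open>tv c x u\<close> a tangent vector.\<close>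

lemma dtrans_dtrans:
  assumes "c \<in> A" "c' \<in> A" "c'' \<in> A" "x \<in> cdom c" "x \<in> cdom c'" "x \<in> cdom c''"
  shows "dtrans c' c'' x (dtrans c c' x u) = dtrans c c'' x u"
  using frechet_derivative_at[OF change_of_chart[OF assms(1,2,4,5) transition_derivative[OF assms(2,3,5,6)]]]
  by (rule fun_cong)

abbreviation TM :: "'p \<Rightarrow> ('p, 'e) tvec set" where "TM \<equiv> tangent_space A"
abbreviation tv :: "('p, 'e) chart \<Rightarrow> 'p \<Rightarrow> 'e \<Rightarrow> ('p, 'e) tvec" where "tv \<equiv> tvec_of A"

lemma tvec_of_coord [simp]: "c \<in> A \<Longrightarrow> x \<in> cdom c \<Longrightarrow> tv c x u c = u"
  by (simp add: tvec_of_def dtrans_self)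

lemma tvec_of_in [simp]: "c \<in> A \<Longrightarrow> x \<in> cdom c \<Longrightarrow> tv c x u \<in> TM x"
  by (auto simp: tangent_space_def tvec_of_def dtrans_dtrans)

lemma tvec_of_tangent:
  assumes "c \<in> A" "x \<in> cdom c" "v \<in> TM x"
  shows "tv c x (v c) = v"
proof
  fix c'
  have "v c' = 0" if "\<not> (c' \<in> A \<and> x \<in> cdom c')"
    using assms(3) that unfolding tangent_space_def by blast
  moreover have "v c' = dtrans c c' x (v c)" if "c' \<in> A \<and> x \<in> cdom c'"
    using assms that unfolding tangent_space_def by blast
  ultimately show "tv c x (v c) c' = v c'"
    unfolding tvec_of_def by presburger
qed

lemma tvec_of_add: "c \<in> A \<Longrightarrow> x \<in> cdom c \<Longrightarrow> tv c x (u + v) = tv c x u + tv c x v"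
  by (rule ext) (simp add: tvec_of_def linear_add linear_dtrans)

lemma tvec_of_scaleR: "c \<in> A \<Longrightarrow> x \<in> cdom c \<Longrightarrow> tv c x (a *\<^sub>R u) = a *\<^sub>R tv c x u"
  by (rule ext) (simp add: tvec_of_def linear_scale linear_dtrans)

lemma tvec_of_0 [simp]: "c \<in> A \<Longrightarrow> x \<in> cdom c \<Longrightarrow> tv c x 0 = 0"
  by (rule ext) (simp add: tvec_of_def linear_0 linear_dtrans)

lemma tangent_add: "u \<in> TM x \<Longrightarrow> v \<in> TM x \<Longrightarrow> u + v \<in> TM x"
  and tangent_scaleR: "u \<in> TM x \<Longrightarrow> a *\<^sub>R u \<in> TM x"
  and tangent_0 [simp]: "0 \<in> TM x"
proof -
  obtain c where c: "c \<in> A" "x \<in> cdom c" by (rule chart_around)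
  show "u + v \<in> TM x" if "u \<in> TM x" "v \<in> TM x"
    using tvec_of_add[OF c, of "u c" "v c"] tvec_of_tangent[OF c] tvec_of_in[OF c] that by metis
  show "a *\<^sub>R u \<in> TM x" if "u \<in> TM x"
    using tvec_of_scaleR[OF c, of a "u c"] tvec_of_tangent[OF c] tvec_of_in[OF c] that by metis
  show "0 \<in> TM x"
    using tvec_of_0[OF c] tvec_of_in[OF c] by metis
qed

lemma tangent_diff: "u \<in> TM x \<Longrightarrow> v \<in> TM x \<Longrightarrow> u - v \<in> TM x"
  using tangent_add[OF _ tangent_scaleR[of v x "-1"]] by simp

text \<open>Shows that the description in \<open>mdiff\<close> is well defined: the chain rule
  changes the derivative, and the compatibility of the coordinates of \<open>v\<close> compensates
  it exactly.\<close>

lemma mdiff_eq: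
  assumes c: "c \<in> A" "x \<in> cdom c"
    and D: "((f \<circ> cinv c) has_derivative D) (at (cmap c x))"
    and v: "v \<in> TM x"
  shows "mdiff A f x v = D (v c)"
proof -
  have "frechet_derivative (f \<circ> cinv c') (at (cmap c' x)) (v c') = D (v c)"
    if "c' \<in> A" "x \<in> cdom c'" for c'
  proof -
    have "((f \<circ> cinv c') has_derivative (\<lambda>u. D (dtrans c' c x u))) (at (cmap c' x))"
      using change_of_chart c that D by blast
    then have "frechet_derivative (f \<circ> cinv c') (at (cmap c' x)) = (\<lambda>u. D (dtrans c' c x u))"
      by (simp add: frechet_derivative_at[symmetric])
    moreover have "v c = dtrans c' c x (v c')"
      using v that c unfolding tangent_space_def by blast
    ultimately show ?thesis by simp
  qed
  then show ?thesis
    unfolding mdiff_def using c by (intro the_equality) auto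
qed

text \<open>\<open>mdiff\<close> is a description and has no meaning without differentiability. The
  derivative is phrased through \<open>mdiff\<close> itself, so linearity of \<open>mdiff\<close> on
  the tangent space can be read off; one chart suffices by \<open>mdifferentiableI\<close>.\<close>

definition mdifferentiable :: "('p \<Rightarrow> 'b::real_normed_vector) \<Rightarrow> 'p \<Rightarrow> bool" where
  "mdifferentiable f x \<longleftrightarrow> (\<forall>c\<in>A. x \<in> cdom c \<longrightarrow>
     ((f \<circ> cinv c) has_derivative (\<lambda>u. mdiff A f x (tv c x u))) (at (cmap c x)))"

lemma mdifferentiableI:
  assumes c: "c \<in> A" "x \<in> cdom c" and D: "((f \<circ> cinv c) has_derivative D) (at (cmap c x))"
  shows "mdifferentiable f x"
  unfolding mdifferentiable_def
proof (intro ballI impI)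
  fix c' assume c': "c' \<in> A" "x \<in> cdom c'"
  have d: "((f \<circ> cinv c') has_derivative (\<lambda>u. D (dtrans c' c x u))) (at (cmap c' x))"
    using change_of_chart c c' D by blast
  have "mdiff A f x (tv c' x u) = D (dtrans c' c x u)" for u
    using mdiff_eq[OF c' d tvec_of_in[OF c']] c' by simp
  with d show "((f \<circ> cinv c') has_derivative (\<lambda>u. mdiff A f x (tv c' x u))) (at (cmap c' x))"
    by simp
qed

lemma mdifferentiableD:
  "mdifferentiable f x \<Longrightarrow> c \<in> A \<Longrightarrow> x \<in> cdom c \<Longrightarrow>
    ((f \<circ> cinv c) has_derivative (\<lambda>u. mdiff A f x (tv c x u))) (at (cmap c x))"
  by (simp add: mdifferentiable_def)

lemma mdiff_add_scaleR:
  assumes "mdifferentiable f x" "u \<in> TM x" "v \<in> TM x"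
  shows mdiff_add: "mdiff A f x (u + v) = mdiff A f x u + mdiff A f x v"
    and mdiff_scaleR: "mdiff A f x (a *\<^sub>R u) = a *\<^sub>R mdiff A f x u"
proof -
  obtain c where c: "c \<in> A" "x \<in> cdom c" by (rule chart_around)
  note D = mdifferentiableD[OF assms(1) c]
  note l = has_derivative_linear[OF D]
  show "mdiff A f x (u + v) = mdiff A f x u + mdiff A f x v"
    using linear_add[OF l, of "u c" "v c"] assms c by (simp add: tvec_of_add tvec_of_tangent)
  show "mdiff A f x (a *\<^sub>R u) = a *\<^sub>R mdiff A f x u"
    using linear_scale[OF l, of a "u c"] assms c by (simp add: tvec_of_scaleR tvec_of_tangent)
qed

lemma C1_mdifferentiable:
  assumes "Ck_map (Suc k) A f" shows "mdifferentiable f x"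
proof -
  obtain c where c: "c \<in> A" "x \<in> cdom c" by (rule chart_around)
  show ?thesis
    using mdifferentiableI[OF c Ck_on_has_derivative] assms c unfolding Ck_map_def by blast
qed

lemma Ck_map_Suc_imp: "Ck_map (Suc k) A f \<Longrightarrow> Ck_map k A f"
  unfolding Ck_map_def using Ck_on_Suc_imp by blast

text \<open>The form in which limits of differentials are taken: vectors at the moving points
  \<open>X n\<close> are compared through their coordinates \<open>U n\<close> in one fixed chart,
  whose domain contains \<open>X n\<close> eventually.\<close>

lemma tendsto_mdiff:
  assumes f: "Ck_map (Suc 0) A f" and c: "c \<in> A" "x \<in> cdom c"
    and X: "(X \<longlongrightarrow> x) F" and U: "(U \<longlongrightarrow> u) F"
  shows "((\<lambda>n. mdiff A f (X n) (tv c (X n) (U n))) \<longlongrightarrow> mdiff A f x (tv c x u)) F"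
proof -
  have f': "Ck_on (Suc 0) (cmap c ` cdom c) (f \<circ> cinv c)"
    using f c by (auto simp: Ck_map_def)
  have eq: "mdiff A f y (tv c y w) = frechet_derivative (f \<circ> cinv c) (at (cmap c y)) w"
    if "y \<in> cdom c" for y w
    using mdiff_eq[OF c(1) that Ck_on_has_derivative[OF f'] tvec_of_in] c that by simp
  have "((\<lambda>n. cmap c (X n)) \<longlongrightarrow> cmap c x) F"
    using isCont_tendsto_compose[OF isCont_cmap X] c by simp
  then have "((\<lambda>n. frechet_derivative (f \<circ> cinv c) (at (cmap c (X n))) (U n))
      \<longlongrightarrow> frechet_derivative (f \<circ> cinv c) (at (cmap c x)) u) F"
    using C1_derivative_tendsto[OF f' _ _ _ U] open_cimage c by auto
  moreover have "\<forall>\<^sub>F n in F. X n \<in> cdom c"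
    using X open_cdom c topological_tendstoD by metis
  ultimately show ?thesis
    unfolding eq[OF c(2)]
    by (rule Lim_transform_eventually[OF _ eventually_mono]) (simp add: eq)
qed

lemma isCont_mfun:
  assumes f: "mdifferentiable f x" shows "isCont f x"
proof -
  obtain c where c: "c \<in> A" "x \<in> cdom c" by (rule chart_around)
  have "isCont (f \<circ> cinv c) (cmap c x)"
    using has_derivative_continuous[OF mdifferentiableD[OF f c]] .
  then have "isCont (\<lambda>y. (f \<circ> cinv c) (cmap c y)) x"
    by (rule isCont_o2[OF isCont_cmap[OF c]])
  moreover have "\<forall>\<^sub>F y in nhds x. (f \<circ> cinv c) (cmap c y) = f y"
    using c open_cdom[OF c(1)] cinv_cmap[OF c(1)] unfolding eventually_nhds o_def by metis
  ultimately show ?thesis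
    using isCont_cong[of "\<lambda>y. (f \<circ> cinv c) (cmap c y)" f x] by simp
qed

end

section \<open>Riemannian metrics\<close>

locale riemannian_manifold = smooth_manifold A
  for A :: "('p::{t2_space,second_countable_topology}, 'e::euclidean_space) chart set" +
  fixes G :: "('p, 'e) metric_tensor"
  assumes metric: "riemannian_metric A G"
begin

lemma G_sym: "u \<in> TM x \<Longrightarrow> v \<in> TM x \<Longrightarrow> G x u v = G x v u"
  using metric tangent_0 unfolding riemannian_metric_def by blast

lemma G_lin: "u \<in> TM x \<Longrightarrow> v \<in> TM x \<Longrightarrow> w \<in> TM x \<Longrightarrow>
    G x (a *\<^sub>R u + b *\<^sub>R v) w = a * G x u w + b * G x v w"
  using metric unfolding riemannian_metric_def by blast

lemma G_pos: "u \<in> TM x \<Longrightarrow> u \<noteq> 0 \<Longrightarrow> G x u u > 0"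
  using metric unfolding riemannian_metric_def by blast

lemma G_add_left: "u \<in> TM x \<Longrightarrow> v \<in> TM x \<Longrightarrow> w \<in> TM x \<Longrightarrow>
    G x (u + v) w = G x u w + G x v w"
  using G_lin[of u x v w 1 1] by simp

lemma G_scaleR_left: "u \<in> TM x \<Longrightarrow> w \<in> TM x \<Longrightarrow> G x (a *\<^sub>R u) w = a * G x u w"
  using G_lin[of u x 0 w a 0] by simp

lemma G_diff_left: "u \<in> TM x \<Longrightarrow> v \<in> TM x \<Longrightarrow> w \<in> TM x \<Longrightarrow>
    G x (u - v) w = G x u w - G x v w"
  using G_lin[of u x v w 1 "-1"] by simp

lemma G_add_right: "u \<in> TM x \<Longrightarrow> v \<in> TM x \<Longrightarrow> w \<in> TM x \<Longrightarrow>
    G x w (u + v) = G x w u + G x w v"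
  using G_add_left G_sym tangent_add by metis

lemma G_scaleR_right: "u \<in> TM x \<Longrightarrow> w \<in> TM x \<Longrightarrow> G x w (a *\<^sub>R u) = a * G x w u"
  using G_scaleR_left G_sym tangent_scaleR by metis

lemma G_zero [simp]: "w \<in> TM x \<Longrightarrow> G x 0 w = 0" "w \<in> TM x \<Longrightarrow> G x w 0 = 0"
  using G_scaleR_left[of 0 x w 0] G_scaleR_right[of 0 x w 0] by simp_all

lemma G_nonneg: "u \<in> TM x \<Longrightarrow> G x u u \<ge> 0"
  using G_pos[of u x] by (cases "u = 0") auto

lemma rnorm_nonneg [simp]: "u \<in> TM x \<Longrightarrow> rnorm G x u \<ge> 0"
  by (simp add: rnorm_def G_nonneg)

lemma rnorm_square: "u \<in> TM x \<Longrightarrow> (rnorm G x u)\<^sup>2 = G x u u"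
  by (simp add: rnorm_def G_nonneg)

lemma rnorm_eq_0: "u \<in> TM x \<Longrightarrow> rnorm G x u = 0 \<longleftrightarrow> u = 0"
  using G_pos[of u x] by (cases "u = 0") (auto simp: rnorm_def)

lemma rnorm_scaleR: "u \<in> TM x \<Longrightarrow> rnorm G x (a *\<^sub>R u) = \<bar>a\<bar> * rnorm G x u"
  by (simp add: rnorm_def G_scaleR_left G_scaleR_right tangent_scaleR real_sqrt_mult)

lemma G_Cauchy_Schwarz:
  assumes u: "u \<in> TM x" and v: "v \<in> TM x"
  shows "\<bar>G x u v\<bar> \<le> rnorm G x u * rnorm G x v"
proof (cases "v = 0")
  case False
  \<comment> \<open>This \<open>t\<close> minimizes the squared norm of
    \<open>u - t *\<^sub>R v\<close>, which is then nonnegative.\<close>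
  define t where "t = G x u v / G x v v"
  have vv: "G x v v > 0" using G_pos v False by blast
  have "0 \<le> G x (u - t *\<^sub>R v) (u - t *\<^sub>R v)"
    using G_nonneg tangent_diff tangent_scaleR u v by blast
  also have "\<dots> = G x (u - t *\<^sub>R v) u - t * G x (u - t *\<^sub>R v) v"
    using G_diff_left[of u x "t *\<^sub>R v" "u - t *\<^sub>R v"] G_sym[of u x "u - t *\<^sub>R v"]
      G_sym[of v x "u - t *\<^sub>R v"] u v
    by (simp add: tangent_diff tangent_scaleR G_scaleR_left)
  also have "\<dots> = G x u u - t * G x v u - t * (G x u v - t * G x v v)"
    using u v by (simp add: G_diff_left G_scaleR_left tangent_scaleR)
  also have "\<dots> = G x u u - (G x u v)\<^sup>2 / G x v v"
    using vv u v by (simp add: t_def G_sym[of v x u] field_simps power2_eq_square)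
  finally have "(G x u v)\<^sup>2 \<le> G x u u * G x v v"
    using vv by (simp add: field_simps)
  then have "sqrt ((G x u v)\<^sup>2) \<le> sqrt (G x u u * G x v v)"
    by (rule real_sqrt_le_mono)
  then show ?thesis by (simp add: rnorm_def real_sqrt_mult)
qed (use u in \<open>simp add: rnorm_def\<close>)

text \<open>Smoothness of the metric is given for constant coordinate vectors only; the expansion
  reduces varying vectors to the finitely many coefficients on basis pairs.\<close>

lemma G_tvec_expand:
  assumes c: "c \<in> A" "x \<in> cdom c"
  shows "G x (tv c x u) (tv c x v) =
    (\<Sum>i\<in>Basis. \<Sum>j\<in>Basis. (u \<bullet> i) * (v \<bullet> j) * G x (tv c x i) (tv c x j))"
proof -
  have L: "linear (\<lambda>u. G x (tv c x u) w)" if "w \<in> TM x" for w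
    using that c by (intro linearI) (auto simp: tvec_of_add tvec_of_scaleR G_add_left G_scaleR_left)
  have R: "linear (\<lambda>v. G x w (tv c x v))" if "w \<in> TM x" for w
    using that c by (intro linearI) (auto simp: tvec_of_add tvec_of_scaleR G_add_right G_scaleR_right)
  have "G x (tv c x u) (tv c x v)
      = G x (tv c x (\<Sum>i\<in>Basis. (u \<bullet> i) *\<^sub>R i)) (tv c x v)"
    by (simp add: euclidean_representation)
  also have "\<dots> = (\<Sum>i\<in>Basis. (u \<bullet> i) * G x (tv c x i) (tv c x v))"
    by (simp add: linear_sum[OF L[OF tvec_of_in[OF c]]] linear_scale[OF L[OF tvec_of_in[OF c]]] del: euclidean_representation)
  also have "\<dots> = (\<Sum>i\<in>Basis. (u \<bullet> i) * (\<Sum>j\<in>Basis. (v \<bullet> j) * G x (tv c x i) (tv c x j)))"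
  proof (intro sum.cong refl arg_cong2[of _ _ _ _ times])
    fix i :: 'e
    have "G x (tv c x i) (tv c x v)
        = G x (tv c x i) (tv c x (\<Sum>j\<in>Basis. (v \<bullet> j) *\<^sub>R j))"
      by (simp add: euclidean_representation)
    also have "\<dots> = (\<Sum>j\<in>Basis. (v \<bullet> j) * G x (tv c x i) (tv c x j))"
      by (simp add: linear_sum[OF R[OF tvec_of_in[OF c]]] linear_scale[OF R[OF tvec_of_in[OF c]]] del: euclidean_representation)
    finally show "G x (tv c x i) (tv c x v)
      = (\<Sum>j\<in>Basis. (v \<bullet> j) * G x (tv c x i) (tv c x j))" .
  qed
  finally show ?thesis by (simp add: sum_distrib_left mult.assoc)
qed

lemma tendsto_G:
  assumes c: "c \<in> A" "x \<in> cdom c"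
    and X: "(X \<longlongrightarrow> x) F" and U: "(U \<longlongrightarrow> u) F" and V: "(V \<longlongrightarrow> v) F"
  shows "((\<lambda>n. G (X n) (tv c (X n) (U n)) (tv c (X n) (V n)))
    \<longlongrightarrow> G x (tv c x u) (tv c x v)) F"
proof -
  have ev: "\<forall>\<^sub>F n in F. X n \<in> cdom c"
    using X open_cdom c topological_tendstoD by metis
  have "((\<lambda>n. G (X n) (tv c (X n) i) (tv c (X n) j))
    \<longlongrightarrow> G x (tv c x i) (tv c x j)) F" for i j
  proof -
    have "Ck_on 0 (cmap c ` cdom c) (\<lambda>a. G (cinv c a) (tv c (cinv c a) i) (tv c (cinv c a) j))"
      using metric c unfolding riemannian_metric_def smooth_on_def by blast
    then have "isCont (\<lambda>a. G (cinv c a) (tv c (cinv c a) i) (tv c (cinv c a) j)) (cmap c x)"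
      using c open_cimage by (auto simp: continuous_on_eq_continuous_at)
    from isCont_tendsto_compose[OF this isCont_tendsto_compose[OF isCont_cmap X]]
    have "((\<lambda>n. G (cinv c (cmap c (X n))) (tv c (cinv c (cmap c (X n))) i)
           (tv c (cinv c (cmap c (X n))) j))
      \<longlongrightarrow> G x (tv c x i) (tv c x j)) F"
      using c by simp
    then show ?thesis
      by (rule Lim_transform_eventually[OF _ eventually_mono[OF ev]]) (simp add: c)
  qed
  then have lim: "((\<lambda>n. \<Sum>i\<in>Basis. \<Sum>j\<in>Basis. (U n \<bullet> i) * (V n \<bullet> j) * G (X n) (tv c (X n) i) (tv c (X n) j))
    \<longlongrightarrow> (\<Sum>i\<in>Basis. \<Sum>j\<in>Basis. (u \<bullet> i) * (v \<bullet> j) * G x (tv c x i) (tv c x j))) F"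
    by (intro tendsto_intros U V)
  have "\<forall>\<^sub>F n in F. (\<Sum>i\<in>Basis. \<Sum>j\<in>Basis. (U n \<bullet> i) * (V n \<bullet> j) * G (X n) (tv c (X n) i) (tv c (X n) j))
    = G (X n) (tv c (X n) (U n)) (tv c (X n) (V n))"
    using ev by (rule eventually_mono) (rule G_tvec_expand[OF c(1), symmetric])
  from Lim_transform_eventually[OF lim this] show ?thesis
    by (subst G_tvec_expand[OF c])
qed

lemma tendsto_rnorm:
  assumes "c \<in> A" "x \<in> cdom c" "(X \<longlongrightarrow> x) F" "(U \<longlongrightarrow> u) F"
  shows "((\<lambda>n. rnorm G (X n) (tv c (X n) (U n))) \<longlongrightarrow> rnorm G x (tv c x u)) F"
  unfolding rnorm_def by (intro tendsto_real_sqrt tendsto_G assms)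

text \<open>The norm is continuous and positive on the compact product of a closed coordinate ball
  and the unit sphere. Its minimum and maximum there are \<open>m\<close> and \<open>B\<close>, and
  homogeneity extends the bounds to all \<open>u\<close>.\<close>

lemma rnorm_chart_equiv:
  assumes c: "c \<in> A" "x \<in> cdom c"
  obtains r m B where "r > 0" "m > 0" "B > 0" "cball (cmap c x) r \<subseteq> cmap c ` cdom c"
    "\<And>a u. a \<in> cball (cmap c x) r \<Longrightarrow> m * norm u \<le> rnorm G (cinv c a) (tv c (cinv c a) u)"
    "\<And>a u. a \<in> cball (cmap c x) r \<Longrightarrow> rnorm G (cinv c a) (tv c (cinv c a) u) \<le> B * norm u"
proof -
  obtain r where r: "r > 0" "cball (cmap c x) r \<subseteq> cmap c ` cdom c"
    using open_cimage[OF c(1)] c(2) open_contains_cball_eq by blast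
  define n where "n = (\<lambda>(a, u). rnorm G (cinv c a) (tv c (cinv c a) u))"
  let ?K = "cball (cmap c x) r \<times> sphere (0::'e) 1"
  have cont: "continuous_on ?K n"
  proof -
    have "isCont n p" if p: "fst p \<in> cmap c ` cdom c" for p
    proof -
      have f1: "(fst \<longlongrightarrow> fst p) (at p)" and f2: "(snd \<longlongrightarrow> snd p) (at p)"
        by (auto intro: tendsto_intros)
      have cp: "((\<lambda>q. cinv c (fst q)) \<longlongrightarrow> cinv c (fst p)) (at p)"
        by (rule isCont_tendsto_compose[OF isCont_cinv f1]) (use p c in auto)
      have "((\<lambda>q. rnorm G (cinv c (fst q)) (tv c (cinv c (fst q)) (snd q)))
          \<longlongrightarrow> rnorm G (cinv c (fst p)) (tv c (cinv c (fst p)) (snd p))) (at p)"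
        by (rule tendsto_rnorm[OF c(1) _ cp f2]) (use p c in auto)
      then show ?thesis unfolding isCont_def n_def by (simp add: case_prod_unfold)
    qed
    then show ?thesis
      using r(2) by (intro continuous_at_imp_continuous_on) force
  qed
  have K: "compact ?K" by (intro compact_Times) auto
  obtain b :: 'e where b: "b \<in> Basis" using nonempty_Basis by blast
  then have ne: "?K \<noteq> {}" using r(1) by force
  obtain p where p: "p \<in> ?K" "\<And>q. q \<in> ?K \<Longrightarrow> n p \<le> n q"
    using continuous_attains_inf[OF K ne cont] by blast
  obtain p' where p': "p' \<in> ?K" "\<And>q. q \<in> ?K \<Longrightarrow> n q \<le> n p'"
    using continuous_attains_sup[OF K ne cont] by blast
  have pos: "n q > 0" if "q \<in> ?K" for q
  proof -
    obtain a u where q: "q = (a, u)" by fastforce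
    then have a: "a \<in> cmap c ` cdom c" and u: "u \<noteq> 0" using that r by auto
    have "tv c (cinv c a) u \<noteq> 0"
      using tvec_of_coord[of c "cinv c a" u] a c u by fastforce
    then show ?thesis
      using rnorm_nonneg[of "tv c (cinv c a) u" "cinv c a"] rnorm_eq_0[of "tv c (cinv c a) u" "cinv c a"] a c
      by (simp add: n_def q less_le)
  qed
  have eq: "rnorm G (cinv c a) (tv c (cinv c a) u) = n (a, u /\<^sub>R norm u) * norm u"
    if "a \<in> cball (cmap c x) r" "u \<noteq> 0" for a u
    using that r c subsetD[OF r(2) that(1)] by (simp add: n_def tvec_of_scaleR rnorm_scaleR)
  show thesis
  proof
    fix a and u :: 'e assume a: "a \<in> cball (cmap c x) r"
    have z: "rnorm G (cinv c a) (tv c (cinv c a) 0) = 0"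
      using subsetD[OF r(2) a] c by (simp add: rnorm_def)
    show "n p * norm u \<le> rnorm G (cinv c a) (tv c (cinv c a) u)"
      using eq[OF a, of u] p(2)[of "(a, u /\<^sub>R norm u)"] a z
      by (cases "u = 0") (auto intro: mult_right_mono)
    show "rnorm G (cinv c a) (tv c (cinv c a) u) \<le> n p' * norm u"
      using eq[OF a, of u] p'(2)[of "(a, u /\<^sub>R norm u)"] a z
      by (cases "u = 0") (auto intro: mult_right_mono)
  qed (use r p p' pos in auto)
qed

text \<open>\<open>T\<close> is the Gram operator of the metric in coordinates. Positive
  definiteness makes it injective, hence surjective in finite dimension, and a preimage of the
  coefficient vector of \<open>l\<close> represents \<open>l\<close>.\<close>

lemma Riesz:
  assumes c: "c \<in> A" "x \<in> cdom c" and l: "linear (l :: 'e \<Rightarrow> real)"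
  obtains v where "v \<in> TM x" "\<And>u. G x v (tv c x u) = l u"
proof -
  define T where "T = (\<lambda>u. \<Sum>j\<in>Basis. G x (tv c x u) (tv c x j) *\<^sub>R j)"
  have linT: "linear T"
    unfolding T_def using c
    by (intro linearI)
       (auto simp: tvec_of_add tvec_of_scaleR G_add_left G_scaleR_left algebra_simps sum.distrib scaleR_sum_right)
  have R: "linear (\<lambda>v. G x w (tv c x v))" if "w \<in> TM x" for w
    using that c by (intro linearI) (auto simp: tvec_of_add tvec_of_scaleR G_add_right G_scaleR_right)
  have exp: "G x (tv c x w) (tv c x u) = T w \<bullet> u" for u w
  proof -
    have "G x (tv c x w) (tv c x u)
        = G x (tv c x w) (tv c x (\<Sum>j\<in>Basis. (u \<bullet> j) *\<^sub>R j))"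
      by (simp add: euclidean_representation)
    also have "\<dots> = (\<Sum>j\<in>Basis. (u \<bullet> j) * G x (tv c x w) (tv c x j))"
      by (simp add: linear_sum[OF R[OF tvec_of_in[OF c]]] linear_scale[OF R[OF tvec_of_in[OF c]]] del: euclidean_representation)
    also have "\<dots> = T w \<bullet> u"
      by (simp add: T_def inner_sum_left inner_commute[of u] mult.commute)
    finally show ?thesis .
  qed
  have "u = 0" if "T u = 0" for u
  proof (rule ccontr)
    assume "u \<noteq> 0"
    then have "tv c x u \<noteq> 0"
      using tvec_of_coord[OF c, of u] by fastforce
    then show False
      using G_pos[of "tv c x u" x] exp[of u u] that c by simp
  qed
  then have "inj T" using linT linear_injective_0 by blast
  then have "surj T" using linT linear_injective_imp_surjective by blast
  then obtain w where w: "T w = (\<Sum>j\<in>Basis. l j *\<^sub>R j)" by (metis surjD)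
  have "T w \<bullet> u = l u" for u
  proof -
    have "l u = l (\<Sum>j\<in>Basis. (u \<bullet> j) *\<^sub>R j)" by (simp add: euclidean_representation)
    also have "\<dots> = (\<Sum>j\<in>Basis. (u \<bullet> j) * l j)"
      by (simp add: linear_sum[OF l] linear_scale[OF l] del: euclidean_representation)
    also have "\<dots> = T w \<bullet> u"
      by (simp add: w inner_sum_left inner_commute[of u] mult.commute)
    finally show ?thesis by simp
  qed
  then show thesis
    using exp c by (intro that[of "tv c x w"]) auto
qed

lemma G_ext:
  assumes "u \<in> TM x" "v \<in> TM x"
    and "\<And>w. w \<in> TM x \<Longrightarrow> G x u w = G x v w"
  shows "u = v"
proof -
  have d: "u - v \<in> TM x" using assms tangent_diff by blast
  then have "G x (u - v) (u - v) = 0"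
    using assms by (simp add: G_diff_left)
  then show ?thesis using G_pos[OF d] by force
qed

text \<open>Common source of the gradient, with \<open>b = 1\<close>, and of the adjoint of the
  differential; both are descriptions of this shape.\<close>

lemma Riesz_THE:
  fixes b :: "'b::real_inner"
  assumes f: "mdifferentiable f x"
  defines "w \<equiv> (THE v. v \<in> TM x \<and> (\<forall>u\<in>TM x. G x v u = b \<bullet> mdiff A f x u))"
  shows "w \<in> TM x \<and> (\<forall>u\<in>TM x. G x w u = b \<bullet> mdiff A f x u)"
proof -
  obtain c where c: "c \<in> A" "x \<in> cdom c" by (rule chart_around)
  have "linear (\<lambda>u. b \<bullet> mdiff A f x (tv c x u))"
    using linear_add[OF has_derivative_linear[OF mdifferentiableD[OF f c]]]
      linear_scale[OF has_derivative_linear[OF mdifferentiableD[OF f c]]]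
    by (intro linearI) (simp_all add: inner_add_right)
  then obtain v where v: "v \<in> TM x" "\<And>u. G x v (tv c x u) = b \<bullet> mdiff A f x (tv c x u)"
    using Riesz[OF c] by metis
  then have "\<forall>u\<in>TM x. G x v u = b \<bullet> mdiff A f x u"
    using tvec_of_tangent[OF c] by metis
  then have "\<exists>!v. v \<in> TM x \<and> (\<forall>u\<in>TM x. G x v u = b \<bullet> mdiff A f x u)"
    using v G_ext by (intro ex1I[of _ v]) auto
  from theI'[OF this] show ?thesis unfolding w_def .
qed

lemma grad_in: "mdifferentiable f x \<Longrightarrow> grad A G f x \<in> TM x"
  and G_grad: "mdifferentiable f x \<Longrightarrow> u \<in> TM x \<Longrightarrow> G x (grad A G f x) u = mdiff A f x u"
  using Riesz_THE[of f x 1] by (simp_all add: grad_def)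

lemma mdiff_adj_in: "mdifferentiable f x \<Longrightarrow> mdiff_adj A G f x w \<in> TM x"
  and G_mdiff_adj: "mdifferentiable f x \<Longrightarrow> u \<in> TM x \<Longrightarrow>
    G x (mdiff_adj A G f x w) u = w \<bullet> mdiff A f x u"
  using Riesz_THE[of f x w] by (simp_all add: mdiff_adj_def)

lemma rnorm_grad_le:
  assumes f: "mdifferentiable f x"
    and b: "\<And>u. u \<in> TM x \<Longrightarrow> \<bar>mdiff A f x u\<bar> \<le> e * rnorm G x u"
  shows "rnorm G x (grad A G f x) \<le> e"
proof (cases "grad A G f x = 0")
  case True
  obtain c where c: "c \<in> A" "x \<in> cdom c" by (rule chart_around)
  \<comment> \<open>A zero gradient leaves only \<open>0 \<le> e\<close> to show. The bound yields
    it at any nonzero tangent vector, and a basis vector of the model space provides one.\<close>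
  obtain i :: 'e where i: "i \<in> Basis" using nonempty_Basis by blast
  let ?v = "tv c x i"
  have "?v \<noteq> 0" using tvec_of_coord[OF c, of i] i by fastforce
  then have "rnorm G x ?v > 0"
    using c rnorm_nonneg[of ?v x] rnorm_eq_0[of ?v x] by (simp add: less_le)
  moreover have "0 \<le> e * rnorm G x ?v" using b[of ?v] c by fastforce
  ultimately have "e \<ge> 0" by (simp add: zero_le_mult_iff)
  then show ?thesis using True by (simp add: rnorm_def)
next
  case False
  have "(rnorm G x (grad A G f x))\<^sup>2 \<le> e * rnorm G x (grad A G f x)"
    using b[OF grad_in[OF f]] G_grad[OF f grad_in[OF f]] rnorm_square[OF grad_in[OF f]] by simp
  moreover have "rnorm G x (grad A G f x) > 0"
    using False rnorm_eq_0[OF grad_in[OF f]] rnorm_nonneg[OF grad_in[OF f]] by linarith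
  ultimately show ?thesis by (simp add: power2_eq_square)
qed

lemma abs_mdiff_le:
  "mdifferentiable f x \<Longrightarrow> u \<in> TM x \<Longrightarrow>
    \<bar>mdiff A f x u\<bar> \<le> rnorm G x (grad A G f x) * rnorm G x u"
  using G_Cauchy_Schwarz[OF grad_in] G_grad by metis

lemma grad_eq_0:
  assumes "mdifferentiable f x" "\<And>u. u \<in> TM x \<Longrightarrow> mdiff A f x u = 0"
  shows "grad A G f x = 0"
  using G_ext[OF grad_in[OF assms(1)] tangent_0] G_grad[OF assms(1)] assms(2) by simp

end

section \<open>Lengths of curves\<close>

context riemannian_manifold
begin

text \<open>Differentiation is relative to \<open>S\<close>, so that the value at the end points of
  a smooth piece is the one-sided derivative; \<open>velocity\<close> is the instance
  \<open>S = {0..1}\<close>.\<close>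

definition vel :: "(real \<Rightarrow> 'p) \<Rightarrow> real set \<Rightarrow> real \<Rightarrow> ('p, 'e) tvec" where
  "vel \<gamma> S t = (\<lambda>c. if c \<in> A \<and> \<gamma> t \<in> cdom c
     then vector_derivative (cmap c \<circ> \<gamma>) (at t within S) else 0)"

definition speed :: "(real \<Rightarrow> 'p) \<Rightarrow> real set \<Rightarrow> real \<Rightarrow> real" where
  "speed \<gamma> S t = rnorm G (\<gamma> t) (vel \<gamma> S t)"

definition len :: "(real \<Rightarrow> 'p) \<Rightarrow> real \<Rightarrow> real \<Rightarrow> real" where
  "len \<gamma> a b = integral {a..b} (speed \<gamma> {a..b})"

lemma at_within_Icc_neq_bot: "a < b \<Longrightarrow> t \<in> {a..b} \<Longrightarrow> at t within {a..b} \<noteq> bot" for a b t :: real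
  by (simp add: trivial_limit_within islimpt_Icc)

lemma has_vector_derivative_chart:
  assumes c: "c \<in> A" "c' \<in> A" "\<gamma> t \<in> cdom c" "\<gamma> t \<in> cdom c'" and t: "t \<in> S"
    and cont: "continuous (at t within S) \<gamma>"
    and u: "((cmap c \<circ> \<gamma>) has_vector_derivative u) (at t within S)"
  shows "((cmap c' \<circ> \<gamma>) has_vector_derivative dtrans c c' (\<gamma> t) u) (at t within S)"
proof -
  have "((cmap c' \<circ> cinv c) has_derivative dtrans c c' (\<gamma> t)) (at ((cmap c \<circ> \<gamma>) t) within (cmap c \<circ> \<gamma>) ` S)"
    using transition_derivative[OF c(1,2,3,4)] by (simp add: has_derivative_at_withinI)
  from vector_derivative_diff_chain_within[OF u this]
  have d: "((cmap c' \<circ> cinv c \<circ> (cmap c \<circ> \<gamma>)) has_vector_derivative dtrans c c' (\<gamma> t) u) (at t within S)" .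
  have "(\<gamma> \<longlongrightarrow> \<gamma> t) (at t within S)" using cont by (simp add: continuous_within)
  then have "\<forall>\<^sub>F s in at t within S. \<gamma> s \<in> cdom c"
    by (rule topological_tendstoD[OF _ open_cdom[OF c(1)] c(3)])
  then obtain e where e: "e > 0" "\<And>s. s \<in> S \<Longrightarrow> dist s t < e \<Longrightarrow> \<gamma> s \<in> cdom c"
    unfolding eventually_at using c(3) by metis
  show ?thesis
    by (rule has_vector_derivative_transform_within[OF d e(1) t]) (use e c in simp)
qed

lemma vel_eq:
  assumes c: "c \<in> A" "\<gamma> t \<in> cdom c" and t: "t \<in> S" "at t within S \<noteq> bot"
    and cont: "continuous (at t within S) \<gamma>"
    and u: "((cmap c \<circ> \<gamma>) has_vector_derivative u) (at t within S)"
  shows "vel \<gamma> S t = tv c (\<gamma> t) u"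
proof
  fix c'
  show "vel \<gamma> S t c' = tv c (\<gamma> t) u c'"
    using has_vector_derivative_chart[of c c' \<gamma> t S u] assms vector_derivative_within[OF t(2)]
    by (auto simp: vel_def tvec_of_def)
qed

lemma C1_curve_cont: "C1_curve_on A \<gamma> a b \<Longrightarrow> t \<in> {a..b} \<Longrightarrow> continuous (at t within {a..b}) \<gamma>"
  by (simp add: C1_curve_on_def continuous_on_eq_continuous_within)

lemma C1_curve_derivative:
  assumes "C1_curve_on A \<gamma> a b" "t \<in> {a..b}" "c \<in> A" "\<gamma> t \<in> cdom c"
  shows "((cmap c \<circ> \<gamma>) has_vector_derivative vel \<gamma> {a..b} t c) (at t within {a..b})"
  using assms by (auto simp: C1_curve_on_def vel_def vector_derivative_works[symmetric])

lemma C1_curve_vel: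
  assumes "C1_curve_on A \<gamma> a b" "a < b" "t \<in> {a..b}" "c \<in> A" "\<gamma> t \<in> cdom c"
  shows "vel \<gamma> {a..b} t = tv c (\<gamma> t) (vel \<gamma> {a..b} t c)"
  by (rule vel_eq[where S="{a..b}" and \<gamma>=\<gamma> and t=t])
     (use assms at_within_Icc_neq_bot C1_curve_cont C1_curve_derivative in blast)+

lemma C1_curve_vel_in:
  assumes "C1_curve_on A \<gamma> a b" "a < b" "t \<in> {a..b}"
  shows "vel \<gamma> {a..b} t \<in> TM (\<gamma> t)"
  using chart_around C1_curve_vel[OF assms] tvec_of_in by metis

text \<open>Entry point for all constructions of curves (restriction, reparametrization, coordinate
  segments): explicit one-sided derivatives replace \<open>vector_derivative\<close>, and the second
  part identifies the velocity with them.\<close>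

lemma C1_curve_onI:
  assumes cont: "continuous_on {a..b} \<gamma>"
    and D: "\<And>c t. c \<in> A \<Longrightarrow> t \<in> {a..b} \<Longrightarrow> \<gamma> t \<in> cdom c \<Longrightarrow>
      ((cmap c \<circ> \<gamma>) has_vector_derivative D c t) (at t within {a..b})"
    and ab: "a < b"
    and cD: "\<And>c. c \<in> A \<Longrightarrow> continuous_on {t \<in> {a..b}. \<gamma> t \<in> cdom c} (D c)"
  shows "C1_curve_on A \<gamma> a b" "\<And>c t. c \<in> A \<Longrightarrow> t \<in> {a..b} \<Longrightarrow> \<gamma> t \<in> cdom c \<Longrightarrow> vel \<gamma> {a..b} t c = D c t"
proof -
  have v: "vector_derivative (cmap c \<circ> \<gamma>) (at t within {a..b}) = D c t"
    if "c \<in> A" "t \<in> {a..b}" "\<gamma> t \<in> cdom c" for c t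
    using vector_derivative_within[OF at_within_Icc_neq_bot D] ab that by blast
  show "C1_curve_on A \<gamma> a b"
    unfolding C1_curve_on_def
  proof (intro conjI cont ballI)
    fix c assume c: "c \<in> A"
    show "(cmap c \<circ> \<gamma>) differentiable (at t within {a..b})" if "t \<in> {t \<in> {a..b}. \<gamma> t \<in> cdom c}" for t
      using D[OF c] that differentiableI_vector by blast
    show "continuous_on {t \<in> {a..b}. \<gamma> t \<in> cdom c} (\<lambda>t. vector_derivative (cmap c \<circ> \<gamma>) (at t within {a..b}))"
      using cD[OF c] by (rule continuous_on_eq) (use v c in auto)
  qed
  show "vel \<gamma> {a..b} t c = D c t" if "c \<in> A" "t \<in> {a..b}" "\<gamma> t \<in> cdom c" for c t
    using v that by (simp add: vel_def)
qed

lemma C1_curve_vel_cont: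
  assumes C: "C1_curve_on A \<gamma> a b" and c: "c \<in> A"
  shows "continuous_on {t \<in> {a..b}. \<gamma> t \<in> cdom c} (\<lambda>t. vel \<gamma> {a..b} t c)"
proof -
  have "continuous_on {t \<in> {a..b}. \<gamma> t \<in> cdom c} (\<lambda>t. vector_derivative (cmap c \<circ> \<gamma>) (at t within {a..b}))"
    using C c by (simp add: C1_curve_on_def)
  then show ?thesis
    by (rule continuous_on_eq) (simp add: vel_def c)
qed

lemma speed_continuous:
  assumes C: "C1_curve_on A \<gamma> a b" and ab: "a < b"
  shows "continuous_on {a..b} (speed \<gamma> {a..b})"
  unfolding continuous_on_def
proof
  fix t assume t: "t \<in> {a..b}"
  let ?F = "at t within {a..b}"
  obtain c where c: "c \<in> A" "\<gamma> t \<in> cdom c" by (rule chart_around)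
  have X: "(\<gamma> \<longlongrightarrow> \<gamma> t) ?F"
    using C1_curve_cont[OF C t] by (simp add: continuous_within)
  have ev: "\<forall>\<^sub>F s in ?F. \<gamma> s \<in> cdom c"
    using X open_cdom c topological_tendstoD by metis
  have "continuous_on {a..b} \<gamma>" using C by (simp add: C1_curve_on_def)
  then have "openin (top_of_set {a..b}) ({a..b} \<inter> \<gamma> -` cdom c)"
    by (rule continuous_openin_preimage_gen[OF _ open_cdom[OF c(1)]])
  then obtain U where U: "open U" "{a..b} \<inter> \<gamma> -` cdom c = {a..b} \<inter> U"
    unfolding openin_open by blast
  have tU: "t \<in> U" using t c(2) U(2) by blast
  have sets: "{s \<in> {a..b}. \<gamma> s \<in> cdom c} = {a..b} \<inter> \<gamma> -` cdom c" by auto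
  \<comment> \<open>Continuity of the coordinate velocity is known only on the times spent in the
    chart. These form a relatively open set around \<open>t\<close>, so the filter at
    \<open>t\<close> is the same as on the whole interval.\<close>
  have "at t within {s \<in> {a..b}. \<gamma> s \<in> cdom c} = ?F"
    unfolding sets U(2) by (rule at_within_nhd[OF tU U(1)]) auto
  moreover have "((\<lambda>s. vel \<gamma> {a..b} s c) \<longlongrightarrow> vel \<gamma> {a..b} t c) (at t within {s \<in> {a..b}. \<gamma> s \<in> cdom c})"
    using C1_curve_vel_cont[OF C c(1)] t c by (simp add: continuous_on_def)
  ultimately have V: "((\<lambda>s. vel \<gamma> {a..b} s c) \<longlongrightarrow> vel \<gamma> {a..b} t c) ?F"
    by simp
  have lim: "((\<lambda>s. rnorm G (\<gamma> s) (tv c (\<gamma> s) (vel \<gamma> {a..b} s c)))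
      \<longlongrightarrow> rnorm G (\<gamma> t) (tv c (\<gamma> t) (vel \<gamma> {a..b} t c))) ?F"
    by (rule tendsto_rnorm[OF c X V])
  have eq: "rnorm G (\<gamma> s) (tv c (\<gamma> s) (vel \<gamma> {a..b} s c)) = speed \<gamma> {a..b} s"
    if "s \<in> {a..b}" "\<gamma> s \<in> cdom c" for s
    unfolding speed_def using C1_curve_vel[OF C ab that(1) c(1) that(2)] by simp
  have "\<forall>\<^sub>F s in ?F. s \<in> {a..b}" by (simp add: eventually_at_filter)
  then have "\<forall>\<^sub>F s in ?F. rnorm G (\<gamma> s) (tv c (\<gamma> s) (vel \<gamma> {a..b} s c)) = speed \<gamma> {a..b} s"
    using ev by eventually_elim (rule eq)
  from Lim_transform_eventually[OF lim this] show "(speed \<gamma> {a..b} \<longlongrightarrow> speed \<gamma> {a..b} t) ?F"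
    using eq[OF t c(2)] by simp
qed

lemma speed_integrable:
  "C1_curve_on A \<gamma> a b \<Longrightarrow> a < b \<Longrightarrow> speed \<gamma> {a..b} integrable_on {a..b}"
  using speed_continuous integrable_continuous_interval by blast

lemma speed_nonneg:
  "C1_curve_on A \<gamma> a b \<Longrightarrow> a < b \<Longrightarrow> t \<in> {a..b} \<Longrightarrow> speed \<gamma> {a..b} t \<ge> 0"
  unfolding speed_def using C1_curve_vel_in by simp

lemma len_nonneg: "C1_curve_on A \<gamma> a b \<Longrightarrow> a < b \<Longrightarrow> len \<gamma> a b \<ge> 0"
  unfolding len_def by (intro integral_nonneg speed_integrable speed_nonneg)

lemma C1_curve_subinterval:
  assumes C: "C1_curve_on A \<gamma> a b" and ab: "a \<le> a'" "a' < b'" "b' \<le> b"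
  shows "C1_curve_on A \<gamma> a' b'"
    and "\<And>t. t \<in> {a'..b'} \<Longrightarrow> speed \<gamma> {a'..b'} t = speed \<gamma> {a..b} t"
proof -
  have sub: "{a'..b'} \<subseteq> {a..b}" using ab by auto
  have 1: "continuous_on {a'..b'} \<gamma>"
    using C sub continuous_on_subset unfolding C1_curve_on_def by blast
  have 2: "((cmap c \<circ> \<gamma>) has_vector_derivative vel \<gamma> {a..b} t c) (at t within {a'..b'})"
    if "c \<in> A" "t \<in> {a'..b'}" "\<gamma> t \<in> cdom c" for c t
    using C1_curve_derivative[OF C _ that(1,3)] that(2) sub has_vector_derivative_within_subset by blast
  have 3: "continuous_on {t \<in> {a'..b'}. \<gamma> t \<in> cdom c} (\<lambda>t. vel \<gamma> {a..b} t c)" if "c \<in> A" for c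
    by (rule continuous_on_subset[OF C1_curve_vel_cont[OF C that]]) (use sub in auto)
  note I = C1_curve_onI[of a' b' \<gamma> "\<lambda>c t. vel \<gamma> {a..b} t c", OF 1 2 ab(2) 3]
  show "C1_curve_on A \<gamma> a' b'" using I(1) by simp
  have "vel \<gamma> {a'..b'} t = vel \<gamma> {a..b} t" if t: "t \<in> {a'..b'}" for t
  proof
    fix c show "vel \<gamma> {a'..b'} t c = vel \<gamma> {a..b} t c"
      using I(2)[of c t] t by (cases "c \<in> A \<and> \<gamma> t \<in> cdom c") (auto simp: vel_def)
  qed
  then show "speed \<gamma> {a'..b'} t = speed \<gamma> {a..b} t" if "t \<in> {a'..b'}" for t
    using that by (simp add: speed_def)
qed

lemma len_subinterval:
  assumes C: "C1_curve_on A \<gamma> a b" and ab: "a \<le> a'" "a' < b'" "b' \<le> b"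
  shows "len \<gamma> a' b' = integral {a'..b'} (speed \<gamma> {a..b})"
  unfolding len_def by (rule Henstock_Kurzweil_Integration.integral_cong) (rule C1_curve_subinterval(2)[OF assms])

lemma len_split:
  assumes C: "C1_curve_on A \<gamma> a b" and m: "a < m" "m < b"
  shows "len \<gamma> a b = len \<gamma> a m + len \<gamma> m b"
proof -
  have "len \<gamma> a m + len \<gamma> m b = integral {a..m} (speed \<gamma> {a..b}) + integral {m..b} (speed \<gamma> {a..b})"
    using m by (simp add: len_subinterval[OF C])
  also have "\<dots> = len \<gamma> a b"
    unfolding len_def using m speed_integrable[OF C]
    by (intro Henstock_Kurzweil_Integration.integral_combine) auto
  finally show ?thesis by simp
qed

text \<open>A negative \<open>m\<close> is allowed, so this covers the reversal of a curve as well
  as its transport to another interval.\<close>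

lemma C1_curve_affine:
  assumes C: "C1_curve_on A \<gamma> a b" and ab: "a < b" "a' < b'"
    and m: "m \<noteq> 0" and im: "(\<lambda>s. m * s + k) ` {a'..b'} = {a..b}"
  shows "C1_curve_on A (\<lambda>s. \<gamma> (m * s + k)) a' b'" (is "C1_curve_on A ?\<gamma> a' b'")
    and "len (\<lambda>s. \<gamma> (m * s + k)) a' b' = len \<gamma> a b"
proof -
  let ?\<phi> = "\<lambda>s. m * s + k"
  have \<phi>: "?\<phi> s \<in> {a..b}" if "s \<in> {a'..b'}" for s using im that by blast
  have 1: "continuous_on {a'..b'} ?\<gamma>"
    by (rule continuous_on_compose2[of "{a..b}" \<gamma>])
       (use C im in \<open>auto simp: C1_curve_on_def intro!: continuous_intros\<close>)
  have 2: "((cmap c \<circ> ?\<gamma>) has_vector_derivative m *\<^sub>R vel \<gamma> {a..b} (?\<phi> s) c) (at s within {a'..b'})"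
    if "c \<in> A" "s \<in> {a'..b'}" "?\<gamma> s \<in> cdom c" for c s
  proof -
    have "(?\<phi> has_vector_derivative m) (at s within {a'..b'})"
      by (auto intro!: derivative_eq_intros simp: has_vector_derivative_def)
    moreover have "((cmap c \<circ> \<gamma>) has_vector_derivative vel \<gamma> {a..b} (?\<phi> s) c) (at (?\<phi> s) within ?\<phi> ` {a'..b'})"
      using C1_curve_derivative[OF C \<phi>[OF that(2)] that(1,3)] im by simp
    ultimately have "((cmap c \<circ> \<gamma> \<circ> ?\<phi>) has_vector_derivative m *\<^sub>R vel \<gamma> {a..b} (?\<phi> s) c) (at s within {a'..b'})"
      by (rule vector_diff_chain_within)
    then show ?thesis by (simp add: o_def)
  qed
  have 3: "continuous_on {s \<in> {a'..b'}. ?\<gamma> s \<in> cdom c} (\<lambda>s. m *\<^sub>R vel \<gamma> {a..b} (?\<phi> s) c)" if "c \<in> A" for c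
    by (intro continuous_on_scaleR continuous_on_const continuous_on_compose2[OF C1_curve_vel_cont[OF C that]])
       (use \<phi> in \<open>auto intro!: continuous_intros\<close>)
  note I = C1_curve_onI[of a' b' ?\<gamma> "\<lambda>c s. m *\<^sub>R vel \<gamma> {a..b} (?\<phi> s) c", OF 1 2 ab(2) 3]
  show "C1_curve_on A ?\<gamma> a' b'" using I(1) by simp
  have v: "vel ?\<gamma> {a'..b'} s = m *\<^sub>R vel \<gamma> {a..b} (?\<phi> s)" if s: "s \<in> {a'..b'}" for s
  proof
    fix c show "vel ?\<gamma> {a'..b'} s c = (m *\<^sub>R vel \<gamma> {a..b} (?\<phi> s)) c"
      using I(2)[of c s] s by (cases "c \<in> A \<and> ?\<gamma> s \<in> cdom c") (auto simp: vel_def)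
  qed
  have sp: "speed ?\<gamma> {a'..b'} s = \<bar>m\<bar> * speed \<gamma> {a..b} (?\<phi> s)" if "s \<in> {a'..b'}" for s
    unfolding speed_def v[OF that] using C1_curve_vel_in[OF C ab(1) \<phi>[OF that]] by (simp add: rnorm_scaleR)
  \<comment> \<open>\<open>has_integral_affinity\<close> returns its domain as the image under the
    inverse affine map; here it is identified with the interval of parameters.\<close>
  have inv: "(\<lambda>x. (1 / m) *\<^sub>R x + - ((1 / m) *\<^sub>R k)) ` cbox a b = {a'..b'}"
  proof -
    have "(\<lambda>x. (1 / m) *\<^sub>R x + - ((1 / m) *\<^sub>R k)) ` cbox a b
        = (\<lambda>x. (1 / m) *\<^sub>R x + - ((1 / m) *\<^sub>R k)) ` ?\<phi> ` {a'..b'}"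
      using im by simp
    also have "\<dots> = (\<lambda>s. s) ` {a'..b'}"
      unfolding image_image using m by (intro image_cong refl) (simp add: field_simps)
    finally show ?thesis by simp
  qed
  have "(speed \<gamma> {a..b} has_integral len \<gamma> a b) (cbox a b)"
    unfolding len_def using speed_integrable[OF C ab(1)] by (simp add: integrable_integral)
  from has_integral_affinity[OF this m, of k]
  have "((\<lambda>s. speed \<gamma> {a..b} (?\<phi> s)) has_integral (1 / \<bar>m\<bar>) * len \<gamma> a b) {a'..b'}"
    unfolding inv by simp
  from has_integral_mult_right[OF this, of "\<bar>m\<bar>"]
  have "((\<lambda>s. \<bar>m\<bar> * speed \<gamma> {a..b} (?\<phi> s)) has_integral len \<gamma> a b) {a'..b'}"
    using m by simp
  then have "(speed ?\<gamma> {a'..b'} has_integral len \<gamma> a b) {a'..b'}"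
    by (rule has_integral_eq[rotated]) (simp add: sp)
  then show "len ?\<gamma> a' b' = len \<gamma> a b"
    by (simp add: len_def integral_unique)
qed

lemma C1_curve_cong:
  assumes C: "C1_curve_on A \<gamma> a b" and ab: "a < b" and eq: "\<And>t. t \<in> {a..b} \<Longrightarrow> \<gamma>' t = \<gamma> t"
  shows "C1_curve_on A \<gamma>' a b" and "len \<gamma>' a b = len \<gamma> a b"
proof -
  have "continuous_on {a..b} \<gamma>" using C unfolding C1_curve_on_def by blast
  then have 1: "continuous_on {a..b} \<gamma>'" by (rule continuous_on_eq) (rule eq[symmetric])
  have 2: "((cmap c \<circ> \<gamma>') has_vector_derivative vel \<gamma> {a..b} t c) (at t within {a..b})"
    if "c \<in> A" "t \<in> {a..b}" "\<gamma>' t \<in> cdom c" for c t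
    by (rule has_vector_derivative_transform[OF that(2) _ C1_curve_derivative[OF C that(2,1)]])
       (use eq that in auto)
  have 3: "continuous_on {t \<in> {a..b}. \<gamma>' t \<in> cdom c} (\<lambda>t. vel \<gamma> {a..b} t c)" if "c \<in> A" for c
    by (rule continuous_on_subset[OF C1_curve_vel_cont[OF C that]]) (use eq in auto)
  note I = C1_curve_onI[of a b \<gamma>' "\<lambda>c t. vel \<gamma> {a..b} t c", OF 1 2 ab 3]
  show "C1_curve_on A \<gamma>' a b" using I(1) by simp
  have "vel \<gamma>' {a..b} t = vel \<gamma> {a..b} t" if t: "t \<in> {a..b}" for t
  proof
    fix c show "vel \<gamma>' {a..b} t c = vel \<gamma> {a..b} t c"
      using I(2)[of c t] t eq[OF t] by (cases "c \<in> A \<and> \<gamma> t \<in> cdom c") (auto simp: vel_def)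
  qed
  then show "len \<gamma>' a b = len \<gamma> a b"
    unfolding len_def speed_def using eq by (intro Henstock_Kurzweil_Integration.integral_cong) simp
qed

text \<open>These are the lengths of piecewise smooth paths between two points, without partitions
  and without a fixed parameter interval; \<open>rdist_eq\<close> shows that the distance is the
  infimum of exactly these numbers.\<close>

inductive joins :: "'p \<Rightarrow> 'p \<Rightarrow> real \<Rightarrow> bool" where
  joins_C1: "a < b \<Longrightarrow> C1_curve_on A \<gamma> a b \<Longrightarrow> joins (\<gamma> a) (\<gamma> b) (len \<gamma> a b)"
| joins_trans: "joins p q L \<Longrightarrow> joins q r L' \<Longrightarrow> joins p r (L + L')"

lemma joins_nonneg: "joins p q L \<Longrightarrow> L \<ge> 0"
  by (induction rule: joins.induct) (auto simp: len_nonneg)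

lemma joins_sym: "joins p q L \<Longrightarrow> joins q p L"
proof (induction rule: joins.induct)
  case (joins_C1 a b \<gamma>)
  have "(\<lambda>s. -1 * s + 0) ` {-b..-a} = {a..b}" by simp
  from joins.joins_C1[of "-b" "-a", OF _ C1_curve_affine(1)[OF joins_C1(2,1) _ _ this]]
    C1_curve_affine(2)[OF joins_C1(2,1) _ _ this]
  show ?case using joins_C1(1) by simp
next
  case (joins_trans p q L r L')
  then show ?case using joins.joins_trans[of r q L' p L] by (simp add: add.commute)
qed

text \<open>On one smooth piece the arc length from the start depends continuously on the end time,
  so the intermediate value theorem applies. In a concatenation the point lies in the first part, at
  the junction or in the second part.\<close>

lemma joins_split:
  assumes "joins p q L" "0 < s" "s < L"
  shows "\<exists>m. joins p m s \<and> joins m q (L - s)"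
  using assms
proof (induction arbitrary: s rule: joins.induct)
  case (joins_C1 a b \<gamma>)
  note C = joins_C1(2)
  let ?I = "\<lambda>t. integral {a..t} (speed \<gamma> {a..b})"
  have "continuous_on {a..b} ?I"
    by (rule indefinite_integral_continuous_1[OF speed_integrable[OF C joins_C1(1)]])
  moreover have "?I a = 0" by simp
  moreover have "?I b = len \<gamma> a b" by (simp add: len_def)
  ultimately obtain t where t: "a \<le> t" "t \<le> b" "?I t = s"
    using IVT'[of ?I a s b] joins_C1 by auto
  have "t \<noteq> a" "t \<noteq> b" using t joins_C1 by (auto simp: len_def)
  then have t': "a < t" "t < b" using t by auto
  have "len \<gamma> a t = s" using len_subinterval[OF C order.refl t'(1)] t by simp
  moreover have "len \<gamma> t b = len \<gamma> a b - s" using len_split[OF C t'] calculation by simp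
  moreover have "joins (\<gamma> a) (\<gamma> t) (len \<gamma> a t)" "joins (\<gamma> t) (\<gamma> b) (len \<gamma> t b)"
    using C1_curve_subinterval(1)[OF C] t' by (auto intro!: joins.joins_C1)
  ultimately show ?case by auto
next
  case (joins_trans p q L r L')
  consider "s < L" | "s = L" | "L < s" by linarith
  then show ?case
  proof cases
    case 1
    then obtain m where "joins p m s" "joins m q (L - s)" using joins_trans by blast
    then show ?thesis using joins.joins_trans[OF _ joins_trans.hyps(2), of m "L - s"] by (auto simp: algebra_simps)
  next
    case 2
    then show ?thesis using joins_trans by auto
  next
    case 3
    then obtain m where "joins q m (s - L)" "joins m r (L' - (s - L))"
      using joins_trans.IH(2)[of "s - L"] joins_trans.prems by fastforce
    then show ?thesis using joins.joins_trans[OF joins_trans.hyps(1), of m "s - L"] by (auto simp: algebra_simps)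
  qed
qed

section \<open>Back from \<open>joins\<close> to piecewise smooth curves on the unit
  interval\<close>

definition pieces :: "(real \<Rightarrow> 'p) \<Rightarrow> nat \<Rightarrow> (nat \<Rightarrow> real) \<Rightarrow> bool" where
  "pieces \<gamma> n \<tau> \<longleftrightarrow> (\<forall>i<n. \<tau> i < \<tau> (Suc i) \<and> C1_curve_on A \<gamma> (\<tau> i) (\<tau> (Suc i)))"

lemma pieces_mono:
  assumes "pieces \<gamma> n \<tau>" shows "i \<le> j \<Longrightarrow> j \<le> n \<Longrightarrow> \<tau> i \<le> \<tau> j"
proof (induction j)
  case (Suc j)
  have "\<tau> j < \<tau> (Suc j)" using assms Suc.prems by (simp add: pieces_def)
  then show ?case using Suc by (cases "i = Suc j") auto
qed simp

definition seg :: "(real \<Rightarrow> 'p) \<Rightarrow> real \<Rightarrow> real \<Rightarrow> real \<Rightarrow> bool" where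
  "seg \<gamma> a b L \<longleftrightarrow> (\<exists>n \<tau>. \<tau> 0 = a \<and> \<tau> n = b \<and> pieces \<gamma> n \<tau> \<and> L = (\<Sum>i<n. len \<gamma> (\<tau> i) (\<tau> (Suc i))))"

lemma seg_trans:
  assumes "seg \<gamma> a m L" "seg \<gamma> m b L'" shows "seg \<gamma> a b (L + L')"
proof -
  obtain n \<tau> where 1: "\<tau> 0 = a" "\<tau> n = m" "pieces \<gamma> n \<tau>" "L = (\<Sum>i<n. len \<gamma> (\<tau> i) (\<tau> (Suc i)))"
    using assms unfolding seg_def by blast
  obtain n' \<tau>' where 2: "\<tau>' 0 = m" "\<tau>' n' = b" "pieces \<gamma> n' \<tau>'" "L' = (\<Sum>i<n'. len \<gamma> (\<tau>' i) (\<tau>' (Suc i)))"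
    using assms unfolding seg_def by blast
  define \<rho> where "\<rho> = (\<lambda>i. if i \<le> n then \<tau> i else \<tau>' (i - n))"
  have r1: "\<rho> i = \<tau> i" "\<rho> (Suc i) = \<tau> (Suc i)" if "i < n" for i using that by (auto simp: \<rho>_def)
  have r2: "\<rho> (n + i) = \<tau>' i" for i using 1 2 by (auto simp: \<rho>_def)
  have r2': "\<rho> (Suc (n + i)) = \<tau>' (Suc i)" for i using r2[of "Suc i"] by simp
  have "\<rho> i < \<rho> (Suc i) \<and> C1_curve_on A \<gamma> (\<rho> i) (\<rho> (Suc i))" if "i < n + n'" for i
  proof (cases "i < n")
    case True
    then show ?thesis using 1(3) r1 by (simp add: pieces_def)
  next
    case False
    define j where "j = i - n"
    have "i = n + j" "j < n'" using that False by (auto simp: j_def)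
    then show ?thesis using 2(3) r2 r2' by (simp add: pieces_def)
  qed
  then have "pieces \<gamma> (n + n') \<rho>" by (simp add: pieces_def)
  moreover have "(\<Sum>i<n + k. F i) = (\<Sum>i<n. F i) + (\<Sum>i<k. F (n + i))" for k and F :: "nat \<Rightarrow> real"
    by (induction k) simp_all
  then have "(\<Sum>i<n + n'. len \<gamma> (\<rho> i) (\<rho> (Suc i))) = L + L'"
    by (simp add: r1 r2 r2' 1(4) 2(4))
  moreover have "\<rho> 0 = a" "\<rho> (n + n') = b" using 1 2 r2 by (auto simp: \<rho>_def)
  ultimately show ?thesis unfolding seg_def by metis
qed

lemma seg_cong:
  assumes "seg \<gamma> a b L" "\<And>t. t \<in> {a..b} \<Longrightarrow> \<gamma>' t = \<gamma> t" shows "seg \<gamma>' a b L"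
proof -
  obtain n \<tau> where 1: "\<tau> 0 = a" "\<tau> n = b" "pieces \<gamma> n \<tau>" "L = (\<Sum>i<n. len \<gamma> (\<tau> i) (\<tau> (Suc i)))"
    using assms unfolding seg_def by blast
  have sub: "{\<tau> i..\<tau> (Suc i)} \<subseteq> {a..b}" if "i < n" for i
    using pieces_mono[OF 1(3), of 0 i] pieces_mono[OF 1(3), of "Suc i" n] that 1 by auto
  have "\<tau> i < \<tau> (Suc i)" "C1_curve_on A \<gamma>' (\<tau> i) (\<tau> (Suc i))"
    "len \<gamma>' (\<tau> i) (\<tau> (Suc i)) = len \<gamma> (\<tau> i) (\<tau> (Suc i))" if "i < n" for i
  proof -
    have C: "C1_curve_on A \<gamma> (\<tau> i) (\<tau> (Suc i))" "\<tau> i < \<tau> (Suc i)" using 1(3) that by (auto simp: pieces_def)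
    show "\<tau> i < \<tau> (Suc i)" "C1_curve_on A \<gamma>' (\<tau> i) (\<tau> (Suc i))"
      "len \<gamma>' (\<tau> i) (\<tau> (Suc i)) = len \<gamma> (\<tau> i) (\<tau> (Suc i))"
      using C1_curve_cong[OF C, of \<gamma>'] assms(2) sub[OF that] C by auto
  qed
  then show ?thesis unfolding seg_def using 1 by (intro exI[of _ n] exI[of _ \<tau>]) (auto simp: pieces_def)
qed

text \<open>The interval stays arbitrary in the induction: a single piece is transported to it
  affinely, and a concatenation places its two parts on the two halves.\<close>

lemma joins_seg:
  assumes "joins p q L" "a < b"
  shows "\<exists>\<gamma>. \<gamma> a = p \<and> \<gamma> b = q \<and> seg \<gamma> a b L"
  using assms
proof (induction arbitrary: a b rule: joins.induct)
  case (joins_C1 a0 b0 \<gamma>)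
  define m where "m = (b0 - a0) / (b - a)"
  define k where "k = a0 - m * a"
  have m: "m > 0" using joins_C1 by (simp add: m_def)
  have "m * (b - a) = b0 - a0" using joins_C1 by (simp add: m_def)
  then have e: "m * a + k = a0" "m * b + k = b0"
    by (simp_all add: k_def algebra_simps)
  have im: "(\<lambda>s. m * s + k) ` {a..b} = {a0..b0}"
    using image_affinity_atLeastAtMost[of m k a b] m joins_C1 e by simp
  note I = C1_curve_affine[OF joins_C1(2,1,3) _ im]
  have "seg (\<lambda>s. \<gamma> (m * s + k)) a b (len \<gamma> a0 b0)"
    unfolding seg_def using I m joins_C1
    by (intro exI[of _ 1] exI[of _ "\<lambda>i. if i = 0 then a else b"]) (simp add: pieces_def)
  then show ?case using e by (intro exI[of _ "\<lambda>s. \<gamma> (m * s + k)"]) simp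
next
  case (joins_trans p q L r L')
  let ?m = "(a + b) / 2"
  have m: "a < ?m" "?m < b" using joins_trans by auto
  obtain \<gamma>1 where 1: "\<gamma>1 a = p" "\<gamma>1 ?m = q" "seg \<gamma>1 a ?m L" using joins_trans m by blast
  obtain \<gamma>2 where 2: "\<gamma>2 ?m = q" "\<gamma>2 b = r" "seg \<gamma>2 ?m b L'" using joins_trans m by blast
  define \<gamma> where "\<gamma> = (\<lambda>t. if t \<le> ?m then \<gamma>1 t else \<gamma>2 t)"
  have "seg \<gamma> a ?m L" by (rule seg_cong[OF 1(3)]) (simp add: \<gamma>_def)
  moreover have "seg \<gamma> ?m b L'"
  proof (rule seg_cong[OF 2(3)])
    fix t assume "t \<in> {?m..b}"
    then show "\<gamma> t = \<gamma>2 t"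
      using 1(2) 2(1) unfolding \<gamma>_def by (cases "t = ?m") (simp_all only: atLeastAtMost_iff order.refl if_True, auto)
  qed
  ultimately have "seg \<gamma> a b (L + L')" by (rule seg_trans)
  moreover have "\<gamma> a = p" "\<gamma> b = r" using 1 2 m by (auto simp: \<gamma>_def)
  ultimately show ?case by blast
qed

text \<open>\<open>velocity\<close> differentiates within the unit interval and \<open>speed\<close>
  within a piece. The two agree in the interior of each piece, and the two end points do not affect
  the integral.\<close>

lemma curve_length_seg:
  assumes \<tau>: "\<tau> 0 = 0" "\<tau> n = 1" "pieces \<gamma> n \<tau>"
  shows "curve_length A G \<gamma> = (\<Sum>i<n. len \<gamma> (\<tau> i) (\<tau> (Suc i)))"
proof -
  let ?s = "\<lambda>t. rnorm G (\<gamma> t) (velocity A \<gamma> t)"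
  have "(?s has_integral (\<Sum>j<i. len \<gamma> (\<tau> j) (\<tau> (Suc j)))) {0..\<tau> i}" if "i \<le> n" for i
    using that
  proof (induction i)
    case 0
    then show ?case using \<tau> by (simp add: has_integral_refl)
  next
    case (Suc i)
    have C: "C1_curve_on A \<gamma> (\<tau> i) (\<tau> (Suc i))" "\<tau> i < \<tau> (Suc i)"
      using \<tau>(3) Suc by (auto simp: pieces_def)
    have b: "0 \<le> \<tau> i" "\<tau> (Suc i) \<le> 1"
      using pieces_mono[OF \<tau>(3), of 0 i] pieces_mono[OF \<tau>(3), of "Suc i" n] \<tau> Suc by auto
    have "(speed \<gamma> {\<tau> i..\<tau> (Suc i)} has_integral len \<gamma> (\<tau> i) (\<tau> (Suc i))) {\<tau> i..\<tau> (Suc i)}"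
      unfolding len_def using speed_integrable[OF C] by (rule integrable_integral)
    then have "(?s has_integral len \<gamma> (\<tau> i) (\<tau> (Suc i))) {\<tau> i..\<tau> (Suc i)}"
    proof (rule has_integral_spike_finite[rotated 2])
      show "finite {\<tau> i, \<tau> (Suc i)}" by simp
      fix t assume t: "t \<in> {\<tau> i..\<tau> (Suc i)} - {\<tau> i, \<tau> (Suc i)}"
      then have "at t within {0..1} = at t" "at t within {\<tau> i..\<tau> (Suc i)} = at t"
        using b by (auto intro!: at_within_Icc_at)
      then show "?s t = speed \<gamma> {\<tau> i..\<tau> (Suc i)} t"
        unfolding speed_def velocity_def vel_def by presburger
    qed
    with Suc have "(?s has_integral ((\<Sum>j<i. len \<gamma> (\<tau> j) (\<tau> (Suc j))) + len \<gamma> (\<tau> i) (\<tau> (Suc i)))) {0..\<tau> (Suc i)}"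
      using b C by (intro has_integral_combine[of 0 "\<tau> i" "\<tau> (Suc i)"]) auto
    then show ?case by simp
  qed
  from this[of n] show ?thesis
    using \<tau> by (simp add: curve_length_def integral_unique)
qed

lemma pieces_joins:
  assumes "pieces \<gamma> n \<tau>" "i < n"
  shows "joins (\<gamma> (\<tau> 0)) (\<gamma> (\<tau> (Suc i))) (\<Sum>j<Suc i. len \<gamma> (\<tau> j) (\<tau> (Suc j)))"
  using assms(2)
proof (induction i)
  case 0
  then show ?case using assms(1) joins_C1[of "\<tau> 0" "\<tau> (Suc 0)" \<gamma>] by (simp add: pieces_def)
next
  case (Suc i)
  have "joins (\<gamma> (\<tau> (Suc i))) (\<gamma> (\<tau> (Suc (Suc i)))) (len \<gamma> (\<tau> (Suc i)) (\<tau> (Suc (Suc i))))"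
    using assms(1) joins_C1 Suc by (simp add: pieces_def)
  from joins_trans[OF Suc.IH this] Suc show ?case by (simp add: add.assoc)
qed

lemma rdist_eq: "rdist A G p q = Inf {L. joins p q L}"
proof -
  have "{curve_length A G \<gamma> | \<gamma>. piecewise_C1_curve A \<gamma> \<and> \<gamma> 0 = p \<and> \<gamma> 1 = q} = {L. joins p q L}"
  proof (intro equalityI subsetI; clarsimp)
    fix \<gamma> assume "piecewise_C1_curve A \<gamma>"
    then obtain n \<tau> where n: "\<tau> 0 = 0" "\<tau> n = 1" "pieces \<gamma> n \<tau>"
      unfolding piecewise_C1_curve_def pieces_def by blast
    then obtain i where "n = Suc i" by (cases n) auto
    then show "joins (\<gamma> 0) (\<gamma> 1) (curve_length A G \<gamma>)"
      using pieces_joins[OF n(3), of i] n curve_length_seg[OF n] by simp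
  next
    fix L assume "joins p q L"
    then obtain \<gamma> where g: "\<gamma> 0 = p" "\<gamma> 1 = q" "seg \<gamma> 0 1 L"
      using joins_seg[of p q L 0 1] by auto
    then obtain n \<tau> where n: "\<tau> 0 = 0" "\<tau> n = 1" "pieces \<gamma> n \<tau>" "L = (\<Sum>i<n. len \<gamma> (\<tau> i) (\<tau> (Suc i)))"
      unfolding seg_def by blast
    then have "piecewise_C1_curve A \<gamma>"
      unfolding piecewise_C1_curve_def pieces_def by blast
    then show "\<exists>\<gamma>. L = curve_length A G \<gamma> \<and> piecewise_C1_curve A \<gamma> \<and> \<gamma> 0 = p \<and> \<gamma> 1 = q"
      using g n(4) curve_length_seg[OF n(1-3)] by (intro exI[of _ \<gamma>]) simp
  qed
  then show ?thesis by (simp add: rdist_def)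
qed

end

section \<open>Closed balls of a complete manifold\<close>

context riemannian_manifold
begin

text \<open>The straight coordinate segment has constant coordinate velocity \<open>a' - a\<close>,
  hence speed at most \<open>B * norm (a' - a)\<close>. This provides short paths to nearby points
  and thereby upper bounds for the distance.\<close>

lemma chart_segment_joins:
  assumes c: "c \<in> A" and K: "cball a\<^sub>0 r \<subseteq> cmap c ` cdom c"
    and B: "\<And>a u. a \<in> cball a\<^sub>0 r \<Longrightarrow> rnorm G (cinv c a) (tv c (cinv c a) u) \<le> B * norm u"
    and a: "a \<in> cball a\<^sub>0 r" "a' \<in> cball a\<^sub>0 r"
  shows "\<exists>L \<le> B * norm (a' - a). joins (cinv c a) (cinv c a') L"
proof -
  let ?l = "\<lambda>t. a + t *\<^sub>R (a' - a)"
  let ?\<gamma> = "\<lambda>t. cinv c (?l t)"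
  have l: "?l t \<in> cball a\<^sub>0 r" if "t \<in> {0..1}" for t
  proof -
    have "(1 - t) *\<^sub>R a + t *\<^sub>R a' \<in> cball a\<^sub>0 r"
      using convexD_alt[OF convex_cball a] that by auto
    then show ?thesis by (simp add: algebra_simps)
  qed
  then have l': "?l t \<in> cmap c ` cdom c" if "t \<in> {0..1}" for t using K that by blast
  have 1: "continuous_on {0..1} ?\<gamma>"
    by (rule continuous_on_compose2[OF continuous_cinv[OF c]]) (use l' in \<open>auto intro!: continuous_intros\<close>)
  have line: "((cmap c \<circ> ?\<gamma>) has_vector_derivative (a' - a)) (at t within {0..1})" if t: "t \<in> {0..1}" for t
  proof (rule has_vector_derivative_transform[OF t])
    show "(cmap c \<circ> ?\<gamma>) s = ?l s" if "s \<in> {0..1}" for s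
      using l'[OF that] c by simp
    show "(?l has_vector_derivative (a' - a)) (at t within {0..1})"
      by (auto intro!: derivative_eq_intros simp: has_vector_derivative_def)
  qed
  have 2: "((cmap c' \<circ> ?\<gamma>) has_vector_derivative dtrans c c' (?\<gamma> t) (a' - a)) (at t within {0..1})"
    if "c' \<in> A" "t \<in> {0..1}" "?\<gamma> t \<in> cdom c'" for c' t
    by (rule has_vector_derivative_chart[OF c that(1) _ that(3,2) _ line[OF that(2)]])
       (use 1 c l' that in \<open>auto simp: continuous_on_eq_continuous_within\<close>)
  have 3: "continuous_on {t \<in> {0..1}. ?\<gamma> t \<in> cdom c'} (\<lambda>t. dtrans c c' (?\<gamma> t) (a' - a))" if c': "c' \<in> A" for c'
    unfolding continuous_on_def
  proof
    fix t assume t: "t \<in> {t \<in> {0..1}. ?\<gamma> t \<in> cdom c'}"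
    let ?F = "at t within {t \<in> {0..1}. ?\<gamma> t \<in> cdom c'}"
    have "((\<lambda>s. frechet_derivative (cmap c' \<circ> cinv c) (at (?l s)) (a' - a))
        \<longlongrightarrow> frechet_derivative (cmap c' \<circ> cinv c) (at (?l t)) (a' - a)) ?F"
    proof (rule C1_derivative_tendsto[OF transition_C1[OF c c'] open_chart_image[OF c open_cdom[OF c']]])
      show "?l t \<in> cmap c ` (cdom c \<inter> cdom c')"
        using t l'[of t] c by force
    qed (intro tendsto_intros)+
    moreover have eq: "dtrans c c' (?\<gamma> s) = frechet_derivative (cmap c' \<circ> cinv c) (at (?l s))"
      if "s \<in> {0..1}" for s using l'[OF that] c by simp
    have "\<forall>\<^sub>F s in ?F. frechet_derivative (cmap c' \<circ> cinv c) (at (?l s)) (a' - a) = dtrans c c' (?\<gamma> s) (a' - a)"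
      unfolding eventually_at_filter by (rule always_eventually) (use eq in simp)
    ultimately show "((\<lambda>s. dtrans c c' (?\<gamma> s) (a' - a)) \<longlongrightarrow> dtrans c c' (?\<gamma> t) (a' - a)) ?F"
      using t eq[of t] Lim_transform_eventually by simp
  qed
  note I = C1_curve_onI[of 0 1 ?\<gamma> "\<lambda>c' t. dtrans c c' (?\<gamma> t) (a' - a)", OF 1 2 _ 3]
  have C: "C1_curve_on A ?\<gamma> 0 1" using I(1) by simp
  have "joins (?\<gamma> 0) (?\<gamma> 1) (len ?\<gamma> 0 1)"
    by (rule joins_C1[OF _ C]) simp
  moreover have "len ?\<gamma> 0 1 \<le> B * norm (a' - a)"
  proof -
    have "speed ?\<gamma> {0..1} t \<le> B * norm (a' - a)" if t: "t \<in> {0..1}" for t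
    proof -
      have "vel ?\<gamma> {0..1} t = tv c (?\<gamma> t) (a' - a)"
        using vel_eq[of c ?\<gamma> t "{0..1}" "a' - a", OF c _ t at_within_Icc_neq_bot[OF _ t] _ line[OF t]] 1 t l'[OF t] c
        by (simp add: continuous_on_eq_continuous_within)
      then show ?thesis unfolding speed_def using B[OF l[OF t]] by simp
    qed
    then have "integral {0..1} (speed ?\<gamma> {0..1}) \<le> integral {0..1} (\<lambda>t::real. B * norm (a' - a))"
      using speed_integrable[OF C] by (intro integral_le) auto
    then show ?thesis by (simp add: len_def)
  qed
  ultimately show ?thesis by auto
qed

text \<open>Leaving the coordinate ball costs length: while the curve is inside, its coordinate
  displacement is at most its length divided by \<open>m\<close>. A first exit time is impossible
  because the available length does not reach the boundary.\<close>

lemma C1_curve_chart_bound: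
  assumes c: "c \<in> A" and K: "cball a\<^sub>0 r \<subseteq> cmap c ` cdom c" and m: "m > 0"
    and lower: "\<And>a u. a \<in> cball a\<^sub>0 r \<Longrightarrow> m * norm u \<le> rnorm G (cinv c a) (tv c (cinv c a) u)"
    and C: "C1_curve_on A \<gamma> a b" and ab: "a < b"
    and start: "\<gamma> a \<in> cdom c" "dist a\<^sub>0 (cmap c (\<gamma> a)) + len \<gamma> a b / m < r"
  shows "\<gamma> b \<in> cdom c \<and> m * norm (cmap c (\<gamma> b) - cmap c (\<gamma> a)) \<le> len \<gamma> a b"
proof -
  define p where "p = cmap c (\<gamma> a)"
  define U where "U = {x \<in> cdom c. cmap c x \<in> ball a\<^sub>0 r}"
  \<comment> \<open>A closed ball strictly inside radius \<open>r\<close> that holds the coordinates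
    before an exit. Its image is compact, hence closed in the Hausdorff manifold, so the curve is
    still in it at the exit time itself.\<close>
  define K' where "K' = cball a\<^sub>0 (dist a\<^sub>0 p + len \<gamma> a b / m)"
  have oU: "open U" unfolding U_def by (rule open_chart_preimage[OF c open_ball])
  have len0: "len \<gamma> a b \<ge> 0" by (rule len_nonneg[OF C ab])
  have aU: "\<gamma> a \<in> U" using start len0 m by (simp add: U_def) (smt (verit) divide_nonneg_pos)
  \<comment> \<open>The fundamental theorem of calculus in the chart, with the coordinate speed
    bounded by the Riemannian speed divided by \<open>m\<close>.\<close>
  have inside: "m * norm (cmap c (\<gamma> t) - p) \<le> len \<gamma> a b"
    if t: "a < t" "t \<le> b" and tU: "\<And>s. a \<le> s \<Longrightarrow> s < t \<Longrightarrow> \<gamma> s \<in> U" "\<gamma> t \<in> U" for t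
  proof -
    have Ct: "C1_curve_on A \<gamma> a t" by (rule C1_curve_subinterval(1)[OF C]) (use t in auto)
    have sU: "\<gamma> s \<in> U" if "s \<in> {a..t}" for s using tU that by (cases "s = t") auto
    have D: "((cmap c \<circ> \<gamma>) has_vector_derivative vel \<gamma> {a..t} s c) (at s within {a..t})" if "s \<in> {a..t}" for s
      using C1_curve_derivative[OF Ct that c] sU[OF that] by (simp add: U_def)
    have I: "((\<lambda>s. vel \<gamma> {a..t} s c) has_integral (cmap c (\<gamma> t) - p)) {a..t}"
      using fundamental_theorem_of_calculus[OF _ D] t by (simp add: p_def)
    have "norm (integral {a..t} (\<lambda>s. vel \<gamma> {a..t} s c)) \<le> integral {a..t} (\<lambda>s. speed \<gamma> {a..t} s / m)"
    proof (rule integral_norm_bound_integral)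
      show "(\<lambda>s. vel \<gamma> {a..t} s c) integrable_on {a..t}" using I by blast
      show "(\<lambda>s. speed \<gamma> {a..t} s / m) integrable_on {a..t}"
        using speed_integrable[OF Ct t(1)] by (rule integrable_on_divide)
      fix s assume s: "s \<in> {a..t}"
      have "m * norm (vel \<gamma> {a..t} s c) \<le> speed \<gamma> {a..t} s"
        using lower[of "cmap c (\<gamma> s)" "vel \<gamma> {a..t} s c"] sU[OF s] c C1_curve_vel[OF Ct t(1) s c]
        by (simp add: U_def speed_def)
      then show "norm (vel \<gamma> {a..t} s c) \<le> speed \<gamma> {a..t} s / m"
        using m by (simp add: field_simps)
    qed
    also have "\<dots> = len \<gamma> a t / m" by (simp add: len_def)
    also have "\<dots> \<le> len \<gamma> a b / m"
    proof (cases "t = b")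
      case False
      then have tb: "t < b" using t by simp
      have "len \<gamma> t b \<ge> 0"
        by (rule len_nonneg[OF C1_curve_subinterval(1)[OF C] tb]) (use t tb in auto)
      then show ?thesis using len_split[OF C t(1) tb] m by (simp add: divide_right_mono)
    qed simp
    finally show ?thesis using m integral_unique[OF I] by (simp add: field_simps)
  qed
  have "{t \<in> {a..b}. \<gamma> t \<notin> U} = {}"
  proof (rule ccontr)
    let ?S = "{t \<in> {a..b}. \<gamma> t \<notin> U}"
    assume ne: "?S \<noteq> {}"
    have contg: "continuous_on {a..b} \<gamma>" using C unfolding C1_curve_on_def by blast
    have "closed ({a..b} \<inter> \<gamma> -` (- U))"
      by (rule continuous_closed_preimage[OF contg]) (use oU in auto)
    moreover have "{a..b} \<inter> \<gamma> -` (- U) = ?S" by auto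
    ultimately have cl: "closed ?S" by simp
    have bdd: "bdd_below ?S" by (rule bdd_belowI[of _ a]) auto
    have t0: "Inf ?S \<in> ?S" by (rule closed_contains_Inf[OF ne bdd cl])
    define t where "t = Inf ?S"
    have t: "a \<le> t" "t \<le> b" "\<gamma> t \<notin> U" using t0 by (auto simp: t_def)
    have before: "\<gamma> s \<in> U" if "a \<le> s" "s < t" for s
    proof (rule ccontr)
      assume "\<gamma> s \<notin> U"
      then have "s \<in> ?S" using that t by auto
      then have "t \<le> s" unfolding t_def using bdd by (rule cInf_lower)
      then show False using that by simp
    qed
    have at: "a < t" using aU t by (cases "a = t") auto
    have inW: "\<gamma> s \<in> cinv c ` K'" if "a < s" "s < t" for s
    proof -
      have "m * norm (cmap c (\<gamma> s) - p) \<le> len \<gamma> a b"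
        by (rule inside) (use that t before in auto)
      then have "norm (cmap c (\<gamma> s) - p) \<le> len \<gamma> a b / m" using m by (simp add: field_simps)
      then have "dist a\<^sub>0 (cmap c (\<gamma> s)) \<le> dist a\<^sub>0 p + len \<gamma> a b / m"
        using dist_triangle[of a\<^sub>0 "cmap c (\<gamma> s)" p] by (simp add: dist_norm norm_minus_commute)
      then have "cmap c (\<gamma> s) \<in> K'" by (simp add: K'_def)
      moreover have "\<gamma> s \<in> cdom c" using before[of s] that by (simp add: U_def)
      ultimately show ?thesis using c by (metis cinv_cmap image_eqI)
    qed
    have K'r: "K' \<subseteq> ball a\<^sub>0 r" using start by (auto simp: K'_def p_def)
    then have K'c: "K' \<subseteq> cmap c ` cdom c" using K ball_subset_cball by blast
    have "compact (cinv c ` K')"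
      by (rule compact_continuous_image[OF continuous_on_subset[OF continuous_cinv[OF c] K'c]]) (simp add: K'_def)
    then have cl: "closed (cinv c ` K')" by (rule compact_imp_closed)
    have "(\<gamma> \<longlongrightarrow> \<gamma> t) (at t within {a..b})"
      using contg t by (simp add: continuous_on_def)
    then have lim: "(\<gamma> \<longlongrightarrow> \<gamma> t) (at t within {a<..<t})"
      by (rule tendsto_within_subset) (use t in auto)
    have "t islimpt {a<..<t}" by (rule islimpt_greaterThanLessThan2[OF at])
    then have "at t within {a<..<t} \<noteq> bot" by (simp add: trivial_limit_within)
    moreover have "\<forall>\<^sub>F s in at t within {a<..<t}. \<gamma> s \<in> cinv c ` K'"
      unfolding eventually_at_filter by (rule always_eventually) (use inW in simp)
    ultimately have "\<gamma> t \<in> cinv c ` K'" using Lim_in_closed_set[OF cl _ _ lim] by blast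
    then obtain k where k: "k \<in> K'" "\<gamma> t = cinv c k" by blast
    then have "k \<in> cmap c ` cdom c" "k \<in> ball a\<^sub>0 r" using K'r K'c by blast+
    then have "\<gamma> t \<in> U" using k(2) c unfolding U_def by simp
    then show False using t by blast
  qed
  then have all: "\<gamma> t \<in> U" if "t \<in> {a..b}" for t using that by blast
  then show ?thesis using inside[OF ab] ab by (simp add: U_def p_def)
qed

text \<open>Along a concatenation, the distance to the centre plus the remaining length divided by
  \<open>m\<close> does not increase, so the hypothesis is available again at the intermediate
  point.\<close>

lemma joins_chart_bound:
  assumes c: "c \<in> A" and K: "cball a\<^sub>0 r \<subseteq> cmap c ` cdom c" and m: "m > 0"
    and lower: "\<And>a u. a \<in> cball a\<^sub>0 r \<Longrightarrow> m * norm u \<le> rnorm G (cinv c a) (tv c (cinv c a) u)"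
    and j: "joins p q L" and p: "p \<in> cdom c" "dist a\<^sub>0 (cmap c p) + L / m < r"
  shows "q \<in> cdom c \<and> m * norm (cmap c q - cmap c p) \<le> L"
  using j p
proof (induction rule: joins.induct)
  case (joins_C1 a b \<gamma>)
  then show ?case using C1_curve_chart_bound[OF c K m lower] by blast
next
  case (joins_trans p q L s L')
  have "dist a\<^sub>0 (cmap c p) + L / m < r"
    using joins_trans.prems joins_nonneg[OF joins_trans.hyps(2)] m
    by (smt (verit) add_divide_distrib divide_nonneg_pos)
  then have q: "q \<in> cdom c" "m * norm (cmap c q - cmap c p) \<le> L"
    using joins_trans by auto
  have "dist a\<^sub>0 (cmap c q) \<le> dist a\<^sub>0 (cmap c p) + L / m"
    using dist_triangle[of a\<^sub>0 "cmap c q" "cmap c p"] q(2) m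
    by (simp add: dist_norm norm_minus_commute field_simps) (smt (verit) mult_left_mono distrib_left mult.commute)
  then have "dist a\<^sub>0 (cmap c q) + L' / m < r"
    using joins_trans.prems by (simp add: add_divide_distrib)
  then have s: "s \<in> cdom c" "m * norm (cmap c s - cmap c q) \<le> L'"
    using joins_trans q by auto
  have "m * norm (cmap c s - cmap c p) \<le> m * (norm (cmap c s - cmap c q) + norm (cmap c q - cmap c p))"
    using m norm_triangle_ineq[of "cmap c s - cmap c q" "cmap c q - cmap c p"] by (intro mult_left_mono) auto
  then show ?case using s q by (simp add: distrib_left)
qed

lemma joins_nearby:
  obtains U where "open U" "p \<in> U" "\<And>q. q \<in> U \<Longrightarrow> \<exists>L. joins p q L"
proof -
  obtain c where c: "c \<in> A" "p \<in> cdom c" by (rule chart_around)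
  obtain r m B where r: "r > 0" "cball (cmap c p) r \<subseteq> cmap c ` cdom c"
    "\<And>a u. a \<in> cball (cmap c p) r \<Longrightarrow> rnorm G (cinv c a) (tv c (cinv c a) u) \<le> B * norm u"
    using rnorm_chart_equiv[OF c] by metis
  show thesis
  proof
    show "open {x \<in> cdom c. cmap c x \<in> ball (cmap c p) r}" by (rule open_chart_preimage[OF c(1) open_ball])
    show "p \<in> {x \<in> cdom c. cmap c x \<in> ball (cmap c p) r}" using c r by simp
    fix q assume "q \<in> {x \<in> cdom c. cmap c x \<in> ball (cmap c p) r}"
    then show "\<exists>L. joins p q L"
      using chart_segment_joins[OF c(1) r(2,3), of "cmap c p" "cmap c q"] c r(1) by auto
  qed
qed

end

section \<open>The Riemannian distance as a metric that induces the manifold topology\<close>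

locale connected_riemannian_manifold = riemannian_manifold +
  assumes connected: "connected (UNIV :: 'a set)"
begin

text \<open>The points reachable from \<open>p\<close> and the unreachable ones both form open sets,
  by \<open>joins_nearby\<close>. It ensures that the infimum defining the distance ranges over a
  nonempty set.\<close>

lemma joins_exists: "\<exists>L. joins p q L"
proof -
  let ?T = "{q. \<exists>L. joins p q L}"
  have "open ?T"
  proof (subst open_subopen, intro ballI)
    fix q assume q: "q \<in> ?T"
    obtain U where U: "open U" "q \<in> U" "\<And>x. x \<in> U \<Longrightarrow> \<exists>L. joins q x L"
      using joins_nearby[of q] by metis
    have "U \<subseteq> ?T" using q U(3) joins_trans by blast
    then show "\<exists>T. open T \<and> q \<in> T \<and> T \<subseteq> ?T" using U by blast
  qed
  moreover have "open (- ?T)"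
  proof (subst open_subopen, intro ballI)
    fix q assume q: "q \<in> - ?T"
    obtain U where U: "open U" "q \<in> U" "\<And>x. x \<in> U \<Longrightarrow> \<exists>L. joins q x L"
      using joins_nearby[of q] by metis
    have "U \<subseteq> - ?T" using q U(3) joins_trans joins_sym by blast
    then show "\<exists>T. open T \<and> q \<in> T \<and> T \<subseteq> - ?T" using U by blast
  qed
  moreover have "p \<in> ?T" using joins_nearby[of p] by blast
  ultimately have "- ?T = {}" using connectedD[OF connected, of ?T "- ?T"] by blast
  then show ?thesis by blast
qed

abbreviation d :: "'a \<Rightarrow> 'a \<Rightarrow> real" where "d \<equiv> rdist A G"

lemma d_le: "joins p q L \<Longrightarrow> d p q \<le> L"
  unfolding rdist_eq using joins_nonneg by (intro cInf_lower bdd_belowI[of _ 0]) auto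

lemma d_less: "d p q < s \<Longrightarrow> \<exists>L<s. joins p q L"
  unfolding rdist_eq using joins_exists[of p q] cInf_lessD[of "{L. joins p q L}" s] by blast

lemma d_nonneg: "0 \<le> d p q"
  unfolding rdist_eq using joins_exists[of p q] joins_nonneg by (intro cInf_greatest) auto

text \<open>A path from \<open>x\<close> of length below \<open>m * r\<close> stays in the
  coordinate ball of radius \<open>r\<close>; the estimate for lengths then passes to the infimum.
  It gives separation of points and convergence in coordinates from convergence in distance.\<close>

lemma d_near:
  obtains c r m where "c \<in> A" "x \<in> cdom c" "r > 0" "m > 0" "cball (cmap c x) r \<subseteq> cmap c ` cdom c"
    "\<And>q. d x q < m * r \<Longrightarrow> q \<in> cdom c \<and> m * norm (cmap c q - cmap c x) \<le> d x q"
proof -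
  obtain c where c: "c \<in> A" "x \<in> cdom c" by (rule chart_around)
  obtain r m B where r: "r > 0" "m > 0" "cball (cmap c x) r \<subseteq> cmap c ` cdom c"
    "\<And>a u. a \<in> cball (cmap c x) r \<Longrightarrow> m * norm u \<le> rnorm G (cinv c a) (tv c (cinv c a) u)"
    using rnorm_chart_equiv[OF c] by metis
  have b: "q \<in> cdom c \<and> m * norm (cmap c q - cmap c x) \<le> L" if "joins x q L" "L < m * r" for q L
    using joins_chart_bound[OF c(1) r(3,2,4) that(1) c(2)] that(2) r(2) by (simp add: field_simps)
  have "q \<in> cdom c \<and> m * norm (cmap c q - cmap c x) \<le> d x q" if q: "d x q < m * r" for q
  proof
    show "q \<in> cdom c" using d_less[OF q] b by blast
    show "m * norm (cmap c q - cmap c x) \<le> d x q"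
    proof (rule ccontr)
      assume "\<not> m * norm (cmap c q - cmap c x) \<le> d x q"
      then have "d x q < min (m * r) (m * norm (cmap c q - cmap c x))" using q by simp
      then obtain L where "L < min (m * r) (m * norm (cmap c q - cmap c x))" "joins x q L"
        using d_less by blast
      then show False using b[of q L] by simp
    qed
  qed
  then show thesis using c r that by blast
qed

lemma tendsto_d:
  assumes X: "(X \<longlongrightarrow> x) F" shows "((\<lambda>n. d (X n) x) \<longlongrightarrow> 0) F"
proof -
  obtain c where c: "c \<in> A" "x \<in> cdom c" by (rule chart_around)
  obtain r m B where r: "r > 0" "cball (cmap c x) r \<subseteq> cmap c ` cdom c"
    "\<And>a u. a \<in> cball (cmap c x) r \<Longrightarrow> rnorm G (cinv c a) (tv c (cinv c a) u) \<le> B * norm u"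
    using rnorm_chart_equiv[OF c] by metis
  have "x \<in> {y \<in> cdom c. cmap c y \<in> ball (cmap c x) r}" using c r by simp
  then have "\<forall>\<^sub>F n in F. X n \<in> {y \<in> cdom c. cmap c y \<in> ball (cmap c x) r}"
    by (rule topological_tendstoD[OF X open_chart_preimage[OF c(1) open_ball]])
  then have ev: "\<forall>\<^sub>F n in F. d (X n) x \<le> B * norm (cmap c x - cmap c (X n))"
  proof (rule eventually_mono)
    fix n assume n: "X n \<in> {y \<in> cdom c. cmap c y \<in> ball (cmap c x) r}"
    then obtain L where "L \<le> B * norm (cmap c x - cmap c (X n))" "joins (X n) x L"
      using chart_segment_joins[OF c(1) r(2,3), of "cmap c (X n)" "cmap c x"] c r(1) by auto
    then show "d (X n) x \<le> B * norm (cmap c x - cmap c (X n))" using d_le by force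
  qed
  have "((\<lambda>n. cmap c (X n)) \<longlongrightarrow> cmap c x) F"
    using isCont_tendsto_compose[OF isCont_cmap[OF c] X] .
  then have "((\<lambda>n. B * norm (cmap c x - cmap c (X n))) \<longlongrightarrow> B * norm (cmap c x - cmap c x)) F"
    by (intro tendsto_intros)
  then have lim: "((\<lambda>n. B * norm (cmap c x - cmap c (X n))) \<longlongrightarrow> 0) F" by simp
  show ?thesis
    by (rule tendsto_sandwich[OF always_eventually ev tendsto_const lim]) (simp add: d_nonneg)
qed

text \<open>Symmetry is a premise because the distance is not yet known to be a metric here;
  \<open>commute\<close> discharges it after the interpretation.\<close>

lemma tendsto_iff_d: "X \<longlonglongrightarrow> x \<longleftrightarrow> (\<lambda>n. d (X n) x) \<longlonglongrightarrow> 0" if sym: "\<And>p q. d p q = d q p" for X :: "nat \<Rightarrow> 'a"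
proof
  assume lim: "(\<lambda>n. d (X n) x) \<longlonglongrightarrow> 0"
  obtain c r m where c: "c \<in> A" "x \<in> cdom c" and r: "r > 0" "m > 0" "cball (cmap c x) r \<subseteq> cmap c ` cdom c"
    and near: "\<And>q. d x q < m * r \<Longrightarrow> q \<in> cdom c \<and> m * norm (cmap c q - cmap c x) \<le> d x q"
    using d_near[of x] by metis
  have ev: "\<forall>\<^sub>F n in sequentially. d (X n) x < m * r"
    using order_tendstoD(2)[OF lim, of "m * r"] r by simp
  have ev1: "\<forall>\<^sub>F n in sequentially. norm (cmap c (X n) - cmap c x) \<le> d (X n) x / m"
    using ev
  proof (rule eventually_mono)
    fix n assume "d (X n) x < m * r"
    then have "m * norm (cmap c (X n) - cmap c x) \<le> d (X n) x"
      using near[of "X n"] sym[of "X n" x] by simp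
    then show "norm (cmap c (X n) - cmap c x) \<le> d (X n) x / m" using r by (simp add: field_simps)
  qed
  have "(\<lambda>n. d (X n) x / m) \<longlonglongrightarrow> 0" using tendsto_divide[OF lim tendsto_const[of m]] r by simp
  from Lim_null_comparison[OF ev1 this] have "(\<lambda>n. cmap c (X n)) \<longlonglongrightarrow> cmap c x"
    by (rule LIM_zero_cancel)
  then have l: "(\<lambda>n. cinv c (cmap c (X n))) \<longlonglongrightarrow> cinv c (cmap c x)"
    by (rule isCont_tendsto_compose[OF isCont_cinv, rotated 2]) (use c in auto)
  have "\<forall>\<^sub>F n in sequentially. cinv c (cmap c (X n)) = X n"
    using ev
  proof (rule eventually_mono)
    fix n assume "d (X n) x < m * r"
    then show "cinv c (cmap c (X n)) = X n" using near[of "X n"] sym[of "X n" x] c by simp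
  qed
  from Lim_transform_eventually[OF l this] show "X \<longlonglongrightarrow> x" using c by simp
qed (rule tendsto_d)

sublocale Metric_space "UNIV :: 'a set" "rdist A G"
proof
  show "d x y = d y x" for x y
  proof -
    have "joins x y = joins y x" by (intro ext iffI) (rule joins_sym; assumption)+
    then show ?thesis by (simp add: rdist_eq)
  qed
  show "0 \<le> d x y" for x y by (rule d_nonneg)
  show "d x y = 0 \<longleftrightarrow> x = y" for x y
  proof
    assume xy: "d x y = 0"
    obtain c r m where c: "c \<in> A" "x \<in> cdom c" and r: "r > 0" "m > 0"
      and near: "\<And>q. d x q < m * r \<Longrightarrow> q \<in> cdom c \<and> m * norm (cmap c q - cmap c x) \<le> d x q"
      using d_near[of x] by metis
    have "y \<in> cdom c" "m * norm (cmap c y - cmap c x) \<le> 0" using near[of y] xy r by auto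
    then have "cmap c y = cmap c x" using r by (simp add: mult_le_0_iff)
    then show "x = y" using c \<open>y \<in> cdom c\<close> cinv_cmap by metis
  next
    assume "x = y"
    \<comment> \<open>A constant sequence converges, so its distances to the limit, which are all
      \<open>d y y\<close>, tend to 0.\<close>
    then have "(\<lambda>n::nat. d y y) \<longlonglongrightarrow> 0" using tendsto_d[of "\<lambda>n. y" y] by simp
    then show "d x y = 0" using \<open>x = y\<close> LIMSEQ_const_iff by blast
  qed
  show "d x z \<le> d x y + d y z" for x y z
  proof (rule ccontr)
    assume "\<not> d x z \<le> d x y + d y z"
    moreover define e where "e = (d x z - d x y - d y z) / 2"
    ultimately have e: "e > 0" "d x z = d x y + d y z + 2 * e" by (auto simp: field_simps)
    obtain L where L: "L < d x y + e" "joins x y L" using d_less[of x y "d x y + e"] e by auto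
    obtain L' where L': "L' < d y z + e" "joins y z L'" using d_less[of y z "d y z + e"] e by auto
    show False using d_le[OF joins_trans[OF L(2) L'(2)]] L L' e by simp
  qed
qed

lemma limitin_mtopology_iff: "limitin mtopology X x sequentially \<longleftrightarrow> X \<longlonglongrightarrow> x"
  using limit_metric_sequentially[of X x]
  by (simp add: tendsto_iff_d[OF commute] LIMSEQ_iff)

text \<open>Coordinates of a sequence in the ball lie in a compact Euclidean ball; a subsequence
  converging in coordinates converges on the manifold and is therefore Cauchy.\<close>

lemma mtotally_bounded_small_ball: "\<exists>e>0. mtotally_bounded (mball x e)"
proof -
  obtain c r m where c: "c \<in> A" "x \<in> cdom c" and r: "r > 0" "m > 0" "cball (cmap c x) r \<subseteq> cmap c ` cdom c"
    and near: "\<And>q. d x q < m * r \<Longrightarrow> q \<in> cdom c \<and> m * norm (cmap c q - cmap c x) \<le> d x q"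
    using d_near[of x] by metis
  have "mtotally_bounded (mball x (m * r))"
    unfolding mtotally_bounded_sequentially
  proof (intro conjI allI impI)
    fix \<sigma> :: "nat \<Rightarrow> 'a" assume s: "range \<sigma> \<subseteq> mball x (m * r)"
    have "d x (\<sigma> n) < m * r" for n using subsetD[OF s, of "\<sigma> n"] by simp
    then have n: "\<sigma> n \<in> cdom c" "m * norm (cmap c (\<sigma> n) - cmap c x) < m * r" for n
      using near[of "\<sigma> n"] by (blast, meson le_less_trans)
    then have "cmap c (\<sigma> n) \<in> cball (cmap c x) r" for n
      using r by (simp add: dist_norm norm_minus_commute less_imp_le)
    then obtain l k where l: "l \<in> cball (cmap c x) r" "strict_mono k" "((\<lambda>n. cmap c (\<sigma> n)) \<circ> k) \<longlonglongrightarrow> l"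
      using compact_cball[of "cmap c x" r, unfolded compact_def] by metis
    have "(\<lambda>n. cinv c (((\<lambda>n. cmap c (\<sigma> n)) \<circ> k) n)) \<longlonglongrightarrow> cinv c l"
      by (rule isCont_tendsto_compose[OF isCont_cinv l(3)]) (use c l r in auto)
    then have "(\<sigma> \<circ> k) \<longlonglongrightarrow> cinv c l" using c n by (simp add: o_def)
    then have "MCauchy (\<sigma> \<circ> k)"
      using convergent_imp_MCauchy limitin_mtopology_iff by blast
    then show "\<exists>r. strict_mono r \<and> MCauchy (\<sigma> \<circ> r)" using l by blast
  qed simp
  then show ?thesis using r by (intro exI[of _ "m * r"]) simp
qed

text \<open>A manifold is a length space, so the argument for complete locally compact length spaces
  applies: the supremum of the radii of totally bounded balls around a point is infinite.\<close>

lemma mtotally_bounded_mball: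
  assumes complete: mcomplete
  shows "mtotally_bounded (mball p r)"
proof (rule ccontr)
  assume notr: "\<not> mtotally_bounded (mball p r)"
  define I where "I = {s. s > 0 \<and> mtotally_bounded (mball p s)}"
  have up: "s < r" if "s \<in> I" for s
    using that notr mtotally_bounded_subset[of "mball p s" "mball p r"] mball_subset_concentric[of r s p]
    by (auto simp: I_def not_less[symmetric])
  then have bdd: "bdd_above I" by (intro bdd_aboveI[of _ r]) force
  obtain e0 where e0: "e0 \<in> I" using mtotally_bounded_small_ball[of p] by (auto simp: I_def)
  define \<rho> where "\<rho> = Sup I"
  have \<rho>0: "\<rho> > 0" using e0 cSup_upper[OF e0 bdd] by (auto simp: \<rho>_def I_def)
  have below: "mtotally_bounded (mball p s)" if s: "s < \<rho>" for s
  proof -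
    obtain s' where "s' \<in> I" "s < s'" using less_cSupD[of I s] s e0 unfolding \<rho>_def by blast
    then show ?thesis
      using mtotally_bounded_subset[of "mball p s'" "mball p s"] mball_subset_concentric[of s s' p] by (auto simp: I_def)
  qed
  have tb: "mtotally_bounded (mball p \<rho>)"
    unfolding mtotally_bounded_def
  proof (intro allI impI)
    fix e :: real assume e: "e > 0"
    \<comment> \<open>The radius is so close to \<rho> that every point of the larger ball is within
      \<open>e / 2\<close> of the smaller one. An \<open>e / 2\<close> net of the smaller ball is
      then an \<open>e\<close> net of the larger; the second argument of \<open>min\<close> keeps
      \<open>s\<close> positive.\<close>
    define s where "s = \<rho> - min (e / 2) (\<rho> / 2)"
    have s: "0 < s" "s < \<rho>" "\<rho> - s \<le> e / 2" using e \<rho>0 by (auto simp: s_def)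
    obtain K where K: "finite K" "K \<subseteq> mball p s" "mball p s \<subseteq> (\<Union>x\<in>K. mball x (e / 2))"
    proof -
      have "0 < e / 2" using e by simp
      with below[OF s(2)] have "\<exists>K. finite K \<and> K \<subseteq> mball p s \<and> mball p s \<subseteq> (\<Union>x\<in>K. mball x (e / 2))"
        unfolding mtotally_bounded_def by (elim allE[of _ "e / 2"] impE)
      then show ?thesis by (elim exE conjE) (rule that)
    qed
    have "mball p \<rho> \<subseteq> (\<Union>x\<in>K. mball x e)"
    proof
      fix q assume "q \<in> mball p \<rho>"
      then have "d p q < \<rho>" by simp
      then obtain L where L: "L < \<rho>" "joins p q L" using d_less[of p q \<rho>] by blast
      obtain q' where q': "q' \<in> mball p s" "d q' q < e / 2"
      proof (cases "d p q < s")
        case True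
        then show ?thesis using that[of q] e by simp
      next
        case False
        then have "s \<le> L" using d_le[OF L(2)] by simp
        \<comment> \<open>The midpoint of \<open>s\<close> and \<open>L - (\<rho> - s)\<close>. From
          \<open>L < \<rho>\<close> it follows that \<open>t < s\<close> and
          \<open>L - t < \<rho> - s\<close>, so splitting the path at \<open>t\<close> gives the
          required point. If \<open>t\<close> is not positive, the whole path is short and
          \<open>p\<close> itself serves.\<close>
        define t where "t = (L + s - (\<rho> - s)) / 2"
        show ?thesis
        proof (cases "t \<le> 0")
          case True
          then have "L < e / 2" using s L \<open>s \<le> L\<close> by (simp add: t_def)
          then show ?thesis using that[of p] d_le[OF L(2)] s by simp
        next
          case False
          moreover have "t < s" "t < L" "L - t < e / 2"
            using s L \<open>s \<le> L\<close> by (auto simp: t_def field_simps)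
          ultimately obtain q' where "joins p q' t" "joins q' q (L - t)"
            using joins_split[OF L(2), of t] by auto
          then show ?thesis using that[of q'] d_le \<open>t < s\<close> \<open>L - t < e / 2\<close> by fastforce
        qed
      qed
      then obtain x where x: "x \<in> K" "d x q' < e / 2" using K by auto
      then have "d x q < e" using triangle[of x q' q] q' by simp
      then show "q \<in> (\<Union>x\<in>K. mball x e)" using x by auto
    qed
    moreover have "K \<subseteq> mball p \<rho>" using K(2) mball_subset_concentric[of s \<rho> p] s by auto
    ultimately show "\<exists>K. finite K \<and> K \<subseteq> mball p \<rho> \<and> mball p \<rho> \<subseteq> (\<Union>x\<in>K. mball x e)" using K by blast
  qed
  then have cpt: "compactin mtopology (mtopology closure_of (mball p \<rho>))"
    using mtotally_bounded_eq_compact_closure_of[OF complete] by blast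
  \<comment> \<open>The balls of half these radii cover the compact closure; the full radii leave
    the room needed to enlarge the ball around \<open>p\<close>.\<close>
  define \<epsilon> where "\<epsilon> = (\<lambda>x. SOME e. e > 0 \<and> mtotally_bounded (mball x e))"
  have \<epsilon>: "\<epsilon> x > 0" "mtotally_bounded (mball x (\<epsilon> x))" for x
    using someI_ex[OF mtotally_bounded_small_ball[of x, unfolded Bex_def]] by (auto simp: \<epsilon>_def)
  let ?\<U> = "(\<lambda>x. mball x (\<epsilon> x / 2)) ` UNIV"
  have "x \<in> mball x (\<epsilon> x / 2)" for x using \<epsilon>(1)[of x] by simp
  then have "mtopology closure_of (mball p \<rho>) \<subseteq> \<Union> ?\<U>" by blast
  then obtain \<F> where \<F>: "finite \<F>" "\<F> \<subseteq> ?\<U>" "mtopology closure_of (mball p \<rho>) \<subseteq> \<Union> \<F>"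
    using compactinD[OF cpt, of ?\<U>] by auto
  obtain Q where "finite Q" "\<F> = (\<lambda>x. mball x (\<epsilon> x / 2)) ` Q"
    using finite_subset_image[OF \<F>(1,2)] by blast
  with \<F>(3) have Q: "finite Q" "mtopology closure_of (mball p \<rho>) \<subseteq> (\<Union>x\<in>Q. mball x (\<epsilon> x / 2))"
    by simp_all
  have cov: "mball p \<rho> \<subseteq> (\<Union>x\<in>Q. mball x (\<epsilon> x / 2))"
    using Q(2) closure_of_subset[of "mball p \<rho>" mtopology] by auto
  then have "Q \<noteq> {}" using \<rho>0 centre_in_mball_iff[of p \<rho>] by auto
  \<comment> \<open>Acts as a Lebesgue number: a point closer than \<delta> to the ball of radius
    \<rho> lies in one of the finitely many full balls. So a radius beyond the supremum \<rho> is
    still totally bounded, a contradiction.\<close>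
  define \<delta> where "\<delta> = Min ((\<lambda>x. \<epsilon> x / 2) ` Q)"
  have "\<delta> > 0" using Q(1) \<open>Q \<noteq> {}\<close> \<epsilon>(1) by (simp add: \<delta>_def)
  moreover have "\<delta> \<le> \<epsilon> x / 2" if "x \<in> Q" for x
    unfolding \<delta>_def using Q(1) that by (intro Min_le) auto
  ultimately have \<delta>: "\<delta> > 0" "\<And>x. x \<in> Q \<Longrightarrow> \<delta> \<le> \<epsilon> x / 2" by blast+
  have "mball p (\<rho> + \<delta> / 2) \<subseteq> (\<Union>x\<in>Q. mball x (\<epsilon> x))"
  proof
    fix q assume "q \<in> mball p (\<rho> + \<delta> / 2)"
    then have "d p q < \<rho> + \<delta> / 2" by simp
    then obtain L where L: "L < \<rho> + \<delta> / 2" "joins p q L" using d_less[of p q "\<rho> + \<delta> / 2"] by blast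
    obtain q' where q': "q' \<in> mball p \<rho>" "d q' q < \<delta>"
    proof (cases "L < \<rho>")
      case True
      then show ?thesis using that[of q] d_le[OF L(2)] \<delta> by simp
    next
      case False
      define t where "t = \<rho> - min (\<delta> / 2) (\<rho> / 2)"
      have t: "0 < t" "t < \<rho>" "L - t < \<delta>" using \<delta> \<rho>0 L by (auto simp: t_def)
      then obtain q' where "joins p q' t" "joins q' q (L - t)"
        using joins_split[OF L(2), of t] False by auto
      then show ?thesis using that[of q'] d_le t by fastforce
    qed
    then obtain x where x: "x \<in> Q" "d x q' < \<epsilon> x / 2" using cov by auto
    then have "d x q < \<epsilon> x" using triangle[of x q' q] q' \<delta>(2)[of x] by simp
    then show "q \<in> (\<Union>x\<in>Q. mball x (\<epsilon> x))" using x by auto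
  qed
  moreover have "mtotally_bounded (\<Union>x\<in>Q. mball x (\<epsilon> x))"
    using Q(1) \<epsilon>(2) by (intro mtotally_bounded_Union) auto
  ultimately have "\<rho> + \<delta> / 2 \<in> I"
    using mtotally_bounded_subset \<rho>0 \<delta>(1) by (auto simp: I_def)
  then show False using cSup_upper[OF _ bdd] \<delta>(1) by (fastforce simp: \<rho>_def)
qed

text \<open>In a complete space a totally bounded ball has compact closure. The separate sequence
  \<open>Y\<close> allows subsequences and index shifts of the bounded sequence.\<close>

theorem bounded_sequence_convergent_subsequence:
  assumes mcomplete and bdd: "mbounded (range X)" and X: "\<And>n::nat. Y n \<in> range X"
  obtains x r where "strict_mono r" "(\<lambda>n. Y (r n)) \<longlonglongrightarrow> x"
proof -
  obtain p b where "range X \<subseteq> mcball p b" using bdd unfolding mbounded_def by blast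
  then have "d p (Y n) \<le> b" for n using X[of n] by auto
  then have "d p (Y n) < b + 1" for n by (rule le_less_trans) simp
  then have "range Y \<subseteq> mball p (b + 1)" by auto
  then have "range Y \<subseteq> mtopology closure_of (mball p (b + 1))"
    using closure_of_subset[of "mball p (b + 1)" mtopology] by auto
  moreover have "compactin mtopology (mtopology closure_of (mball p (b + 1)))"
    using mtotally_bounded_eq_compact_closure_of[OF assms(1)] mtotally_bounded_mball[OF assms(1)] by blast
  ultimately obtain l r where "strict_mono r" "limitin mtopology (Y \<circ> r) l sequentially"
    unfolding compactin_sequentially by blast
  then show thesis using that[of r l] unfolding limitin_mtopology_iff by (simp add: o_def)
qed

end

section \<open>The positive part\<close>

lemma pos_part_nth [simp]: "pos_part v $ i = max (v $ i) 0"
  by (simp add: pos_part_def)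

lemma pos_part_nonneg [simp]: "0 \<le> pos_part v"
  by (simp add: less_eq_vec_def)

lemma pos_part_of_nonneg: "0 \<le> v \<Longrightarrow> pos_part v = v"
  by (simp add: vec_eq_iff less_eq_vec_def max_absorb1)

lemma pos_part_scaleR: "a \<ge> 0 \<Longrightarrow> pos_part (a *\<^sub>R v) = a *\<^sub>R pos_part v"
  by (simp add: vec_eq_iff max_mult_distrib_left)

lemma pos_part_minus_eq_0: "pos_part (- v) = 0 \<longleftrightarrow> 0 \<le> v"
  by (auto simp: vec_eq_iff less_eq_vec_def max_def)

lemma inner_vec_nonneg: "0 \<le> u \<Longrightarrow> 0 \<le> v \<Longrightarrow> 0 \<le> u \<bullet> v" for u v :: "real^'n"
  by (auto simp: inner_vec_def less_eq_vec_def intro!: sum_nonneg)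

lemma norm_vec_mono: 
  fixes u v :: "real^'n"
  assumes "\<And>i. \<bar>u $ i\<bar> \<le> \<bar>v $ i\<bar>"
  shows "norm u \<le> norm v"
  unfolding norm_vec_def by (rule L2_set_mono) (use assms in auto)

lemma norm_pos_part_diff: "norm (pos_part u - pos_part v) \<le> norm (u - v)"
  by (rule norm_vec_mono) auto

lemma tendsto_pos_part: "(f \<longlongrightarrow> l) F \<Longrightarrow> ((\<lambda>x. pos_part (f x)) \<longlongrightarrow> pos_part l) F"
  unfolding pos_part_def by (intro tendsto_vec_lambda tendsto_intros tendsto_vec_nth)

text \<open>Componentwise monotonicity of the positive part: each component moves against the sign
  of \<open>b\<close>. This is why the inequality constraints never spoil the descent of the search
  direction.\<close>

lemma pos_part_antimono_inner: "(pos_part (t - b) - pos_part t) \<bullet> b \<le> 0"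
  unfolding inner_vec_def by (rule sum_nonpos) (auto simp: max_def mult_nonpos_nonneg mult_nonneg_nonpos algebra_simps mult_le_0_iff)

lemma pos_part_inner_self: "pos_part v \<bullet> v = (norm (pos_part v))\<^sup>2"
  unfolding power2_norm_eq_inner inner_vec_def by (rule sum.cong) (auto simp: max_def)

text \<open>For the scalar function \<open>(max a 0)\<^sup>2\<close> the first-order remainder is at
  most \<open>b\<^sup>2\<close>, also across the kink; summing over components leaves a quadratic
  remainder.\<close>

lemma has_derivative_norm_pos_part_square:
  "((\<lambda>u. (norm (pos_part u))\<^sup>2) has_derivative (\<lambda>v. 2 * (pos_part u \<bullet> v))) (at (u :: real^'n))"
proof -
  have sq: "\<bar>(max (a + b) 0)\<^sup>2 - (max a 0)\<^sup>2 - 2 * (max a 0 * b)\<bar> \<le> b\<^sup>2" for a b :: real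
  proof (cases "a \<ge> 0"; cases "a + b \<ge> 0")
    assume "a \<ge> 0" "\<not> a + b \<ge> 0"
    then have "\<bar>(max (a + b) 0)\<^sup>2 - (max a 0)\<^sup>2 - 2 * (max a 0 * b)\<bar> = \<bar>a * (a + 2 * b)\<bar>"
      by (simp add: max_def power2_eq_square algebra_simps)
    also have "\<dots> = a * (- a - 2 * b)" using \<open>a \<ge> 0\<close> \<open>\<not> a + b \<ge> 0\<close> by (simp add: abs_mult)
    also have "\<dots> = b\<^sup>2 - (a + b)\<^sup>2" by (simp add: power2_eq_square algebra_simps)
    finally show ?thesis by simp
  next
    assume "\<not> a \<ge> 0" "a + b \<ge> 0"
    then have "(a + b)\<^sup>2 \<le> b\<^sup>2" by (intro power_mono) auto
    then show ?thesis using \<open>\<not> a \<ge> 0\<close> \<open>a + b \<ge> 0\<close> by simp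
  qed (auto simp: max_def power2_eq_square algebra_simps)
  have n2: "(norm w)\<^sup>2 = (\<Sum>i\<in>UNIV. (w $ i)\<^sup>2)" for w :: "real^'n"
    unfolding power2_norm_eq_inner inner_vec_def by (simp add: power2_eq_square)
  have bound: "\<bar>(norm (pos_part (u + v)))\<^sup>2 - (norm (pos_part u))\<^sup>2 - 2 * (pos_part u \<bullet> v)\<bar> \<le> (norm v)\<^sup>2" for v
  proof -
    have "(norm (pos_part (u + v)))\<^sup>2 - (norm (pos_part u))\<^sup>2 - 2 * (pos_part u \<bullet> v)
      = (\<Sum>i\<in>UNIV. (max (u $ i + v $ i) 0)\<^sup>2 - (max (u $ i) 0)\<^sup>2 - 2 * (max (u $ i) 0 * v $ i))"
      by (simp add: n2 inner_vec_def sum_subtractf sum_distrib_left)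
    also have "\<bar>\<dots>\<bar> \<le> (\<Sum>i\<in>UNIV. (v $ i)\<^sup>2)"
      by (rule order_trans[OF sum_abs sum_mono]) (rule sq)
    also have "\<dots> = (norm v)\<^sup>2" by (simp add: n2)
    finally show ?thesis .
  qed
  let ?q = "\<lambda>v. norm ((norm (pos_part (u + v)))\<^sup>2 - (norm (pos_part u))\<^sup>2 - 2 * (pos_part u \<bullet> v)) / norm v"
  have "(?q \<longlongrightarrow> 0) (at 0)"
  proof (rule Lim_null_comparison)
    have "norm (?q v) \<le> norm v" for v
      using divide_right_mono[OF bound[of v], of "norm v"]
      by (cases "v = 0") (simp_all add: power2_eq_square)
    then show "\<forall>\<^sub>F v in at 0. norm (?q v) \<le> norm v" by simp
    show "((\<lambda>v. norm v) \<longlongrightarrow> 0) (at (0 :: real^'n))" using tendsto_norm[OF tendsto_ident_at, of 0 UNIV] by simp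
  qed
  moreover have "bounded_linear (\<lambda>v. 2 * (pos_part u \<bullet> v))"
    by (intro bounded_linear_const_mult bounded_linear_inner_right)
  ultimately show ?thesis unfolding has_derivative_at by blast
qed

section \<open>First-order conditions\<close>

locale nonlinear_program = connected_riemannian_manifold A G
  for A :: "('a::{t2_space,second_countable_topology}, 'b::euclidean_space) chart set"
    and G :: "('a, 'b) metric_tensor" +
  fixes f :: "'a \<Rightarrow> real" and g :: "'a \<Rightarrow> real^'m" and h :: "'a \<Rightarrow> real^'l"
  assumes f_C1: "Ck_map (Suc 0) A f" and g_C1: "Ck_map (Suc 0) A g" and h_C1: "Ck_map (Suc 0) A h"
begin

abbreviation gradL :: "'a \<Rightarrow> real^'m \<Rightarrow> real^'l \<Rightarrow> ('a, 'b) tvec" where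
  "gradL \<equiv> grad_lagrangian A G f g h"
abbreviation residual :: "'a \<Rightarrow> real^'m \<Rightarrow> real^'l \<Rightarrow> real" where
  "residual \<equiv> KKT_res A G f g h"

lemmas mdifferentiable_fgh =
  C1_mdifferentiable[OF f_C1] C1_mdifferentiable[OF g_C1] C1_mdifferentiable[OF h_C1]

lemmas isCont_fgh =
  isCont_mfun[OF C1_mdifferentiable[OF f_C1]] isCont_mfun[OF C1_mdifferentiable[OF g_C1]]
  isCont_mfun[OF C1_mdifferentiable[OF h_C1]]

text \<open>The derivative of the Lagrangian with an additional multiplier for the objective, as in the
  Fritz John conditions.\<close>

definition dlag :: "real \<Rightarrow> real^'m \<Rightarrow> real^'l \<Rightarrow> 'a \<Rightarrow> ('a, 'b) tvec \<Rightarrow> real" where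
  "dlag a y z x v = a * mdiff A f x v - y \<bullet> mdiff A g x v - z \<bullet> mdiff A h x v"

lemma mdiff_dlagI:
  assumes "\<And>c. c \<in> A \<Longrightarrow> x \<in> cdom c \<Longrightarrow>
    ((F \<circ> cinv c) has_derivative (\<lambda>u. dlag a y z x (tv c x u))) (at (cmap c x))"
  shows "mdifferentiable F x" and "v \<in> TM x \<Longrightarrow> mdiff A F x v = dlag a y z x v"
proof -
  obtain c where c: "c \<in> A" "x \<in> cdom c" by (rule chart_around)
  show "mdifferentiable F x" by (rule mdifferentiableI[OF c assms[OF c]])
  show "mdiff A F x v = dlag a y z x v" if "v \<in> TM x"
    using mdiff_eq[OF c assms[OF c] that] tvec_of_tangent[OF c that] by simp
qed

lemma fgh_derivative:
  assumes "c \<in> A" "x \<in> cdom c"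
  shows "((\<lambda>a. f (cinv c a)) has_derivative (\<lambda>u. mdiff A f x (tv c x u))) (at (cmap c x))"
    "((\<lambda>a. g (cinv c a)) has_derivative (\<lambda>u. mdiff A g x (tv c x u))) (at (cmap c x))"
    "((\<lambda>a. h (cinv c a)) has_derivative (\<lambda>u. mdiff A h x (tv c x u))) (at (cmap c x))"
  using mdifferentiableD[OF mdifferentiable_fgh(1) assms] mdifferentiableD[OF mdifferentiable_fgh(2) assms]
    mdifferentiableD[OF mdifferentiable_fgh(3) assms] by (simp_all add: o_def)

lemma mdifferentiable_lagrangian: "mdifferentiable (\<lambda>x. lagrangian f g h x y z) x"
  and mdiff_lagrangian: "v \<in> TM x \<Longrightarrow>
    mdiff A (\<lambda>x. lagrangian f g h x y z) x v = dlag 1 y z x v"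
proof -
  have "(((\<lambda>x. lagrangian f g h x y z) \<circ> cinv c) has_derivative (\<lambda>u. dlag 1 y z x (tv c x u))) (at (cmap c x))"
    if "c \<in> A" "x \<in> cdom c" for c
    unfolding o_def lagrangian_def dlag_def
    by (auto intro!: derivative_eq_intros fgh_derivative that)
  from mdiff_dlagI[OF this] show "mdifferentiable (\<lambda>x. lagrangian f g h x y z) x"
    "v \<in> TM x \<Longrightarrow> mdiff A (\<lambda>x. lagrangian f g h x y z) x v = dlag 1 y z x v" by blast+
qed

lemma has_derivative_norm_pos_part_square_comp:
  "(k has_derivative k') (at x within S) \<Longrightarrow>
    ((\<lambda>x. (norm (pos_part (k x)))\<^sup>2) has_derivative (\<lambda>v. 2 * (pos_part (k x) \<bullet> k' v))) (at x within S)"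
  using has_derivative_compose[OF _ has_derivative_norm_pos_part_square] by blast

lemma has_derivative_norm_square_comp:
  fixes k :: "'c::real_normed_vector \<Rightarrow> 'd::real_inner"
  shows "(k has_derivative k') (at x within S) \<Longrightarrow>
    ((\<lambda>x. (norm (k x))\<^sup>2) has_derivative (\<lambda>v. 2 * (k x \<bullet> k' v))) (at x within S)"
  unfolding power2_norm_eq_inner by (auto intro!: derivative_eq_intros simp: inner_commute)

lemma penalty_derivative:
  assumes c: "c \<in> A" "x \<in> cdom c"
  shows "((\<lambda>a. (norm (y - g (cinv c a)))\<^sup>2) has_derivative
      (\<lambda>w. - 2 * ((y - g x) \<bullet> mdiff A g x (tv c x w)))) (at (cmap c x))"
    and "((\<lambda>a. (norm (pos_part (z - h (cinv c a))))\<^sup>2) has_derivative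
      (\<lambda>w. - 2 * (pos_part (z - h x) \<bullet> mdiff A h x (tv c x w)))) (at (cmap c x))"
  using has_derivative_norm_square_comp[OF has_derivative_diff[OF has_derivative_const fgh_derivative(2)[OF c]], of y]
    has_derivative_norm_pos_part_square_comp[OF has_derivative_diff[OF has_derivative_const fgh_derivative(3)[OF c]], of z] c
  by simp_all

text \<open>The slope of the merit function is that of the Lagrangian at shifted multipliers, and
  these are exactly the multipliers stored by Step 4.3. Passing its gradient test thus makes the
  gradient of the Lagrangian small.\<close>

lemma
  assumes \<sigma>: "\<sigma> > 0"
  shows mdifferentiable_merit: "mdifferentiable (merit f g h y z \<sigma>) x"
    and mdiff_merit: "v \<in> TM x \<Longrightarrow> mdiff A (merit f g h y z \<sigma>) x v =
      dlag 1 (y - (1 / \<sigma>) *\<^sub>R g x) (pos_part (z - (1 / \<sigma>) *\<^sub>R h x)) x v"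
proof -
  have e1: "y - (1 / \<sigma>) *\<^sub>R g x = (1 / \<sigma>) *\<^sub>R (\<sigma> *\<^sub>R y - g x)"
    using \<sigma> by (simp add: algebra_simps)
  have "z - (1 / \<sigma>) *\<^sub>R h x = (1 / \<sigma>) *\<^sub>R (\<sigma> *\<^sub>R z - h x)"
    using \<sigma> by (simp add: algebra_simps)
  then have e2: "pos_part (z - (1 / \<sigma>) *\<^sub>R h x) = (1 / \<sigma>) *\<^sub>R pos_part (\<sigma> *\<^sub>R z - h x)"
    using pos_part_scaleR[of "1 / \<sigma>" "\<sigma> *\<^sub>R z - h x"] \<sigma> by simp
  have "((merit f g h y z \<sigma> \<circ> cinv c) has_derivative
      (\<lambda>u. dlag 1 (y - (1 / \<sigma>) *\<^sub>R g x) (pos_part (z - (1 / \<sigma>) *\<^sub>R h x)) x (tv c x u))) (at (cmap c x))"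
    if c: "c \<in> A" "x \<in> cdom c" for c
    unfolding o_def merit_def dlag_def e1 e2
    by (rule has_derivative_eq_rhs[OF has_derivative_add[OF has_derivative_add[OF fgh_derivative(1)[OF c]
          has_derivative_mult_right[OF penalty_derivative(1)[OF c]]]
          has_derivative_mult_right[OF penalty_derivative(2)[OF c]]]])
       (use \<sigma> in \<open>simp add: fun_eq_iff\<close>)
  from mdiff_dlagI[OF this] show "mdifferentiable (merit f g h y z \<sigma>) x"
    "v \<in> TM x \<Longrightarrow> mdiff A (merit f g h y z \<sigma>) x v =
      dlag 1 (y - (1 / \<sigma>) *\<^sub>R g x) (pos_part (z - (1 / \<sigma>) *\<^sub>R h x)) x v" by blast+
qed

lemma mdifferentiable_violation: "mdifferentiable (violation g h) x"
  and mdiff_violation: "v \<in> TM x \<Longrightarrow>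
    mdiff A (violation g h) x v = dlag 0 (- g x) (pos_part (- h x)) x v"
proof -
  have "((violation g h \<circ> cinv c) has_derivative
      (\<lambda>u. dlag 0 (- g x) (pos_part (- h x)) x (tv c x u))) (at (cmap c x))"
    if c: "c \<in> A" "x \<in> cdom c" for c
  proof -
    have "(\<lambda>a. violation g h (cinv c a))
        = (\<lambda>a. 1/2 * (norm (0 - g (cinv c a)))\<^sup>2 + 1/2 * (norm (pos_part (0 - h (cinv c a))))\<^sup>2)"
      by (simp add: violation_def)
    then show ?thesis
      unfolding o_def dlag_def
      by (simp only:) (rule has_derivative_eq_rhs[OF has_derivative_add[OF
          has_derivative_mult_right[OF penalty_derivative(1)[OF c]]
          has_derivative_mult_right[OF penalty_derivative(2)[OF c]]]], simp add: fun_eq_iff)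
  qed
  from mdiff_dlagI[OF this] show "mdifferentiable (violation g h) x"
    "v \<in> TM x \<Longrightarrow> mdiff A (violation g h) x v = dlag 0 (- g x) (pos_part (- h x)) x v" by blast+
qed

lemma tendsto_dlag:
  assumes c: "c \<in> A" "x \<in> cdom c" and X: "(X \<longlongrightarrow> x) F" and U: "(U \<longlongrightarrow> u) F"
    and l: "(a \<longlongrightarrow> a') F" "(Y \<longlongrightarrow> y) F" "(Z \<longlongrightarrow> z) F"
  shows "((\<lambda>n. dlag (a n) (Y n) (Z n) (X n) (tv c (X n) (U n))) \<longlongrightarrow> dlag a' y z x (tv c x u)) F"
  unfolding dlag_def
  by (intro tendsto_intros l tendsto_mdiff[OF _ c X U] f_C1 g_C1 h_C1)

text \<open>\<open>v\<close> is carried to the points \<open>X n\<close> with fixed coordinates in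
  one chart. The norms of these vectors converge, so the factors \<open>e n\<close> force the limit
  of the differentials to vanish.\<close>

lemma dlag_limit:
  assumes X: "X \<longlonglongrightarrow> x" and l: "a \<longlonglongrightarrow> a'" "Y \<longlonglongrightarrow> y" "Z \<longlonglongrightarrow> z" and e: "e \<longlonglongrightarrow> 0"
    and bound: "\<And>n v. v \<in> TM (X n) \<Longrightarrow> \<bar>dlag (a n) (Y n) (Z n) (X n) v\<bar> \<le> e n * rnorm G (X n) v"
    and v: "v \<in> TM x"
  shows "dlag a' y z x v = 0"
proof -
  obtain c where c: "c \<in> A" "x \<in> cdom c" by (rule chart_around)
  let ?t = "\<lambda>n. tv c (X n) (v c)"
  have lim: "(\<lambda>n. dlag (a n) (Y n) (Z n) (X n) (?t n)) \<longlonglongrightarrow> dlag a' y z x v"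
    using tendsto_dlag[OF c X tendsto_const l, of "v c"] tvec_of_tangent[OF c v] by simp
  have "(\<lambda>n. e n * rnorm G (X n) (?t n)) \<longlonglongrightarrow> 0 * rnorm G x (tv c x (v c))"
    by (intro tendsto_intros e tendsto_rnorm[OF c X])
  then have e0: "(\<lambda>n. e n * rnorm G (X n) (?t n)) \<longlonglongrightarrow> 0" by simp
  have "\<forall>\<^sub>F n in sequentially. X n \<in> cdom c"
    by (rule topological_tendstoD[OF X open_cdom[OF c(1)] c(2)])
  then have "\<forall>\<^sub>F n in sequentially. norm (dlag (a n) (Y n) (Z n) (X n) (?t n)) \<le> e n * rnorm G (X n) (?t n)"
    by (rule eventually_mono) (use bound c in simp)
  from Lim_null_comparison[OF this e0] show ?thesis
    using LIMSEQ_unique[OF lim] by simp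
qed

lemma abs_dlag_le:
  "v \<in> TM x \<Longrightarrow>
    \<bar>dlag 1 y z x v\<bar> \<le> rnorm G x (gradL x y z) * rnorm G x v"
  using abs_mdiff_le[OF mdifferentiable_lagrangian] mdiff_lagrangian
  unfolding grad_lagrangian_def by simp

lemma rnorm_grad_lagrangian_nonneg: "rnorm G x (gradL x y z) \<ge> 0"
  unfolding grad_lagrangian_def by (intro rnorm_nonneg grad_in mdifferentiable_lagrangian)

lemma grad_lagrangian_eq_0:
  assumes "\<And>v. v \<in> TM x \<Longrightarrow> dlag 1 y z x v = 0"
  shows "gradL x y z = 0"
  unfolding grad_lagrangian_def
  by (rule grad_eq_0[OF mdifferentiable_lagrangian]) (simp add: mdiff_lagrangian assms)

lemma vec_limit_nonneg:
  fixes Z :: "nat \<Rightarrow> real^'n"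
  assumes "Z \<longlonglongrightarrow> z" "\<And>n. 0 \<le> Z n" shows "0 \<le> z"
  unfolding less_eq_vec_def
proof
  fix i have "(\<lambda>n. Z n $ i) \<longlonglongrightarrow> z $ i" by (intro tendsto_vec_nth assms)
  then show "0 $ i \<le> z $ i"
    using LIMSEQ_le_const[of "\<lambda>n. Z n $ i" "z $ i" 0] assms(2) by (simp add: less_eq_vec_def)
qed

text \<open>Each summand of the residual is bounded by the residual, so the conditions pass to the
  limit one by one. The gradients live in different tangent spaces and are therefore treated through
  \<open>dlag_limit\<close>.\<close>

lemma KKT_limit:
  assumes X: "X \<longlonglongrightarrow> x" and YZ: "Y \<longlonglongrightarrow> y" "Z \<longlonglongrightarrow> z" and Z0: "\<And>n. 0 \<le> Z n"
    and res: "(\<lambda>n. residual (X n) (Y n) (Z n)) \<longlonglongrightarrow> 0"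
  shows "KKT_point A G f g h x"
proof -
  let ?r = "\<lambda>n. residual (X n) (Y n) (Z n)"
  have le: "norm (g (X n)) \<le> ?r n" "norm (pos_part (- h (X n))) \<le> ?r n"
    "rnorm G (X n) (gradL (X n) (Y n) (Z n)) \<le> ?r n" "\<bar>Z n \<bullet> h (X n)\<bar> \<le> ?r n" for n
    using rnorm_grad_lagrangian_nonneg[of "X n" "Y n" "Z n"] by (auto simp: KKT_res_def)
  have null: "b = 0" if "B \<longlonglongrightarrow> b" "\<And>n. norm (B n) \<le> ?r n" for B and b :: "'d::real_normed_vector"
    using LIMSEQ_unique[OF that(1) Lim_null_comparison[OF always_eventually res, of B]] that(2) by simp
  have g: "(\<lambda>n. g (X n)) \<longlonglongrightarrow> g x" and h: "(\<lambda>n. h (X n)) \<longlonglongrightarrow> h x"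
    using isCont_tendsto_compose[OF isCont_fgh(2) X] isCont_tendsto_compose[OF isCont_fgh(3) X] by auto
  have "g x = 0" using null[OF g le(1)] .
  moreover have "pos_part (- h x) = 0"
    using null[OF tendsto_pos_part[OF tendsto_minus[OF h]] le(2)] .
  moreover have "z \<bullet> h x = 0" using null[OF tendsto_inner[OF YZ(2) h]] le(4) by simp
  moreover have "0 \<le> z" by (rule vec_limit_nonneg[OF YZ(2) Z0])
  moreover have "gradL x y z = 0"
  proof (rule grad_lagrangian_eq_0)
    fix v assume v: "v \<in> TM x"
    show "dlag 1 y z x v = 0"
    proof (rule dlag_limit[OF X tendsto_const YZ res _ v])
      fix n w assume w: "w \<in> TM (X n)"
      show "\<bar>dlag 1 (Y n) (Z n) (X n) w\<bar> \<le> ?r n * rnorm G (X n) w"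
        by (rule order_trans[OF abs_dlag_le[OF w] mult_right_mono[OF le(3)]]) (use w in simp)
    qed
  qed
  ultimately show ?thesis unfolding KKT_point_def pos_part_minus_eq_0 by blast
qed

text \<open>A small positive multiple of \<open>(y, z)\<close> belongs to the set in
  \<open>ERCQ\<close>. Pairing its representation with \<open>(y, z)\<close> makes the differentials
  cancel and leaves nonpositive terms. Serves both for Fritz John limits with vanishing objective
  weight and for stationary points of the violation.\<close>

lemma ERCQ_multipliers_zero:
  assumes E: "ERCQ A g h x" and z: "0 \<le> z"
    and d: "\<And>v. v \<in> TM x \<Longrightarrow> dlag 0 y z x v = 0" and le: "y \<bullet> g x + z \<bullet> h x \<le> 0"
  shows "y = 0 \<and> z = 0"
proof -
  let ?S = "{(g x + mdiff A g x \<xi>, h x + mdiff A h x \<xi> - w) | \<xi> w. \<xi> \<in> TM x \<and> 0 \<le> w}"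
  obtain e where e: "e > 0" "ball (0, 0) e \<subseteq> ?S"
    using E unfolding ERCQ_def mem_interior by blast
  \<comment> \<open>Half the radius relative to the size of the multipliers; the summand 1 avoids a
    division by zero.\<close>
  define t where "t = e / (2 * (norm (y, z) + 1))"
  have t: "t > 0" using e by (simp add: t_def add_nonneg_pos)
  have "t * norm (y, z) < e"
  proof -
    have "t * norm (y, z) \<le> t * (norm (y, z) + 1)" using t by (intro mult_left_mono) auto
    also have "\<dots> = e / 2"
    proof -
      have "0 < 2 * (norm (y, z) + 1)" by (simp add: add_nonneg_pos)
      then have "t * (2 * (norm (y, z) + 1)) = e" by (simp only: t_def) simp
      then show ?thesis by (simp add: algebra_simps)
    qed
    finally show ?thesis using e by simp
  qed
  then have "norm (t *\<^sub>R (y, z)) < e" using t by (simp only: norm_scaleR abs_of_pos)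
  then have "(t *\<^sub>R y, t *\<^sub>R z) \<in> ball (0, 0) e" by (simp add: zero_prod_def[symmetric])
  from subsetD[OF e(2) this] have "(t *\<^sub>R y, t *\<^sub>R z) \<in> ?S" .
  then obtain \<xi> w where \<xi>: "\<xi> \<in> TM x" "0 \<le> w"
    "t *\<^sub>R y = g x + mdiff A g x \<xi>" "t *\<^sub>R z = h x + mdiff A h x \<xi> - w" by auto
  have "t * (y \<bullet> y + z \<bullet> z) = y \<bullet> (t *\<^sub>R y) + z \<bullet> (t *\<^sub>R z)" by (simp add: algebra_simps)
  also have "\<dots> = y \<bullet> g x + z \<bullet> h x - dlag 0 y z x \<xi> - z \<bullet> w"
    unfolding \<xi>(3,4) dlag_def by (simp add: inner_add_right inner_diff_right)
  also have "\<dots> \<le> 0" using d[OF \<xi>(1)] le inner_vec_nonneg[OF z \<xi>(2)] by simp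
  finally have "y \<bullet> y + z \<bullet> z \<le> 0" using t by (simp add: mult_le_0_iff)
  then show ?thesis
    by (metis add_nonneg_eq_0_iff antisym add_nonneg_nonneg inner_ge_zero inner_eq_zero_iff)
qed

text \<open>The multipliers, together with the multiplier 1 of the objective, are scaled to be bounded;
  if the multiplier of the objective tends to 0 in the limit, the limit contradicts the
  constraint qualification.\<close>

lemma AKKT_imp_KKT:
  assumes E: "ERCQ A g h x" and feas: "feasible g h x" and S: "AKKT_sequence A G f g h x X Y Z"
  shows "KKT_point A G f g h x"
proof -
  have X: "X \<longlonglongrightarrow> x" and Z0: "\<And>n. 0 \<le> Z n"
    and gr: "(\<lambda>n. rnorm G (X n) (gradL (X n) (Y n) (Z n))) \<longlonglongrightarrow> 0"
    and co: "(\<lambda>n. Z n \<bullet> pos_part (h (X n))) \<longlonglongrightarrow> 0"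
    using S by (auto simp: AKKT_sequence_def)
  define N where "N = (\<lambda>n. 1 / (1 + norm (Y n, Z n)))"
  define W where "W = (\<lambda>n. (N n, N n *\<^sub>R (Y n, Z n)))"
  have N: "0 < N n" "N n \<le> 1" for n
    by (auto simp: N_def add_pos_nonneg)
  \<comment> \<open>The scaled weight and multipliers have total size exactly 1, so their limits
    cannot all vanish.\<close>
  have NW: "N n + norm (N n *\<^sub>R (Y n, Z n)) = 1" for n
  proof -
    have "1 + norm (Y n, Z n) \<noteq> 0" by (smt (verit) norm_ge_zero)
    then have "N n * (1 + norm (Y n, Z n)) = 1" by (simp add: N_def)
    moreover have "norm (N n *\<^sub>R (Y n, Z n)) = N n * norm (Y n, Z n)"
      using N(1)[of n] by (simp only: norm_scaleR abs_of_pos)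
    ultimately show ?thesis by (simp add: distrib_left)
  qed
  have "W n \<in> {0..1} \<times> cball 0 1" for n
    using N[of n] NW[of n] by (simp add: W_def)
  moreover have "compact ({0..1::real} \<times> cball (0 :: (real^'m) \<times> (real^'l)) 1)"
    by (intro compact_Times) auto
  ultimately have "\<exists>w\<in>{0..1} \<times> cball 0 1. \<exists>r. strict_mono r \<and> (W \<circ> r) \<longlonglongrightarrow> w"
    unfolding compact_def by blast
  then obtain w r where r: "w \<in> {0..1} \<times> cball 0 1" "strict_mono r" "(W \<circ> r) \<longlonglongrightarrow> w"
    by blast
  define \<nu> y z where "\<nu> = fst w" and "y = fst (snd w)" and "z = snd (snd w)"
  have \<nu>: "(\<lambda>n. N (r n)) \<longlonglongrightarrow> \<nu>" and y: "(\<lambda>n. N (r n) *\<^sub>R Y (r n)) \<longlonglongrightarrow> y"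
    and z: "(\<lambda>n. N (r n) *\<^sub>R Z (r n)) \<longlonglongrightarrow> z"
    using tendsto_fst[OF r(3)] tendsto_fst[OF tendsto_snd[OF r(3)]] tendsto_snd[OF tendsto_snd[OF r(3)]]
    by (simp_all add: W_def \<nu>_def y_def z_def)
  have Xr: "(\<lambda>n. X (r n)) \<longlonglongrightarrow> x" using LIMSEQ_subseq_LIMSEQ[OF X r(2)] by (simp add: o_def)
  have d: "dlag \<nu> y z x v = 0" if v: "v \<in> TM x" for v
  proof (rule dlag_limit[OF Xr \<nu> y z _ _ v])
    show "(\<lambda>n. rnorm G (X (r n)) (gradL (X (r n)) (Y (r n)) (Z (r n)))) \<longlonglongrightarrow> 0"
      using LIMSEQ_subseq_LIMSEQ[OF gr r(2)] by (simp add: o_def)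
    fix n v assume v: "v \<in> TM (X (r n))"
    have "dlag (N (r n)) (N (r n) *\<^sub>R Y (r n)) (N (r n) *\<^sub>R Z (r n)) (X (r n)) v
        = N (r n) * dlag 1 (Y (r n)) (Z (r n)) (X (r n)) v" by (simp add: dlag_def algebra_simps)
    then have "\<bar>dlag (N (r n)) (N (r n) *\<^sub>R Y (r n)) (N (r n) *\<^sub>R Z (r n)) (X (r n)) v\<bar>
        = N (r n) * \<bar>dlag 1 (Y (r n)) (Z (r n)) (X (r n)) v\<bar>"
      using N(1)[of "r n"] by (simp add: abs_mult)
    also have "\<dots> \<le> 1 * \<bar>dlag 1 (Y (r n)) (Z (r n)) (X (r n)) v\<bar>"
      using N(2)[of "r n"] by (intro mult_right_mono) auto
    finally show "\<bar>dlag (N (r n)) (N (r n) *\<^sub>R Y (r n)) (N (r n) *\<^sub>R Z (r n)) (X (r n)) v\<bar>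
        \<le> rnorm G (X (r n)) (gradL (X (r n)) (Y (r n)) (Z (r n))) * rnorm G (X (r n)) v"
      using abs_dlag_le[OF v, of "Y (r n)" "Z (r n)"] by simp
  qed
  have z0: "0 \<le> z"
    by (rule vec_limit_nonneg[OF z]) (use N(1) Z0 in \<open>simp add: less_eq_vec_def less_imp_le\<close>)
  have gx: "g x = 0" and hx: "0 \<le> h x" using feas by (auto simp: feasible_def)
  have "(\<lambda>n. h (X (r n))) \<longlonglongrightarrow> h x" using isCont_tendsto_compose[OF isCont_fgh(3) Xr] .
  then have 1: "(\<lambda>n. N (r n) *\<^sub>R Z (r n) \<bullet> pos_part (h (X (r n)))) \<longlonglongrightarrow> z \<bullet> pos_part (h x)"
    by (intro tendsto_inner z tendsto_pos_part)
  have 2: "(\<lambda>n. N (r n) *\<^sub>R Z (r n) \<bullet> pos_part (h (X (r n)))) \<longlonglongrightarrow> 0"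
    using tendsto_mult[OF \<nu> LIMSEQ_subseq_LIMSEQ[OF co r(2)]] by (simp add: o_def)
  \<comment> \<open>The sequential complementarity involves \<open>pos_part (h (X n))\<close>;
    feasibility of \<open>x\<close> turns its limit into \<open>h x\<close>.\<close>
  have zh: "z \<bullet> h x = 0" using LIMSEQ_unique[OF 1 2] pos_part_of_nonneg[OF hx] by simp
  have "\<nu> \<noteq> 0"
  proof
    assume "\<nu> = 0"
    then have "y = 0 \<and> z = 0" using ERCQ_multipliers_zero[OF E z0, of y] d gx zh by simp
    moreover have "(\<lambda>n. N (r n) + norm (N (r n) *\<^sub>R Y (r n), N (r n) *\<^sub>R Z (r n))) \<longlonglongrightarrow> \<nu> + norm (y, z)"
      by (intro tendsto_intros \<nu> y z)
    then have "\<nu> + norm (y, z) = 1" using NW by (simp add: LIMSEQ_const_iff)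
    ultimately show False using \<open>\<nu> = 0\<close> by (simp add: zero_prod_def[symmetric])
  qed
  then have \<nu>0: "\<nu> > 0" using r(1) by (auto simp: \<nu>_def)
  have "dlag 1 ((1 / \<nu>) *\<^sub>R y) ((1 / \<nu>) *\<^sub>R z) x v = 0" if "v \<in> TM x" for v
  proof -
    have "dlag 1 ((1 / \<nu>) *\<^sub>R y) ((1 / \<nu>) *\<^sub>R z) x v = (1 / \<nu>) * dlag \<nu> y z x v"
      using \<nu>0 by (simp add: dlag_def field_simps)
    then show ?thesis using d[OF that] by simp
  qed
  then have "gradL x ((1 / \<nu>) *\<^sub>R y) ((1 / \<nu>) *\<^sub>R z) = 0"
    by (rule grad_lagrangian_eq_0)
  moreover have "0 \<le> (1 / \<nu>) *\<^sub>R z" using z0 \<nu>0 by (simp add: less_eq_vec_def)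
  ultimately show ?thesis unfolding KKT_point_def using gx hx zh
    by (intro exI[of _ "(1 / \<nu>) *\<^sub>R y"] exI[of _ "(1 / \<nu>) *\<^sub>R z"]) simp
qed

text \<open>For the multipliers \<open>- g x\<close> and \<open>pos_part (- h x)\<close> the pairing
  with the constraint values is minus twice the violation, so \<open>ERCQ_multipliers_zero\<close>
  applies and forces both to vanish.\<close>

lemma ERCQ_stationary_feasible:
  assumes E: "ERCQ A g h x" and d: "\<And>v. v \<in> TM x \<Longrightarrow> dlag 0 (- g x) (pos_part (- h x)) x v = 0"
  shows "feasible g h x"
proof -
  have "pos_part (- h x) \<bullet> h x = - (norm (pos_part (- h x)))\<^sup>2"
    using pos_part_inner_self[of "- h x"] by simp
  then have "- g x \<bullet> g x + pos_part (- h x) \<bullet> h x \<le> 0"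
    using inner_ge_zero[of "g x"] zero_le_power2[of "norm (pos_part (- h x))"]
    unfolding inner_minus_left by linarith
  from ERCQ_multipliers_zero[OF E _ d this] show ?thesis
    by (simp add: feasible_def pos_part_minus_eq_0)
qed

section \<open>The subproblem\<close>

text \<open>Eliminating \<open>\<eta>\<close> leaves an unconstrained problem in
  \<open>\<xi>\<close> that is differentiable along lines; its derivative vanishes at
  \<open>p\<close>. The left side of the stationarity equation is the slope of the merit function at
  the current iterate, so the term with \<open>pos_part t\<close> is added on both sides.\<close>

lemma subproblem_optimality:
  assumes opt: "subproblem_optimizer A G f g h H s p \<eta>" and sa: "self_adjoint_operator A G (st_x s) H"
    and \<sigma>: "st_sigma s > 0"
  defines "x \<equiv> st_x s" and "t \<equiv> st_zh s - (1 / st_sigma s) *\<^sub>R h (st_x s)"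
  shows subproblem_tangent: "p \<in> TM x"
    and subproblem_stationary: "u \<in> TM x \<Longrightarrow>
      dlag 1 (st_yh s - (1 / st_sigma s) *\<^sub>R g x) (pos_part t) x u
      = - G x (M_op A G g H s p) u
        + (pos_part (t - (1 / st_sigma s) *\<^sub>R mdiff A h x p) - pos_part t) \<bullet> mdiff A h x u"
    and G_M_op: "u \<in> TM x \<Longrightarrow> v \<in> TM x \<Longrightarrow>
      G x (M_op A G g H s u) v = G x (H u) v + (1 / st_sigma s) * (mdiff A g x u \<bullet> mdiff A g x v)"
proof -
  define \<sigma> where "\<sigma> = st_sigma s"
  define y where "y = st_yh s - (1 / \<sigma>) *\<^sub>R g x"
  have \<sigma>0: "\<sigma> > 0" using \<sigma> by (simp add: \<sigma>_def)
  note D = mdifferentiable_fgh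
  have Hin: "H u \<in> TM x" if "u \<in> TM x" for u
    using sa that by (simp add: self_adjoint_operator_def x_def)
  have Hlin: "H (a *\<^sub>R u + b *\<^sub>R v) = a *\<^sub>R H u + b *\<^sub>R H v" and Hsym: "G x (H u) v = G x u (H v)"
    if "u \<in> TM x" "v \<in> TM x" for u v a b
    using sa that by (simp_all add: self_adjoint_operator_def x_def)
  show M: "G x (M_op A G g H s u) v = G x (H u) v + (1 / st_sigma s) * (mdiff A g x u \<bullet> mdiff A g x v)"
    if "u \<in> TM x" "v \<in> TM x" for u v
    unfolding M_op_def x_def[symmetric] using that D Hin
    by (simp add: G_add_left G_scaleR_left mdiff_adj_in tangent_scaleR G_mdiff_adj)
  define q where "q = (\<lambda>\<xi> \<eta>. G x (grad A G f x - mdiff_adj A G g x y) \<xi>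
              + 1/2 * G x (M_op A G g H s \<xi>) \<xi> + \<sigma>/2 * (norm (\<eta> :: real^'l))\<^sup>2)"
  have opt': "is_arg_min (\<lambda>(\<xi>, \<eta>). q \<xi> \<eta>) (\<lambda>(\<xi>, \<eta>). \<xi> \<in> TM x \<and> 0 \<le> mdiff A h x \<xi> + \<sigma> *\<^sub>R (\<eta> - t)) (p, \<eta>)"
    using opt unfolding subproblem_optimizer_def Let_def q_def x_def t_def y_def \<sigma>_def .
  then have feas: "0 \<le> mdiff A h x p + \<sigma> *\<^sub>R (\<eta> - t)" and p: "p \<in> TM x"
    by (auto simp: is_arg_min_def)
  show "p \<in> TM x" by (rule p)
  have min: "q p \<eta> \<le> q \<xi> \<zeta>" if "\<xi> \<in> TM x" "0 \<le> mdiff A h x \<xi> + \<sigma> *\<^sub>R (\<zeta> - t)" for \<xi> \<zeta>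
    using opt' that by (force simp: is_arg_min_def not_less)
  \<comment> \<open>For given \<open>\<xi>\<close> this is the feasible \<open>\<eta>\<close> of
    smallest norm: each component is raised to its lower bound or, where that is negative, set to
    0.\<close>
  define w where "w = (\<lambda>\<xi>. pos_part (t - (1 / \<sigma>) *\<^sub>R mdiff A h x \<xi>))"
  have wfeas: "0 \<le> mdiff A h x \<xi> + \<sigma> *\<^sub>R (w \<xi> - t)" for \<xi>
    unfolding less_eq_vec_def
  proof
    fix i
    have "\<sigma> * (t $ i - (1 / \<sigma>) * mdiff A h x \<xi> $ i) \<le> \<sigma> * w \<xi> $ i"
      using \<sigma>0 by (intro mult_left_mono) (auto simp: w_def)
    then show "0 $ i \<le> (mdiff A h x \<xi> + \<sigma> *\<^sub>R (w \<xi> - t)) $ i"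
      using \<sigma>0 by (simp add: algebra_simps)
  qed
  have "norm (w p) \<le> norm \<eta>"
  proof (rule norm_vec_mono)
    fix i
    have "0 \<le> mdiff A h x p $ i + \<sigma> * (\<eta> $ i - t $ i)" using feas by (simp add: less_eq_vec_def)
    then have "t $ i - mdiff A h x p $ i / \<sigma> \<le> \<eta> $ i" using \<sigma>0 by (simp add: field_simps)
    then show "\<bar>w p $ i\<bar> \<le> \<bar>\<eta> $ i\<bar>" by (auto simp: w_def)
  qed
  then have "q p (w p) \<le> q p \<eta>" using \<sigma>0 unfolding q_def by (simp add: mult_left_mono power_mono)
  then have minw: "q p (w p) \<le> q \<xi> (w \<xi>)" if "\<xi> \<in> TM x" for \<xi>
    using min[OF that wfeas] by linarith
  assume u: "u \<in> TM x"
  let ?M = "\<lambda>u v. G x (M_op A G g H s u) v"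
  let ?a = "t - (1 / \<sigma>) *\<^sub>R mdiff A h x p" and ?b = "(1 / \<sigma>) *\<^sub>R mdiff A h x u"
  define c where "c = G x (grad A G f x - mdiff_adj A G g x y)"
  \<comment> \<open>The reduced objective along the line through \<open>p\<close> with direction
    \<open>u\<close>, expanded so that its derivative at 0 is visible.\<close>
  define \<phi> where "\<phi> = (\<lambda>\<tau>. c p + \<tau> * c u + 1/2 * (?M p p + 2 * \<tau> * ?M p u + \<tau>\<^sup>2 * ?M u u)
    + \<sigma>/2 * (norm (pos_part (?a - \<tau> *\<^sub>R ?b)))\<^sup>2)"
  have \<phi>: "\<phi> \<tau> = q (p + \<tau> *\<^sub>R u) (w (p + \<tau> *\<^sub>R u))" for \<tau>
  proof -
    have pt: "p + \<tau> *\<^sub>R u \<in> TM x" using p u by (simp add: tangent_add tangent_scaleR)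
    have Hp: "H (p + \<tau> *\<^sub>R u) = H p + \<tau> *\<^sub>R H u" using Hlin[OF p u, of 1 \<tau>] by simp
    have gp: "mdiff A g x (p + \<tau> *\<^sub>R u) = mdiff A g x p + \<tau> *\<^sub>R mdiff A g x u"
      using p u D by (simp add: mdiff_add mdiff_scaleR tangent_scaleR)
    have hp: "mdiff A h x (p + \<tau> *\<^sub>R u) = mdiff A h x p + \<tau> *\<^sub>R mdiff A h x u"
      using p u D by (simp add: mdiff_add mdiff_scaleR tangent_scaleR)
    have c: "c (p + \<tau> *\<^sub>R u) = c p + \<tau> * c u"
      unfolding c_def using p u
      by (simp add: D grad_in mdiff_adj_in G_add_right G_scaleR_right tangent_diff tangent_scaleR)
    have Hup: "G x (H u) p = G x (H p) u" using Hsym[OF u p] G_sym[OF u Hin[OF p]] by simp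
    have "?M (p + \<tau> *\<^sub>R u) (p + \<tau> *\<^sub>R u) = ?M p p + 2 * \<tau> * ?M p u + \<tau>\<^sup>2 * ?M u u"
      using p u Hin Hup
      by (simp add: M pt Hp gp G_add_left G_add_right G_scaleR_left G_scaleR_right tangent_add tangent_scaleR
          inner_add_left inner_add_right power2_eq_square inner_commute algebra_simps)
    moreover have "w (p + \<tau> *\<^sub>R u) = pos_part (?a - \<tau> *\<^sub>R ?b)"
      by (simp add: w_def hp algebra_simps)
    ultimately show ?thesis unfolding \<phi>_def q_def c_def[symmetric] by (simp add: c)
  qed
  have "(\<phi> has_derivative (\<lambda>\<tau>. \<tau> * (c u + ?M p u - pos_part ?a \<bullet> mdiff A h x u))) (at 0)"
    unfolding \<phi>_def
    by (rule derivative_eq_intros has_derivative_norm_pos_part_square_comp refl)+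
       (use \<sigma>0 in \<open>auto simp: fun_eq_iff field_simps\<close>)
  then have der: "(\<phi> has_real_derivative (c u + ?M p u - pos_part ?a \<bullet> mdiff A h x u)) (at 0)"
    unfolding has_field_derivative_def by (rule has_derivative_eq_rhs) (simp add: fun_eq_iff)
  have "\<phi> 0 \<le> \<phi> \<tau>" for \<tau>
    unfolding \<phi> using minw[of "p + \<tau> *\<^sub>R u"] p u by (simp add: tangent_add tangent_scaleR)
  then have "c u + ?M p u - pos_part ?a \<bullet> mdiff A h x u = 0"
    by (intro DERIV_local_min[OF der, of 1]) auto
  moreover have "c u = mdiff A f x u - y \<bullet> mdiff A g x u"
    unfolding c_def using u D by (simp add: G_diff_left grad_in mdiff_adj_in G_grad G_mdiff_adj)
  ultimately show "dlag 1 (st_yh s - (1 / st_sigma s) *\<^sub>R g x) (pos_part t) x u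
      = - G x (M_op A G g H s p) u
        + (pos_part (t - (1 / st_sigma s) *\<^sub>R mdiff A h x p) - pos_part t) \<bullet> mdiff A h x u"
    unfolding dlag_def y_def \<sigma>_def by (simp add: inner_diff_left)
qed

end

section \<open>Line search\<close>

text \<open>The mean value theorem along the retraction curve expresses the quotient as a slope of
  \<open>F\<close> at an intermediate point. The base points move with \<open>n\<close>, so joint
  smoothness of the retraction in point and vector is used; its derivative at the zero vector turns
  the limit direction into \<open>u\<close>.\<close>

lemma (in smooth_manifold) retraction_difference_quotient:
  fixes F :: "'p \<Rightarrow> real"
  assumes R: "manifold_retraction A R" and c: "c \<in> A" "x \<in> cdom c"
    and X: "X \<longlonglongrightarrow> x" and U: "U \<longlonglongrightarrow> u" and b: "b \<longlonglongrightarrow> 0" "\<And>n. b n > 0"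
    and F: "\<And>x. mdifferentiable F x"
    and F': "\<And>Y V v. Y \<longlonglongrightarrow> x \<Longrightarrow> V \<longlonglongrightarrow> v \<Longrightarrow>
      (\<lambda>n. mdiff A F (Y n) (tv c (Y n) (V n))) \<longlonglongrightarrow> mdiff A F x (tv c x v)"
  shows "(\<lambda>n. (F (R (X n) (b n *\<^sub>R tv c (X n) (U n))) - F (X n)) / b n)
    \<longlonglongrightarrow> mdiff A F x (tv c x u)"
proof -
  define \<rho> where "\<rho> = (\<lambda>(a, w). cmap c (R (cinv c a) (tv c (cinv c a) w)))"
  define W where "W = {(a, w). a \<in> cmap c ` cdom c \<and> R (cinv c a) (tv c (cinv c a) w) \<in> cdom c}"
  have R0: "R y 0 = y" for y using R by (simp add: manifold_retraction_def)
  have R1: "((\<lambda>u. cmap c (R x (tv c x u))) has_derivative (\<lambda>u. u)) (at 0)"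
    using R c unfolding manifold_retraction_def by blast
  have W: "open W" "smooth_on W \<rho>"
    using R c(1) unfolding manifold_retraction_def Let_def W_def \<rho>_def by blast+
  have \<rho>C1: "Ck_on (Suc 0) W \<rho>" using W(2) unfolding smooth_on_def by blast
  define D where "D = (\<lambda>q. frechet_derivative \<rho> (at q))"
  have D: "(\<rho> has_derivative D q) (at q)" if "q \<in> W" for q
    unfolding D_def by (rule Ck_on_has_derivative[OF \<rho>C1 that])
  define a0 where "a0 = cmap c x"
  define a where "a = (\<lambda>n. cmap c (X n))"
  have a: "a \<longlonglongrightarrow> a0"
    unfolding a_def a0_def by (rule isCont_tendsto_compose[OF isCont_cmap[OF c] X])
  have inW: "(a0, 0) \<in> W" using c by (simp add: W_def a0_def R0)
  have \<rho>0: "\<rho> (a0, 0) = a0" using c by (simp add: \<rho>_def a0_def R0)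
  \<comment> \<open>In the vector argument the derivative at the zero section is the identity, by
    the defining property of a retraction.\<close>
  have D0: "D (a0, 0) (0, w) = w" for w
  proof -
    have "((\<lambda>w. (a0, w)) has_derivative (\<lambda>w. (0, w))) (at 0)"
      by (auto intro!: derivative_eq_intros)
    from diff_chain_at[OF this D[OF inW]]
    have "((\<lambda>w. cmap c (R x (tv c x w))) has_derivative (\<lambda>w. D (a0, 0) (0, w))) (at 0)"
      using c by (simp add: o_def \<rho>_def a0_def)
    then show ?thesis using has_derivative_unique[OF _ R1] by metis
  qed
  obtain e where e: "e > 0" "ball (a0, 0) e \<subseteq> W"
    using W(1) inW open_contains_ball by blast
  \<comment> \<open>Holds eventually and keeps the coordinate segment from \<open>(a n, 0)\<close>
    to \<open>(a n, b n *\<^sub>R U n)\<close> inside the chart domain \<open>W\<close>. For other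
    \<open>n\<close> the chosen \<open>\<tau> n\<close> is arbitrary.\<close>
  define good where "good = (\<lambda>n. X n \<in> cdom c \<and> dist (a n) a0 < e / 2 \<and> b n * norm (U n) < e / 2)"
  have "(\<lambda>n. b n * norm (U n)) \<longlonglongrightarrow> 0 * norm u" by (intro tendsto_intros b U)
  then have "\<forall>\<^sub>F n in sequentially. b n * norm (U n) < e / 2"
    using e(1) by (intro order_tendstoD(2)[where a="e / 2"]) auto
  moreover have "\<forall>\<^sub>F n in sequentially. dist (a n) a0 < e / 2"
    using tendstoD[OF a, of "e / 2"] e(1) by simp
  moreover have "\<forall>\<^sub>F n in sequentially. X n \<in> cdom c"
    by (rule topological_tendstoD[OF X open_cdom[OF c(1)] c(2)])
  ultimately have ev: "\<forall>\<^sub>F n in sequentially. good n"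
    unfolding good_def by eventually_elim simp
  have goodW: "(a n, \<tau> *\<^sub>R U n) \<in> W" if "good n" "0 \<le> \<tau>" "\<tau> \<le> b n" for n \<tau>
  proof -
    have "dist (a n, \<tau> *\<^sub>R U n) (a0, 0) \<le> dist (a n) a0 + \<tau> * norm (U n)"
      using sqrt_sum_squares_le_sum[of "dist (a n) a0" "\<tau> * norm (U n)"] that(2) by (simp add: dist_Pair_Pair)
    also have "\<dots> < e" using that mult_right_mono[OF that(3), of "norm (U n)"] by (simp add: good_def)
    finally have "(a n, \<tau> *\<^sub>R U n) \<in> ball (a0, 0) e" by (simp add: dist_commute)
    then show ?thesis using e by blast
  qed
  let ?y = "\<lambda>n \<tau>. cinv c (\<rho> (a n, \<tau> *\<^sub>R U n))"
  let ?quot = "\<lambda>n. (F (R (X n) (b n *\<^sub>R tv c (X n) (U n))) - F (X n)) / b n"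
  have "\<exists>\<tau>. 0 < \<tau> \<and> \<tau> < b n \<and>
      ?quot n = mdiff A F (?y n \<tau>) (tv c (?y n \<tau>) (D (a n, \<tau> *\<^sub>R U n) (0, U n)))"
    if n: "good n" for n
  proof -
    let ?\<phi> = "\<lambda>\<tau>. (F \<circ> cinv c) (\<rho> (a n, \<tau> *\<^sub>R U n))"
    have Xn: "X n \<in> cdom c" "cinv c (a n) = X n" using n c by (simp_all add: good_def a_def)
    have y: "?y n \<tau> = R (X n) (tv c (X n) (\<tau> *\<^sub>R U n))" "?y n \<tau> \<in> cdom c"
        "cmap c (?y n \<tau>) = \<rho> (a n, \<tau> *\<^sub>R U n)"
      if "0 \<le> \<tau>" "\<tau> \<le> b n" for \<tau>
      using goodW[OF n that] c Xn by (simp_all add: W_def \<rho>_def)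
    have "(?\<phi> has_derivative (\<lambda>\<sigma>. \<sigma> * mdiff A F (?y n \<tau>) (tv c (?y n \<tau>) (D (a n, \<tau> *\<^sub>R U n) (0, U n)))))
        (at \<tau> within {0..b n})"
      if \<tau>: "0 \<le> \<tau>" "\<tau> \<le> b n" for \<tau>
    proof -
      have 1: "((\<lambda>\<tau>. (a n, \<tau> *\<^sub>R U n)) has_derivative (\<lambda>\<sigma>. (0, \<sigma> *\<^sub>R U n))) (at \<tau>)"
        by (auto intro!: derivative_eq_intros)
      have 2: "((F \<circ> cinv c) has_derivative (\<lambda>w. mdiff A F (?y n \<tau>) (tv c (?y n \<tau>) w))) (at (\<rho> (a n, \<tau> *\<^sub>R U n)))"
        using mdifferentiableD[OF F c(1) y(2)[OF \<tau>]] unfolding y(3)[OF \<tau>] .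
      note lD = has_derivative_linear[OF D[OF goodW[OF n \<tau>]]]
      have "D (a n, \<tau> *\<^sub>R U n) (0, \<sigma> *\<^sub>R U n) = \<sigma> *\<^sub>R D (a n, \<tau> *\<^sub>R U n) (0, U n)" for \<sigma>
        using linear_scale[OF lD, of \<sigma> "(0, U n)"] by simp
      then have "mdiff A F (?y n \<tau>) (tv c (?y n \<tau>) (D (a n, \<tau> *\<^sub>R U n) (0, \<sigma> *\<^sub>R U n)))
          = \<sigma> * mdiff A F (?y n \<tau>) (tv c (?y n \<tau>) (D (a n, \<tau> *\<^sub>R U n) (0, U n)))" for \<sigma>
        using linear_scale[OF has_derivative_linear[OF 2]] by simp
      with diff_chain_at[OF diff_chain_at[OF 1 D[OF goodW[OF n \<tau>]]], unfolded o_def, OF 2[unfolded o_def]]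
      show ?thesis by (simp add: o_def has_derivative_at_withinI)
    qed
    from mvt_simple[OF b(2)[of n] this]
    obtain \<tau> where \<tau>: "\<tau> \<in> {0<..<b n}"
      "?\<phi> (b n) - ?\<phi> 0 = (b n - 0) * mdiff A F (?y n \<tau>) (tv c (?y n \<tau>) (D (a n, \<tau> *\<^sub>R U n) (0, U n)))"
      by blast
    have "?\<phi> (b n) = F (R (X n) (b n *\<^sub>R tv c (X n) (U n)))"
      using y(1)[of "b n"] b(2)[of n] c Xn by (simp add: tvec_of_scaleR)
    moreover have "?\<phi> 0 = F (X n)"
      using y(1)[of 0] b(2)[of n] c Xn by (simp add: R0)
    ultimately show ?thesis using \<tau> b(2)[of n] by (intro exI[of _ \<tau>]) (simp add: field_simps)
  qed
  then obtain \<tau> where \<tau>: "\<And>n. good n \<Longrightarrow> 0 < \<tau> n \<and> \<tau> n < b n \<and>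
      ?quot n = mdiff A F (?y n (\<tau> n)) (tv c (?y n (\<tau> n)) (D (a n, \<tau> n *\<^sub>R U n) (0, U n)))"
    by metis
  have "\<forall>\<^sub>F n in sequentially. norm (\<tau> n) \<le> b n"
    using ev by (rule eventually_mono) (use \<tau> in force)
  from Lim_null_comparison[OF this b(1)] have \<tau>0: "\<tau> \<longlonglongrightarrow> 0" .
  have "(\<lambda>n. (a n, \<tau> n *\<^sub>R U n)) \<longlonglongrightarrow> (a0, 0 *\<^sub>R u)"
    by (intro tendsto_intros a \<tau>0 U)
  then have q: "(\<lambda>n. (a n, \<tau> n *\<^sub>R U n)) \<longlonglongrightarrow> (a0, 0)" by simp
  have "(\<lambda>n. \<rho> (a n, \<tau> n *\<^sub>R U n)) \<longlonglongrightarrow> \<rho> (a0, 0)"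
    by (rule isCont_tendsto_compose[OF has_derivative_continuous[OF D[OF inW]] q])
  then have l: "(\<lambda>n. \<rho> (a n, \<tau> n *\<^sub>R U n)) \<longlonglongrightarrow> a0" by (simp add: \<rho>0)
  have "isCont (cinv c) a0" using isCont_cinv[OF c(1)] c(2) by (simp add: a0_def)
  from isCont_tendsto_compose[OF this l] have Y: "(\<lambda>n. ?y n (\<tau> n)) \<longlonglongrightarrow> x"
    using c by (simp add: a0_def)
  have "(\<lambda>n. (0, U n)) \<longlonglongrightarrow> (0, u)" by (intro tendsto_intros U)
  from C1_derivative_tendsto[OF \<rho>C1 W(1) inW q this]
  have V: "(\<lambda>n. D (a n, \<tau> n *\<^sub>R U n) (0, U n)) \<longlonglongrightarrow> u" using D0 by (simp add: D_def)
  show ?thesis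
    by (rule Lim_transform_eventually[OF F'[OF Y V] eventually_mono[OF ev]]) (use \<tau> in simp)
qed

section \<open>Convergence of the algorithm\<close>

text \<open>A decreasing nonnegative sequence has a limit \<open>l\<close>; passing to the limit
  along the halving indices gives \<open>l \<le> l / 2\<close>.\<close>

lemma repeatedly_halved_tendsto_0:
  fixes a :: "nat \<Rightarrow> real"
  assumes pos: "\<And>k. 0 \<le> a k" and dec: "\<And>k. a (Suc k) \<le> a k"
    and half: "\<And>k. P k \<Longrightarrow> a (Suc k) \<le> a k / 2" and inf: "infinite {k. P k}"
  shows "a \<longlonglongrightarrow> 0"
proof -
  have "decseq a" using dec by (simp add: decseq_Suc_iff)
  then obtain l where l: "a \<longlonglongrightarrow> l" using decseq_convergent[of a 0] pos by metis
  define s where "s = enumerate {k. P k}"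
  have s: "strict_mono s" "P (s n)" for n
    using enumerate_in_set[OF inf, of n] strict_mono_enumerate[OF inf] by (auto simp: s_def)
  have 1: "(\<lambda>n. a (s n)) \<longlonglongrightarrow> l" using LIMSEQ_subseq_LIMSEQ[OF l s(1)] by (simp add: o_def)
  have "strict_mono (\<lambda>n. Suc (s n))" using s(1) by (simp add: strict_mono_def)
  from LIMSEQ_subseq_LIMSEQ[OF l this] have 2: "(\<lambda>n. a (Suc (s n))) \<longlonglongrightarrow> l" by (simp add: o_def)
  have "l \<le> l / 2"
    by (rule LIMSEQ_le[OF 2 tendsto_divide[OF 1 tendsto_const]]) (use half s in auto)
  moreover have "l \<ge> 0" by (rule LIMSEQ_le_const[OF l]) (use pos in auto)
  ultimately show ?thesis using l by simp
qed

locale rssqp = nonlinear_program A G f g h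
  for A :: "('a::{t2_space,second_countable_topology}, 'b::euclidean_space) chart set"
    and G :: "('a, 'b) metric_tensor"
    and f :: "'a \<Rightarrow> real" and g :: "'a \<Rightarrow> real^'m::finite" and h :: "'a \<Rightarrow> real^'l::finite" +
  fixes R :: "'a \<Rightarrow> ('a, 'b) tvec \<Rightarrow> 'a"
    and \<beta> \<epsilon> \<theta> :: real
    and C :: "(real^'m) set"
    and D :: "(real^'l) set"
    and H :: "nat \<Rightarrow> ('a, 'b) tvec \<Rightarrow> ('a, 'b) tvec"
    and S :: "nat \<Rightarrow> ('a, 'm, 'l) rssqp_state"
    and \<nu> :: real
  assumes complete: "mcomplete"
    and retraction: "manifold_retraction A R"
    and run: "rssqp_run A G R f g h \<beta> \<epsilon> \<theta> C D H S"
    and sigma_pos: "st_sigma (S k) > 0"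
    and \<nu>_pos: "\<nu> > 0"
    and coercive: "u \<in> TM (st_x (S k)) \<Longrightarrow>
      1/\<nu> * (rnorm G (st_x (S k)) u)\<^sup>2 \<le> G (st_x (S k)) (M_op A G g (H k) (S k) u) u"
    and H_bounded: "u \<in> TM (st_x (S k)) \<Longrightarrow> v \<in> TM (st_x (S k)) \<Longrightarrow>
      \<bar>G (st_x (S k)) (H k u) v\<bar> \<le> \<nu> * rnorm G (st_x (S k)) u * rnorm G (st_x (S k)) v"
    and iterates_bounded: "mbounded (range (\<lambda>k. st_x (S k)))"
begin

abbreviation "X k \<equiv> st_x (S k)"
abbreviation "\<sigma> k \<equiv> st_sigma (S k)"
abbreviation "yh k \<equiv> st_yh (S k)"
abbreviation "zh k \<equiv> st_zh (S k)"

text \<open>A step only asserts that a direction, a slack and a step exponent exist; this predicate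
  serves to choose one such triple per iteration.\<close>

definition step_data :: "nat \<Rightarrow> ('a, 'b) tvec \<times> (real^'l) \<times> nat \<Rightarrow> bool" where
  "step_data k = (\<lambda>(p, \<eta>, j). subproblem_optimizer A G f g h (H k) (S k) p \<eta> \<and>
     armijo A G R f g h \<beta> \<epsilon> (S k) p j \<and> (\<forall>i<j. \<not> armijo A G R f g h \<beta> \<epsilon> (S k) p i) \<and>
     S (Suc k) = rssqp_update A G f g h \<theta> C D (S k) (R (X k) (\<beta>^j *\<^sub>R p))
       (yh k - (1 / \<sigma> k) *\<^sub>R (g (X k) + mdiff A g (X k) p)) \<eta>)"

definition "dir k = fst (SOME t. step_data k t)"
definition "eta k = fst (snd (SOME t. step_data k t))"
definition "steps k = snd (snd (SOME t. step_data k t))"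
definition "ty k = yh k - (1 / \<sigma> k) *\<^sub>R (g (X k) + mdiff A g (X k) (dir k))"

lemma run_step: "rssqp_step A G R f g h \<beta> \<epsilon> \<theta> C D (H k) (S k) (S (Suc k))"
  and params: "0 < \<beta>" "\<beta> < 1" "0 < \<epsilon>" "\<epsilon> < 1" "0 < \<theta>" "\<theta> < 1"
  and C: "C \<noteq> {}" "compact C" and D: "D \<noteq> {}" "compact D" "\<And>z. z \<in> D \<Longrightarrow> 0 \<le> z"
  and init: "yh 0 \<in> C" "zh 0 \<in> D" "0 < st_phi (S 0)" "0 < st_psi (S 0)" "0 < st_gamma (S 0)"
  using run by (auto simp: rssqp_run_def)

lemma step_data: "step_data k (dir k, eta k, steps k)"
proof -
  have "\<exists>t. step_data k t"
    using run_step[of k] unfolding rssqp_step_def step_data_def by auto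
  then have "step_data k (SOME t. step_data k t)" by (rule someI_ex)
  then show ?thesis by (simp add: dir_def eta_def steps_def)
qed

lemma optimizer: "subproblem_optimizer A G f g h (H k) (S k) (dir k) (eta k)"
  and armijo: "armijo A G R f g h \<beta> \<epsilon> (S k) (dir k) (steps k)"
  and not_armijo: "i < steps k \<Longrightarrow> \<not> armijo A G R f g h \<beta> \<epsilon> (S k) (dir k) i"
  and update: "S (Suc k) = rssqp_update A G f g h \<theta> C D (S k) (R (X k) (\<beta>^steps k *\<^sub>R dir k)) (ty k) (eta k)"
  using step_data[of k] by (simp_all add: step_data_def ty_def)

lemma X_Suc: "X (Suc k) = R (X k) (\<beta>^steps k *\<^sub>R dir k)"
  unfolding update by (simp add: rssqp_update_def Let_def)

abbreviation "F k \<equiv> merit f g h (yh k) (zh k) (\<sigma> k)"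

text \<open>The conditions of Steps 4.1, 4.2 and 4.3.\<close>

definition "c1 k \<longleftrightarrow> Phi_res A G f g h \<theta> (X (Suc k)) (ty k) (eta k) \<le> 1/2 * st_phi (S k) \<and> ty k \<in> C \<and> eta k \<in> D"
definition "c2 k \<longleftrightarrow> Psi_res A G f g h \<theta> (X (Suc k)) (ty k) (eta k) \<le> 1/2 * st_psi (S k) \<and> ty k \<in> C \<and> eta k \<in> D"
definition "c3 k \<longleftrightarrow> rnorm G (X (Suc k)) (grad A G (F k) (X (Suc k))) \<le> st_gamma (S k)"

lemma update_cases:
  "S (Suc k) = (if c1 k then (S k)\<lparr>st_x := X (Suc k), st_y := ty k, st_yh := ty k, st_z := eta k, st_zh := eta k,
          st_phi := 1/2 * st_phi (S k)\<rparr>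
      else if c2 k then (S k)\<lparr>st_x := X (Suc k), st_y := ty k, st_yh := ty k, st_z := eta k, st_zh := eta k,
          st_psi := 1/2 * st_psi (S k)\<rparr>
      else if c3 k then
        (S k)\<lparr>st_x := X (Suc k), st_y := yh k - (1 / \<sigma> k) *\<^sub>R g (X (Suc k)),
          st_z := pos_part (zh k - (1 / \<sigma> k) *\<^sub>R h (X (Suc k))),
          st_yh := closest_point C (yh k - (1 / \<sigma> k) *\<^sub>R g (X (Suc k))),
          st_zh := closest_point D (zh k - (1 / \<sigma> k) *\<^sub>R h (X (Suc k))),
          st_sigma := min (1/2 * \<sigma> k) (residual (X k) (st_y (S k)) (st_z (S k)) powr (3/2)),
          st_gamma := 1/2 * st_gamma (S k)\<rparr>
      else (S k)\<lparr>st_x := X (Suc k)\<rparr>)"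
  unfolding c1_def c2_def c3_def X_Suc by (subst update) (simp only: rssqp_update_def Let_def)

lemma hat_in: "yh k \<in> C \<and> zh k \<in> D"
proof (induction k)
  case (Suc k)
  have cl: "closed C" "closed D" using C(2) D(2) by (auto intro: compact_imp_closed)
  show ?case
    by (subst (1 2) update_cases)
       (use Suc closest_point_in_set[OF cl(1) C(1)] closest_point_in_set[OF cl(2) D(1)] in \<open>auto simp: c1_def c2_def\<close>)
qed (use init in simp)

lemma phi_Suc: "st_phi (S (Suc k)) = (if c1 k then st_phi (S k) / 2 else st_phi (S k))"
  by (subst update_cases) simp

lemma psi_Suc: "st_psi (S (Suc k)) = (if \<not> c1 k \<and> c2 k then st_psi (S k) / 2 else st_psi (S k))"
  by (subst update_cases) simp

lemma gamma_Suc: "st_gamma (S (Suc k)) = (if \<not> c1 k \<and> \<not> c2 k \<and> c3 k then st_gamma (S k) / 2 else st_gamma (S k))"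
  by (subst update_cases) simp

lemma sigma_Suc: "\<not> c1 k \<Longrightarrow> \<not> c2 k \<Longrightarrow> c3 k \<Longrightarrow> \<sigma> (Suc k) \<le> \<sigma> k / 2"
  "c1 k \<or> c2 k \<or> \<not> c3 k \<Longrightarrow> \<sigma> (Suc k) = \<sigma> k"
  by (subst update_cases, auto)+

lemma tolerances_pos: "0 < st_phi (S k) \<and> 0 < st_psi (S k) \<and> 0 < st_gamma (S k)"
  by (induction k) (use init in \<open>simp_all add: phi_Suc psi_Suc gamma_Suc\<close>)

lemma multipliers_43:
  assumes "\<not> c1 k" "\<not> c2 k" "c3 k"
  shows "st_y (S (Suc k)) = yh k - (1 / \<sigma> k) *\<^sub>R g (X (Suc k))"
    and "st_z (S (Suc k)) = pos_part (zh k - (1 / \<sigma> k) *\<^sub>R h (X (Suc k)))"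
  by (subst update_cases, simp add: assms)+

section \<open>Steps 4.1, 4.2 or 4.3 executed infinitely often\<close>

lemma convergent_subsequence:
  fixes s :: "nat \<Rightarrow> nat"
  obtains x r where "strict_mono r" "(\<lambda>n. X (s (r n))) \<longlonglongrightarrow> x"
  using bounded_sequence_convergent_subsequence[OF complete iterates_bounded, of "\<lambda>n. X (s n)"] by blast

lemma accepted_infinitely_often:
  assumes inf: "infinite {k. Q k}"
    and Q: "\<And>k. Q k \<Longrightarrow> ty k \<in> C \<and> eta k \<in> D \<and> residual (X (Suc k)) (ty k) (eta k) \<le> B k"
    and B: "B \<longlonglongrightarrow> 0"
  shows "\<exists>x. (\<exists>r. strict_mono r \<and> (\<lambda>n. X (r n)) \<longlonglongrightarrow> x) \<and> KKT_point A G f g h x"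
proof -
  define s where "s = enumerate {k. Q k}"
  have s: "strict_mono s" "Q (s n)" for n
    using enumerate_in_set[OF inf, of n] strict_mono_enumerate[OF inf] by (auto simp: s_def)
  \<comment> \<open>The index is shifted because the tests evaluate the trial multipliers at the new
    iterate.\<close>
  obtain x r1 where r1: "strict_mono r1" "(\<lambda>n. X (Suc (s (r1 n)))) \<longlonglongrightarrow> x"
    using convergent_subsequence[of "\<lambda>n. Suc (s n)"] by blast
  let ?w = "\<lambda>n. (ty (s (r1 n)), eta (s (r1 n)))"
  have w: "\<forall>n. ?w n \<in> C \<times> D" using Q s by simp
  have "seq_compact (C \<times> D)" using C D by (intro compact_imp_seq_compact compact_Times)
  then obtain l r2 where "l \<in> C \<times> D" and r2: "strict_mono r2" "(?w \<circ> r2) \<longlonglongrightarrow> l"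
    by (rule seq_compactE[OF _ w])
  define K where "K = (\<lambda>n. s (r1 (r2 n)))"
  have K: "strict_mono K" using s(1) r1(1) r2(1) by (simp add: K_def strict_mono_def)
  have QK: "Q (K n)" for n using s by (simp add: K_def)
  have "(\<lambda>n. X (Suc (K n))) \<longlonglongrightarrow> x"
    using LIMSEQ_subseq_LIMSEQ[OF r1(2) r2(1)] by (simp add: o_def K_def)
  moreover have "(\<lambda>n. ty (K n)) \<longlonglongrightarrow> fst l" "(\<lambda>n. eta (K n)) \<longlonglongrightarrow> snd l"
    using tendsto_fst[OF r2(2)] tendsto_snd[OF r2(2)] by (simp_all add: o_def K_def)
  moreover have "0 \<le> eta (K n)" for n using Q[OF QK] D(3) by blast
  moreover have "(\<lambda>n. residual (X (Suc (K n))) (ty (K n)) (eta (K n))) \<longlonglongrightarrow> 0"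
  proof (rule Lim_null_comparison)
    show "(\<lambda>n. B (K n)) \<longlonglongrightarrow> 0" using LIMSEQ_subseq_LIMSEQ[OF B K] by (simp add: o_def)
    have "norm (residual (X (Suc (K n))) (ty (K n)) (eta (K n))) \<le> B (K n)" for n
      using Q[OF QK, of n] rnorm_grad_lagrangian_nonneg[of "X (Suc (K n))" "ty (K n)" "eta (K n)"]
      by (simp add: KKT_res_def)
    then show "\<forall>\<^sub>F n in sequentially. norm (residual (X (Suc (K n))) (ty (K n)) (eta (K n))) \<le> B (K n)"
      by simp
  qed
  ultimately have "KKT_point A G f g h x" by (rule KKT_limit)
  moreover have "strict_mono (\<lambda>n. Suc (K n))" using K by (simp add: strict_mono_def)
  ultimately show ?thesis using \<open>(\<lambda>n. X (Suc (K n))) \<longlonglongrightarrow> x\<close> by blast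
qed

text \<open>Both tests weigh each summand of the residual by 1 or by \<theta>, which lies below 1. A
  passed test thus bounds the residual by the tolerance divided by
  \<open>2 * \<theta>\<close>.\<close>

lemma KKT_res_le:
  "\<theta> * residual x y z \<le> Phi_res A G f g h \<theta> x y z"
  "\<theta> * residual x y z \<le> Psi_res A G f g h \<theta> x y z"
proof -
  have "\<theta> * a \<le> a" if "a \<ge> 0" for a using params that mult_right_mono[of \<theta> 1 a] by simp
  from this[of "norm (g x)"] this[of "norm (pos_part (- h x))"] this[of "\<bar>z \<bullet> h x\<bar>"]
    this[OF rnorm_grad_lagrangian_nonneg[of x y z]]
  show "\<theta> * residual x y z \<le> Phi_res A G f g h \<theta> x y z"
    "\<theta> * residual x y z \<le> Psi_res A G f g h \<theta> x y z"
    by (auto simp: KKT_res_def Phi_res_def Psi_res_def distrib_left)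
qed

lemma step41_infinitely_often:
  assumes "infinite {k. c1 k}"
  shows "\<exists>x. (\<exists>r. strict_mono r \<and> (\<lambda>n. X (r n)) \<longlonglongrightarrow> x) \<and> KKT_point A G f g h x"
proof (rule accepted_infinitely_often[OF assms])
  have "(\<lambda>k. st_phi (S k)) \<longlonglongrightarrow> 0"
    by (rule repeatedly_halved_tendsto_0[of _ c1])
       (use tolerances_pos assms in \<open>auto simp: phi_Suc less_imp_le\<close>)
  then have "(\<lambda>k. 1 / (2 * \<theta>) * st_phi (S k)) \<longlonglongrightarrow> 1 / (2 * \<theta>) * 0" by (intro tendsto_intros)
  then show "(\<lambda>k. 1 / (2 * \<theta>) * st_phi (S k)) \<longlonglongrightarrow> 0" by simp
  show "ty k \<in> C \<and> eta k \<in> D \<and>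
      residual (X (Suc k)) (ty k) (eta k) \<le> 1 / (2 * \<theta>) * st_phi (S k)" if "c1 k" for k
    using that KKT_res_le(1)[of "X (Suc k)" "ty k" "eta k"] params(5) unfolding c1_def
    by (auto simp: field_simps)
qed

lemma step42_infinitely_often:
  assumes inf: "infinite {k. \<not> c1 k \<and> c2 k}"
  shows "\<exists>x. (\<exists>r. strict_mono r \<and> (\<lambda>n. X (r n)) \<longlonglongrightarrow> x) \<and> KKT_point A G f g h x"
proof (rule accepted_infinitely_often[OF inf])
  have "(\<lambda>k. st_psi (S k)) \<longlonglongrightarrow> 0"
    by (rule repeatedly_halved_tendsto_0[of _ "\<lambda>k. \<not> c1 k \<and> c2 k"])
       (use tolerances_pos inf in \<open>auto simp: psi_Suc less_imp_le\<close>)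
  then have "(\<lambda>k. 1 / (2 * \<theta>) * st_psi (S k)) \<longlonglongrightarrow> 1 / (2 * \<theta>) * 0" by (intro tendsto_intros)
  then show "(\<lambda>k. 1 / (2 * \<theta>) * st_psi (S k)) \<longlonglongrightarrow> 0" by simp
  show "ty k \<in> C \<and> eta k \<in> D \<and>
      residual (X (Suc k)) (ty k) (eta k) \<le> 1 / (2 * \<theta>) * st_psi (S k)" if "\<not> c1 k \<and> c2 k" for k
    using that KKT_res_le(2)[of "X (Suc k)" "ty k" "eta k"] params(5) unfolding c2_def
    by (auto simp: field_simps)
qed

text \<open>A component contributes only if \<open>0 < b < s * a\<close>, with \<open>a\<close> and
  \<open>b\<close> the entries of \<open>z\<close> and \<open>w\<close>; its product is then at most
  \<open>a * (s * a)\<close>.\<close>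

lemma complementarity_bound:
  fixes z w :: "real^'l"
  assumes z: "0 \<le> z" and s: "s > 0"
  shows "\<bar>pos_part (z - (1 / s) *\<^sub>R w) \<bullet> pos_part w\<bar> \<le> s * (norm z)\<^sup>2"
proof -
  have "max (a - b / s) 0 * max b 0 \<le> s * a\<^sup>2" if "a \<ge> 0" for a b :: real
  proof (cases "0 < b \<and> b < s * a")
    case True
    then have "(a - b / s) * b \<le> a * (s * a)" using s that by (intro mult_mono) auto
    then show ?thesis using True s by (simp add: max_def field_simps power2_eq_square)
  next
    case False
    then have 0: "max (a - b / s) 0 * max b 0 = 0" using s by (auto simp: max_def field_simps)
    show ?thesis unfolding 0 using s by simp
  qed
  then have "pos_part (z - (1 / s) *\<^sub>R w) \<bullet> pos_part w \<le> (\<Sum>i\<in>UNIV. s * (z $ i)\<^sup>2)"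
    unfolding inner_vec_def using z by (intro sum_mono) (simp add: less_eq_vec_def)
  also have "\<dots> = s * (norm z)\<^sup>2"
    unfolding power2_norm_eq_inner inner_vec_def by (simp add: sum_distrib_left power2_eq_square)
  finally show ?thesis
    using inner_vec_nonneg[of "pos_part (z - (1 / s) *\<^sub>R w)" "pos_part w"] by simp
qed

lemma step43_infinitely_often:
  assumes inf: "infinite {k. \<not> c1 k \<and> \<not> c2 k \<and> c3 k}"
  shows "\<exists>x. (\<exists>r. strict_mono r \<and> (\<lambda>n. X (r n)) \<longlonglongrightarrow> x) \<and>
      ((AKKT_point A G f g h x \<and> (\<exists>r. strict_mono r \<and>
           AKKT_sequence A G f g h x (\<lambda>n. X (r n)) (\<lambda>n. st_y (S (r n))) (\<lambda>n. st_z (S (r n))))) \<or>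
       (\<not> feasible g h x \<and> grad A G (violation g h) x = 0)) \<and>
      (ERCQ A g h x \<longrightarrow> KKT_point A G f g h x)"
proof -
  let ?Q = "\<lambda>k. \<not> c1 k \<and> \<not> c2 k \<and> c3 k"
  have gam: "(\<lambda>k. st_gamma (S k)) \<longlonglongrightarrow> 0"
    by (rule repeatedly_halved_tendsto_0[of _ ?Q])
       (use tolerances_pos inf in \<open>auto simp: gamma_Suc less_imp_le\<close>)
  have sig: "\<sigma> \<longlonglongrightarrow> 0"
  proof (rule repeatedly_halved_tendsto_0[of _ ?Q])
    show "0 \<le> \<sigma> k" for k using sigma_pos by (simp add: less_imp_le)
    show "\<sigma> (Suc k) \<le> \<sigma> k" for k
      using sigma_Suc(1)[of k] sigma_Suc(2)[of k] sigma_pos[of k] by fastforce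
  qed (use sigma_Suc inf in auto)
  define s where "s = enumerate {k. ?Q k}"
  have s: "strict_mono s" "?Q (s n)" for n
    using enumerate_in_set[OF inf, of n] strict_mono_enumerate[OF inf] by (auto simp: s_def)
  obtain x r where r: "strict_mono r" "(\<lambda>n. X (Suc (s (r n)))) \<longlonglongrightarrow> x"
    using convergent_subsequence[of "\<lambda>n. Suc (s n)"] by blast
  define K where "K = (\<lambda>n. s (r n))"
  have K: "strict_mono K" using s(1) r(1) by (simp add: K_def strict_mono_def)
  have SK: "strict_mono (\<lambda>n. Suc (K n))" using K by (simp add: strict_mono_def)
  have QK: "\<not> c1 (K n)" "\<not> c2 (K n)" "c3 (K n)" for n using s by (auto simp: K_def)
  have X: "(\<lambda>n. X (Suc (K n))) \<longlonglongrightarrow> x" using r by (simp add: K_def)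
  have gK: "(\<lambda>n. st_gamma (S (K n))) \<longlonglongrightarrow> 0" and sK: "(\<lambda>n. \<sigma> (K n)) \<longlonglongrightarrow> 0"
    using LIMSEQ_subseq_LIMSEQ[OF gam K] LIMSEQ_subseq_LIMSEQ[OF sig K] by (simp_all add: o_def)
  have lg: "(\<lambda>n. g (X (Suc (K n)))) \<longlonglongrightarrow> g x" and lh: "(\<lambda>n. h (X (Suc (K n)))) \<longlonglongrightarrow> h x"
    using isCont_tendsto_compose[OF isCont_fgh(2) X] isCont_tendsto_compose[OF isCont_fgh(3) X] by auto
  let ?Y = "\<lambda>n. st_y (S (Suc (K n)))" and ?Z = "\<lambda>n. st_z (S (Suc (K n)))"
  note YZ = multipliers_43[OF QK]
  \<comment> \<open>With the multipliers stored in Step 4.3 this differential is that of the merit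
    function tested there, so the tolerance bounds it.\<close>
  have dl: "\<bar>dlag 1 (?Y n) (?Z n) (X (Suc (K n))) v\<bar> \<le> st_gamma (S (K n)) * rnorm G (X (Suc (K n))) v"
    if v: "v \<in> TM (X (Suc (K n)))" for n v
  proof -
    have "\<bar>mdiff A (F (K n)) (X (Suc (K n))) v\<bar>
        \<le> rnorm G (X (Suc (K n))) (grad A G (F (K n)) (X (Suc (K n)))) * rnorm G (X (Suc (K n))) v"
      by (rule abs_mdiff_le[OF mdifferentiable_merit[OF sigma_pos] v])
    also have "\<dots> \<le> st_gamma (S (K n)) * rnorm G (X (Suc (K n))) v"
      using QK(3)[of n] v by (intro mult_right_mono) (auto simp: c3_def)
    finally show ?thesis unfolding mdiff_merit[OF sigma_pos v] YZ .
  qed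
  have gr: "(\<lambda>n. rnorm G (X (Suc (K n))) (gradL (X (Suc (K n))) (?Y n) (?Z n))) \<longlonglongrightarrow> 0"
  proof (rule Lim_null_comparison[OF always_eventually gK], rule allI)
    fix n
    have "rnorm G (X (Suc (K n))) (gradL (X (Suc (K n))) (?Y n) (?Z n)) \<le> st_gamma (S (K n))"
      unfolding grad_lagrangian_def
      by (rule rnorm_grad_le[OF mdifferentiable_lagrangian]) (simp add: mdiff_lagrangian dl)
    then show "norm (rnorm G (X (Suc (K n))) (gradL (X (Suc (K n))) (?Y n) (?Z n))) \<le> st_gamma (S (K n))"
      using rnorm_grad_lagrangian_nonneg by simp
  qed
  obtain MC where MC: "\<And>y. y \<in> C \<Longrightarrow> norm y \<le> MC"
    using compact_imp_bounded[OF C(2)] unfolding bounded_iff by blast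
  obtain MD where MD: "\<And>z. z \<in> D \<Longrightarrow> norm z \<le> MD"
    using compact_imp_bounded[OF D(2)] unfolding bounded_iff by blast
  show ?thesis
  proof (cases "feasible g h x")
    case True
    \<comment> \<open>The safeguarded multipliers stay in the bounded set \<open>D\<close>, so the
      estimate is a fixed multiple of the penalty parameter.\<close>
    have comp: "(\<lambda>n. ?Z n \<bullet> pos_part (h (X (Suc (K n))))) \<longlonglongrightarrow> 0"
    proof (rule Lim_null_comparison[OF always_eventually], rule allI)
      fix n
      have zD: "zh (K n) \<in> D" using hat_in by blast
      have "\<bar>?Z n \<bullet> pos_part (h (X (Suc (K n))))\<bar> \<le> \<sigma> (K n) * (norm (zh (K n)))\<^sup>2"
        unfolding YZ by (rule complementarity_bound[OF D(3)[OF zD] sigma_pos])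
      also have "\<dots> \<le> \<sigma> (K n) * MD\<^sup>2"
        using sigma_pos[of "K n"] MD[OF zD] by (intro mult_left_mono power_mono) auto
      finally show "norm (?Z n \<bullet> pos_part (h (X (Suc (K n))))) \<le> \<sigma> (K n) * MD\<^sup>2" by simp
    next
      show "(\<lambda>n. \<sigma> (K n) * MD\<^sup>2) \<longlonglongrightarrow> 0" using tendsto_mult_right[OF sK, of "MD\<^sup>2"] by simp
    qed
    have "\<forall>n. 0 \<le> ?Z n" unfolding YZ by simp
    then have seq: "AKKT_sequence A G f g h x (\<lambda>n. X (Suc (K n))) ?Y ?Z"
      unfolding AKKT_sequence_def using X gr comp by blast
    then have "AKKT_point A G f g h x" using True unfolding AKKT_point_def by blast
    then show ?thesis using AKKT_imp_KKT[OF _ True seq] seq X SK by blast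
  next
    case False
    have scaled: "(\<lambda>n. \<sigma> (K n) *\<^sub>R w n) \<longlonglongrightarrow> 0" if w: "\<And>n. norm (w n) \<le> M"
      for M and w :: "nat \<Rightarrow> 'c::real_normed_vector"
    proof (rule Lim_null_comparison[OF always_eventually], rule allI)
      show "norm (\<sigma> (K n) *\<^sub>R w n) \<le> \<sigma> (K n) * M" for n
        using sigma_pos[of "K n"] w[of n] by (simp add: mult_left_mono)
      show "(\<lambda>n. \<sigma> (K n) * M) \<longlonglongrightarrow> 0" using tendsto_mult_right[OF sK, of M] by simp
    qed
    have sy: "(\<lambda>n. \<sigma> (K n) *\<^sub>R yh (K n)) \<longlonglongrightarrow> 0" and sz: "(\<lambda>n. \<sigma> (K n) *\<^sub>R zh (K n)) \<longlonglongrightarrow> 0"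
      using scaled[of "\<lambda>n. yh (K n)" MC] scaled[of "\<lambda>n. zh (K n)" MD] MC MD hat_in by simp_all
    have ly: "(\<lambda>n. \<sigma> (K n) *\<^sub>R yh (K n) - g (X (Suc (K n)))) \<longlonglongrightarrow> - g x"
      using tendsto_diff[OF sy lg] by simp
    have lz: "(\<lambda>n. pos_part (\<sigma> (K n) *\<^sub>R zh (K n) - h (X (Suc (K n))))) \<longlonglongrightarrow> pos_part (- h x)"
      using tendsto_pos_part[OF tendsto_diff[OF sz lh]] by simp
    \<comment> \<open>Multiplying by the penalty parameter makes it the weight of the objective,
      which vanishes in the limit; the scaled safeguarded multipliers vanish too, and only the
      constraint values remain as multipliers.\<close>
    have stat: "dlag 0 (- g x) (pos_part (- h x)) x v = 0" if v: "v \<in> TM x" for v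
    proof (rule dlag_limit[OF X sK ly lz _ _ v])
      show "(\<lambda>n. \<sigma> (K n) * st_gamma (S (K n))) \<longlonglongrightarrow> 0" using tendsto_mult[OF sK gK] by simp
      fix n v assume v: "v \<in> TM (X (Suc (K n)))"
      let ?s = "\<sigma> (K n)"
      have s0: "?s > 0" by (rule sigma_pos)
      have "?s *\<^sub>R yh (K n) - g (X (Suc (K n))) = ?s *\<^sub>R ?Y n"
        unfolding YZ using s0 by (simp add: algebra_simps)
      moreover have "pos_part (?s *\<^sub>R zh (K n) - h (X (Suc (K n)))) = ?s *\<^sub>R ?Z n"
        unfolding YZ pos_part_scaleR[OF less_imp_le[OF s0], symmetric] using s0 by (simp add: algebra_simps)
      moreover have "dlag ?s (?s *\<^sub>R ?Y n) (?s *\<^sub>R ?Z n) (X (Suc (K n))) v = ?s * dlag 1 (?Y n) (?Z n) (X (Suc (K n))) v"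
        by (simp add: dlag_def algebra_simps)
      ultimately have "\<bar>dlag ?s (?s *\<^sub>R yh (K n) - g (X (Suc (K n)))) (pos_part (?s *\<^sub>R zh (K n) - h (X (Suc (K n))))) (X (Suc (K n))) v\<bar>
          = ?s * \<bar>dlag 1 (?Y n) (?Z n) (X (Suc (K n))) v\<bar>"
        using s0 by (simp add: abs_mult)
      also have "\<dots> \<le> ?s * (st_gamma (S (K n)) * rnorm G (X (Suc (K n))) v)"
        using s0 dl[OF v] by (intro mult_left_mono) auto
      finally show "\<bar>dlag ?s (?s *\<^sub>R yh (K n) - g (X (Suc (K n)))) (pos_part (?s *\<^sub>R zh (K n) - h (X (Suc (K n))))) (X (Suc (K n))) v\<bar>
          \<le> ?s * st_gamma (S (K n)) * rnorm G (X (Suc (K n))) v" by (simp add: mult.assoc)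
    qed
    have "grad A G (violation g h) x = 0"
      by (rule grad_eq_0[OF mdifferentiable_violation]) (simp add: mdiff_violation stat)
    then show ?thesis using False ERCQ_stationary_feasible[OF _ stat] X SK by blast
  qed
qed

end

text \<open>Convergence on the finitely many coordinate directions, together with the lower norm
  bound in a chart, bounds the operator norms eventually. The premise asks for convergence along the
  sequence only, which suits the merit function as well as the constraints.\<close>

lemma (in riemannian_manifold) mdiff_locally_bounded:
  fixes \<phi> :: "'p \<Rightarrow> 'c::real_normed_vector"
  assumes X: "X \<longlonglongrightarrow> x" and diff: "\<And>x. mdifferentiable \<phi> x"
    and cont: "\<And>c u. c \<in> A \<Longrightarrow> x \<in> cdom c \<Longrightarrow>
      (\<lambda>n. mdiff A \<phi> (X n) (tv c (X n) u)) \<longlonglongrightarrow> mdiff A \<phi> x (tv c x u)"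
  obtains B where "B > 0"
    "\<forall>\<^sub>F n in sequentially. \<forall>v\<in>TM (X n). norm (mdiff A \<phi> (X n) v) \<le> B * rnorm G (X n) v"
proof -
  obtain c where c: "c \<in> A" "x \<in> cdom c" by (rule chart_around)
  obtain r m B where r: "r > 0" "m > 0" "cball (cmap c x) r \<subseteq> cmap c ` cdom c"
    "\<And>a u. a \<in> cball (cmap c x) r \<Longrightarrow> m * norm u \<le> rnorm G (cinv c a) (tv c (cinv c a) u)"
    using rnorm_chart_equiv[OF c] by metis
  define M where "M = (\<lambda>n. \<Sum>i\<in>Basis. norm (mdiff A \<phi> (X n) (tv c (X n) i)))"
  define M0 where "M0 = (\<Sum>i\<in>Basis. norm (mdiff A \<phi> x (tv c x i)))"
  have "M \<longlonglongrightarrow> M0"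
    unfolding M_def M0_def by (intro tendsto_intros cont c)
  then have 1: "\<forall>\<^sub>F n in sequentially. M n < M0 + 1" by (rule order_tendstoD) simp
  have "x \<in> {y \<in> cdom c. cmap c y \<in> ball (cmap c x) r}" using c r by simp
  then have 2: "\<forall>\<^sub>F n in sequentially. X n \<in> {y \<in> cdom c. cmap c y \<in> ball (cmap c x) r}"
    by (rule topological_tendstoD[OF X open_chart_preimage[OF c(1) open_ball]])
  have M0: "M0 \<ge> 0" by (simp add: M0_def sum_nonneg)
  show thesis
  proof
    show "(M0 + 1) / m > 0" using M0 r(2) by simp
    show "\<forall>\<^sub>F n in sequentially. \<forall>v\<in>TM (X n). norm (mdiff A \<phi> (X n) v) \<le> (M0 + 1) / m * rnorm G (X n) v"
      using 1 2
    proof (eventually_elim, intro ballI)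
      fix n v assume M: "M n < M0 + 1" and n: "X n \<in> {y \<in> cdom c. cmap c y \<in> ball (cmap c x) r}"
        and v: "v \<in> TM (X n)"
      have cn: "X n \<in> cdom c" using n by simp
      note lin = has_derivative_linear[OF mdifferentiableD[OF diff c(1) cn]]
      have "mdiff A \<phi> (X n) v = mdiff A \<phi> (X n) (tv c (X n) (\<Sum>i\<in>Basis. (v c \<bullet> i) *\<^sub>R i))"
        using tvec_of_tangent[OF c(1) cn v] by (simp add: euclidean_representation)
      also have "\<dots> = (\<Sum>i\<in>Basis. (v c \<bullet> i) *\<^sub>R mdiff A \<phi> (X n) (tv c (X n) i))"
        by (simp add: linear_sum[OF lin] linear_scale[OF lin] del: euclidean_representation)
      finally have "norm (mdiff A \<phi> (X n) v) \<le> (\<Sum>i\<in>Basis. \<bar>v c \<bullet> i\<bar> * norm (mdiff A \<phi> (X n) (tv c (X n) i)))"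
        using norm_sum[of "\<lambda>i. (v c \<bullet> i) *\<^sub>R mdiff A \<phi> (X n) (tv c (X n) i)" Basis] by simp
      also have "\<dots> \<le> (\<Sum>i\<in>Basis. norm (v c) * norm (mdiff A \<phi> (X n) (tv c (X n) i)))"
        by (intro sum_mono mult_right_mono Basis_le_norm) auto
      also have "\<dots> = M n * norm (v c)" by (simp add: M_def sum_distrib_left mult.commute)
      also have "\<dots> \<le> (M0 + 1) * (rnorm G (X n) v / m)"
      proof (intro mult_mono)
        have "m * norm (v c) \<le> rnorm G (X n) v"
          using r(4)[of "cmap c (X n)" "v c"] n c(1) tvec_of_tangent[OF c(1) cn v] by simp
        then show "norm (v c) \<le> rnorm G (X n) v / m" using r(2) by (simp add: field_simps)
      qed (use M M0 in auto)
      finally show "norm (mdiff A \<phi> (X n) v) \<le> (M0 + 1) / m * rnorm G (X n) v" by simp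
    qed
  qed
qed

section \<open>Descent for a fixed merit function\<close>

context rssqp
begin

lemma self_adjoint: "self_adjoint_operator A G (X k) (H k)"
  using run_step[of k] by (simp add: rssqp_step_def)

lemma dir_in: "dir k \<in> TM (X k)"
  by (rule subproblem_tangent[OF optimizer self_adjoint sigma_pos])

lemma merit_slope:
  assumes "u \<in> TM (X k)"
  shows "mdiff A (F k) (X k) u = - G (X k) (M_op A G g (H k) (S k) (dir k)) u
        + (pos_part (zh k - (1 / \<sigma> k) *\<^sub>R h (X k) - (1 / \<sigma> k) *\<^sub>R mdiff A h (X k) (dir k))
           - pos_part (zh k - (1 / \<sigma> k) *\<^sub>R h (X k))) \<bullet> mdiff A h (X k) u"
  using mdiff_merit[OF sigma_pos assms] subproblem_stationary[OF optimizer self_adjoint sigma_pos assms] by simp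

text \<open>Coercivity controls the quadratic term of \<open>merit_slope\<close>, and the term of
  the inequality constraints is nonpositive by \<open>pos_part_antimono_inner\<close>.\<close>

lemma merit_descent: "mdiff A (F k) (X k) (dir k) \<le> - (1 / \<nu>) * (rnorm G (X k) (dir k))\<^sup>2"
proof -
  let ?t = "zh k - (1 / \<sigma> k) *\<^sub>R h (X k)" and ?b = "(1 / \<sigma> k) *\<^sub>R mdiff A h (X k) (dir k)"
  have "(pos_part (?t - ?b) - pos_part ?t) \<bullet> ?b \<le> 0" by (rule pos_part_antimono_inner)
  then have "(pos_part (?t - ?b) - pos_part ?t) \<bullet> mdiff A h (X k) (dir k) \<le> 0"
    using sigma_pos[of k] by (simp add: divide_le_0_iff)
  moreover have "(1 / \<nu>) * (rnorm G (X k) (dir k))\<^sup>2 \<le> G (X k) (M_op A G g (H k) (S k) (dir k)) (dir k)"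
    by (rule coercive[OF dir_in])
  ultimately show ?thesis unfolding merit_slope[OF dir_in] by linarith
qed

text \<open>Every term of \<open>merit_slope\<close> carries a factor of the search direction,
  because the positive part is 1-Lipschitz. A short direction therefore forces a small gradient, the
  counterpart of \<open>merit_descent\<close>.\<close>

lemma merit_slope_bound:
  assumes v: "v \<in> TM (X k)"
  shows "\<bar>mdiff A (F k) (X k) v\<bar> \<le> \<nu> * rnorm G (X k) (dir k) * rnorm G (X k) v
    + (1 / \<sigma> k) * (norm (mdiff A g (X k) (dir k)) * norm (mdiff A g (X k) v))
    + (1 / \<sigma> k) * (norm (mdiff A h (X k) (dir k)) * norm (mdiff A h (X k) v))"
proof -
  let ?t = "zh k - (1 / \<sigma> k) *\<^sub>R h (X k)" and ?b = "(1 / \<sigma> k) *\<^sub>R mdiff A h (X k) (dir k)"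
  have s: "\<sigma> k > 0" by (rule sigma_pos)
  have "\<bar>G (X k) (M_op A G g (H k) (S k) (dir k)) v\<bar>
      \<le> \<bar>G (X k) (H k (dir k)) v\<bar> + \<bar>(1 / \<sigma> k) * (mdiff A g (X k) (dir k) \<bullet> mdiff A g (X k) v)\<bar>"
    unfolding G_M_op[OF optimizer self_adjoint sigma_pos dir_in v] by (rule abs_triangle_ineq)
  also have "\<dots> \<le> \<nu> * rnorm G (X k) (dir k) * rnorm G (X k) v
      + (1 / \<sigma> k) * (norm (mdiff A g (X k) (dir k)) * norm (mdiff A g (X k) v))"
    using H_bounded[OF dir_in v] s Cauchy_Schwarz_ineq2[of "mdiff A g (X k) (dir k)" "mdiff A g (X k) v"]
    by (intro add_mono) (auto simp: abs_mult divide_right_mono)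
  finally have 1: "\<bar>G (X k) (M_op A G g (H k) (S k) (dir k)) v\<bar> \<le> \<nu> * rnorm G (X k) (dir k) * rnorm G (X k) v
      + (1 / \<sigma> k) * (norm (mdiff A g (X k) (dir k)) * norm (mdiff A g (X k) v))" .
  have "\<bar>(pos_part (?t - ?b) - pos_part ?t) \<bullet> mdiff A h (X k) v\<bar> \<le> norm (pos_part (?t - ?b) - pos_part ?t) * norm (mdiff A h (X k) v)"
    by (rule Cauchy_Schwarz_ineq2)
  also have "\<dots> \<le> norm (?t - ?b - ?t) * norm (mdiff A h (X k) v)"
    by (intro mult_right_mono norm_pos_part_diff) simp
  also have "\<dots> = (1 / \<sigma> k) * (norm (mdiff A h (X k) (dir k)) * norm (mdiff A h (X k) v))"
    using s by simp
  finally have 2: "\<bar>(pos_part (?t - ?b) - pos_part ?t) \<bullet> mdiff A h (X k) v\<bar>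
      \<le> (1 / \<sigma> k) * (norm (mdiff A h (X k) (dir k)) * norm (mdiff A h (X k) v))" .
  show ?thesis unfolding merit_slope[OF v] using 1 2 by linarith
qed

lemma armijo_iff:
  "armijo A G R f g h \<beta> \<epsilon> (S k) (dir k) j \<longleftrightarrow>
    F k (R (X k) (\<beta>^j *\<^sub>R dir k)) \<le> F k (X k) + \<epsilon> * \<beta>^j * mdiff A (F k) (X k) (dir k)"
  using G_grad[OF mdifferentiable_merit[OF sigma_pos] dir_in]
  by (simp add: armijo_def Let_def)

text \<open>If only Step 4.4 occurs from \<open>k0\<close> on, the merit function and \<gamma> are
  frozen and the gradient stays above \<gamma> at all later iterates. Near an accumulation point the
  directions tend to 0 along a subsequence, which makes the gradient small there.\<close>

lemma no_stall:
  assumes stall: "\<And>k. k \<ge> k0 \<Longrightarrow> \<not> c1 k \<and> \<not> c2 k \<and> \<not> c3 k"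
  shows False
proof -
  define y z s \<gamma> where "y = yh k0" and "z = zh k0" and "s = \<sigma> k0" and "\<gamma> = st_gamma (S k0)"
  have const: "yh k = y \<and> zh k = z \<and> \<sigma> k = s \<and> st_gamma (S k) = \<gamma>" if "k \<ge> k0" for k
    using that
  proof (induction k rule: dec_induct)
    case (step k)
    then show ?case by (subst (1 2 3 4) update_cases) (use stall[of k] in simp)
  qed (simp add: y_def z_def s_def \<gamma>_def)
  define E where "E = merit f g h y z s"
  have FE: "F k = E" if "k \<ge> k0" for k using const[OF that] by (simp add: E_def)
  have s: "s > 0" using sigma_pos by (simp add: s_def)
  have \<gamma>: "\<gamma> > 0" using tolerances_pos by (simp add: \<gamma>_def)
  have E: "mdifferentiable E x" for x unfolding E_def by (rule mdifferentiable_merit[OF s])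
  have grad_large: "\<gamma> < rnorm G (X (Suc k)) (grad A G E (X (Suc k)))" if "k \<ge> k0" for k
    using stall[OF that] const[OF that] FE[OF that] by (simp add: c3_def)
  have decrease: "E (X (Suc k)) \<le> E (X k) + \<epsilon> * \<beta>^steps k * mdiff A E (X k) (dir k)" if "k \<ge> k0" for k
    using armijo[of k] unfolding armijo_iff X_Suc FE[OF that] .
  have slope_le: "mdiff A E (X k) (dir k) \<le> - (1 / \<nu>) * (rnorm G (X k) (dir k))\<^sup>2" if "k \<ge> k0" for k
    using merit_descent[of k] FE[OF that] by simp
  have slope_nonpos: "mdiff A E (X k) (dir k) \<le> 0" if "k \<ge> k0" for k
  proof -
    have "0 \<le> (1 / \<nu>) * (rnorm G (X k) (dir k))\<^sup>2" using \<nu>_pos by simp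
    then show ?thesis using slope_le[OF that] by linarith
  qed
  have E_mono: "E (X j) \<le> E (X i)" if "k0 \<le> i" "i \<le> j" for i j
    using that(2,1)
  proof (induction j rule: dec_induct)
    case (step j)
    have "\<epsilon> * \<beta>^steps j * mdiff A E (X j) (dir j) \<le> 0"
      using slope_nonpos[of j] step params by (intro mult_nonneg_nonpos) auto
    then show ?case using decrease[of j] step by simp
  qed simp
  \<comment> \<open>Indices of the form \<open>Suc k\<close> with \<open>k \<ge> k0\<close> are used
    because the rejected test of Step 4.3 bounds the gradient from below at
    \<open>X (Suc k)\<close>.\<close>
  obtain x r1 where r1: "strict_mono r1" "(\<lambda>n. X (Suc (k0 + r1 n))) \<longlonglongrightarrow> x"
    using convergent_subsequence[of "\<lambda>n. Suc (k0 + n)"] by blast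
  let ?X = "\<lambda>n. X (Suc (k0 + r1 n))"
  have slope_tendsto: "(\<lambda>n. mdiff A E (Y n) (tv c (Y n) (V n))) \<longlonglongrightarrow> mdiff A E x (tv c x v)"
    if c: "c \<in> A" "x \<in> cdom c" and Y: "Y \<longlonglongrightarrow> x" and V: "V \<longlonglongrightarrow> v" for Y V v c
  proof -
    have "(\<lambda>n. h (Y n)) \<longlonglongrightarrow> h x" "(\<lambda>n. g (Y n)) \<longlonglongrightarrow> g x"
      using isCont_tendsto_compose[OF isCont_fgh(2) Y] isCont_tendsto_compose[OF isCont_fgh(3) Y] by auto
    then have lim: "(\<lambda>n. dlag 1 (y - (1 / s) *\<^sub>R g (Y n)) (pos_part (z - (1 / s) *\<^sub>R h (Y n))) (Y n) (tv c (Y n) (V n)))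
        \<longlonglongrightarrow> dlag 1 (y - (1 / s) *\<^sub>R g x) (pos_part (z - (1 / s) *\<^sub>R h x)) x (tv c x v)"
      by (intro tendsto_dlag[OF c Y V] tendsto_intros tendsto_pos_part)
    have "\<forall>\<^sub>F n in sequentially. Y n \<in> cdom c"
      by (rule topological_tendstoD[OF Y open_cdom[OF c(1)] c(2)])
    then have "\<forall>\<^sub>F n in sequentially. dlag 1 (y - (1 / s) *\<^sub>R g (Y n)) (pos_part (z - (1 / s) *\<^sub>R h (Y n))) (Y n) (tv c (Y n) (V n))
        = mdiff A E (Y n) (tv c (Y n) (V n))"
      by (rule eventually_mono) (use c in \<open>simp add: E_def mdiff_merit[OF s]\<close>)
    from Lim_transform_eventually[OF lim this] show ?thesis
      using c by (simp add: E_def mdiff_merit[OF s])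
  qed
  obtain Be where Be: "Be > 0" "\<forall>\<^sub>F n in sequentially. \<forall>v\<in>TM (?X n).
      norm (mdiff A E (?X n) v) \<le> Be * rnorm G (?X n) v"
    using mdiff_locally_bounded[OF r1(2) E slope_tendsto[OF _ _ r1(2) tendsto_const]] by blast
  obtain Bg where Bg: "Bg > 0" "\<forall>\<^sub>F n in sequentially. \<forall>v\<in>TM (?X n).
      norm (mdiff A g (?X n) v) \<le> Bg * rnorm G (?X n) v"
    using mdiff_locally_bounded[OF r1(2) mdifferentiable_fgh(2) tendsto_mdiff[OF g_C1 _ _ r1(2) tendsto_const]] by blast
  obtain Bh where Bh: "Bh > 0" "\<forall>\<^sub>F n in sequentially. \<forall>v\<in>TM (?X n).
      norm (mdiff A h (?X n) v) \<le> Bh * rnorm G (?X n) v"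
    using mdiff_locally_bounded[OF r1(2) mdifferentiable_fgh(3) tendsto_mdiff[OF h_C1 _ _ r1(2) tendsto_const]] by blast
  obtain c where c: "c \<in> A" "x \<in> cdom c" by (rule chart_around)
  obtain r m B where r: "r > 0" "m > 0" "cball (cmap c x) r \<subseteq> cmap c ` cdom c"
    "\<And>a u. a \<in> cball (cmap c x) r \<Longrightarrow> m * norm u \<le> rnorm G (cinv c a) (tv c (cinv c a) u)"
    using rnorm_chart_equiv[OF c] by metis
  let ?U = "{y \<in> cdom c. cmap c y \<in> ball (cmap c x) r}"
  have "x \<in> ?U" using c r by simp
  then have "\<forall>\<^sub>F n in sequentially. ?X n \<in> ?U"
    by (rule topological_tendstoD[OF r1(2) open_chart_preimage[OF c(1) open_ball]])
  then have "\<forall>\<^sub>F n in sequentially. ?X n \<in> ?U \<and> (\<forall>v\<in>TM (?X n).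
      norm (mdiff A E (?X n) v) \<le> Be * rnorm G (?X n) v \<and> norm (mdiff A g (?X n) v) \<le> Bg * rnorm G (?X n) v \<and>
      norm (mdiff A h (?X n) v) \<le> Bh * rnorm G (?X n) v)"
    using Be(2) Bg(2) Bh(2) by eventually_elim blast
  then obtain N where N: "\<And>n. n \<ge> N \<Longrightarrow> ?X n \<in> ?U"
      "\<And>n v. n \<ge> N \<Longrightarrow> v \<in> TM (?X n) \<Longrightarrow> norm (mdiff A E (?X n) v) \<le> Be * rnorm G (?X n) v"
      "\<And>n v. n \<ge> N \<Longrightarrow> v \<in> TM (?X n) \<Longrightarrow> norm (mdiff A g (?X n) v) \<le> Bg * rnorm G (?X n) v"
      "\<And>n v. n \<ge> N \<Longrightarrow> v \<in> TM (?X n) \<Longrightarrow> norm (mdiff A h (?X n) v) \<le> Bh * rnorm G (?X n) v"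
    unfolding eventually_sequentially by blast
  define J where "J = (\<lambda>n. Suc (k0 + r1 (n + N)))"
  have J: "J n \<ge> k0" for n by (simp add: J_def)
  \<comment> \<open>Descent and boundedness of the slope give
    \<open>(1 / \<nu>) * p\<^sup>2 \<le> Be * p\<close> for the norm \<open>p\<close> of the
    direction, hence \<open>p \<le> \<nu> * Be\<close>; division by \<open>m\<close> passes to
    coordinates.\<close>
  have norm_dir: "norm (dir (J n) c) \<le> \<nu> * Be / m" for n
  proof -
    let ?p = "rnorm G (X (J n)) (dir (J n))"
    have XU: "X (J n) \<in> ?U" using N(1)[of "n + N"] by (simp add: J_def)
    have p0: "?p \<ge> 0" using dir_in by simp
    have "(1 / \<nu>) * ?p\<^sup>2 \<le> - mdiff A E (X (J n)) (dir (J n))" using slope_le[OF J, of n] by simp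
    also have "\<dots> \<le> Be * ?p"
      using N(2)[of "n + N" "dir (J n)"] dir_in[of "J n"] by (simp add: J_def)
    finally have "?p * ?p \<le> (\<nu> * Be) * ?p" using \<nu>_pos by (simp add: field_simps power2_eq_square)
    then have "?p \<le> \<nu> * Be" using p0 Be(1) \<nu>_pos by (cases "?p = 0") auto
    moreover have "m * norm (dir (J n) c) \<le> ?p"
      using r(4)[of "cmap c (X (J n))" "dir (J n) c"] XU c(1) tvec_of_tangent[OF c(1) _ dir_in[of "J n"]] by simp
    ultimately show ?thesis using r(2) by (simp add: field_simps)
  qed
  have "seq_compact (cball (0 :: 'b) (\<nu> * Be / m))" by (rule compact_imp_seq_compact[OF compact_cball])
  moreover have "\<forall>n. dir (J n) c \<in> cball 0 (\<nu> * Be / m)" using norm_dir by simp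
  ultimately obtain u r2 where "u \<in> cball 0 (\<nu> * Be / m)" and r2: "strict_mono r2" "((\<lambda>n. dir (J n) c) \<circ> r2) \<longlonglongrightarrow> u"
    by (rule seq_compactE)
  define K where "K = (\<lambda>n. J (r2 n))"
  have K: "strict_mono K" using r1(1) r2(1) by (simp add: K_def J_def strict_mono_def)
  have K0: "K n \<ge> k0" for n using J by (simp add: K_def)
  have KN: "K n = Suc (k0 + r1 (r2 n + N))" for n by (simp add: K_def J_def)
  have XK: "(\<lambda>n. X (K n)) \<longlonglongrightarrow> x"
    using LIMSEQ_subseq_LIMSEQ[OF LIMSEQ_ignore_initial_segment[OF r1(2), of N] r2(1)] by (simp add: o_def KN)
  have UK: "(\<lambda>n. dir (K n) c) \<longlonglongrightarrow> u" using r2(2) by (simp add: o_def K_def)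
  have XKc: "X (K n) \<in> cdom c" for n using N(1)[of "r2 n + N"] by (simp add: KN)
  have tK: "tv c (X (K n)) (dir (K n) c) = dir (K n)" for n
    by (rule tvec_of_tangent[OF c(1) XKc dir_in])
  define \<delta> where "\<delta> = mdiff A E x (tv c x u)"
  let ?d = "\<lambda>n. mdiff A E (X (K n)) (dir (K n))"
  have d: "?d \<longlonglongrightarrow> \<delta>" using slope_tendsto[OF c XK UK] by (simp add: tK \<delta>_def)
  have "\<delta> \<le> 0" by (rule LIMSEQ_le_const2[OF d]) (use slope_nonpos K0 in auto)
  \<comment> \<open>With a slope bounded away from 0, convergence of the merit values forces the
    step sizes to 0. The preceding trial steps were rejected, and in the limit their rejection reads
    \<open>\<epsilon> * \<delta> \<le> \<delta>\<close>, impossible for \<epsilon> below 1 and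
    negative \<delta>.\<close>
  moreover have "\<not> \<delta> < 0"
  proof
    assume \<delta>: "\<delta> < 0"
    let ?\<alpha> = "\<lambda>n. \<beta>^steps (K n)"
    have EK: "(\<lambda>n. E (X (K n))) \<longlonglongrightarrow> E x" by (rule isCont_tendsto_compose[OF isCont_mfun[OF E] XK])
    have "(\<lambda>n. E (X (K n)) - E (X (K (Suc n)))) \<longlonglongrightarrow> E x - E x"
      by (intro tendsto_diff EK LIMSEQ_Suc)
    then have E0: "(\<lambda>n. E (X (K n)) - E (X (K (Suc n)))) \<longlonglongrightarrow> 0" by simp
    have "(\<lambda>n. ?\<alpha> n * (\<epsilon> * - ?d n)) \<longlonglongrightarrow> 0"
    proof (rule Lim_null_comparison[OF always_eventually E0], rule allI)
      fix n
      have "0 \<le> ?\<alpha> n * (\<epsilon> * - ?d n)"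
        using slope_nonpos[OF K0, of n] params by (intro mult_nonneg_nonneg) auto
      moreover have "?\<alpha> n * (\<epsilon> * - ?d n) \<le> E (X (K n)) - E (X (Suc (K n)))"
        using decrease[OF K0, of n] by (simp add: algebra_simps)
      moreover have "E (X (K (Suc n))) \<le> E (X (Suc (K n)))"
        using K0[of n] strict_monoD[OF K, of n "Suc n"] by (intro E_mono) auto
      ultimately show "norm (?\<alpha> n * (\<epsilon> * - ?d n)) \<le> E (X (K n)) - E (X (K (Suc n)))" by simp
    qed
    moreover have "(\<lambda>n. \<epsilon> * - ?d n) \<longlonglongrightarrow> \<epsilon> * - \<delta>" by (intro tendsto_intros d)
    moreover have ed: "\<epsilon> * - \<delta> > 0" using \<delta> params by (simp add: mult_pos_neg)
    ultimately have quo: "(\<lambda>n. ?\<alpha> n * (\<epsilon> * - ?d n) / (\<epsilon> * - ?d n)) \<longlonglongrightarrow> 0 / (\<epsilon> * - \<delta>)"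
      by (intro tendsto_divide) auto
    have "\<forall>\<^sub>F n in sequentially. ?d n < 0" by (rule order_tendstoD(2)[OF d \<delta>])
    then have "\<forall>\<^sub>F n in sequentially. ?\<alpha> n * (\<epsilon> * - ?d n) / (\<epsilon> * - ?d n) = ?\<alpha> n"
      by (rule eventually_mono) (use params in simp)
    from Lim_transform_eventually[OF quo this] have \<alpha>0: "?\<alpha> \<longlonglongrightarrow> 0" by simp
    \<comment> \<open>The last rejected trial step; it exists as soon as the accepted step is below
      1, since the exponent is then positive.\<close>
    let ?b = "\<lambda>n. ?\<alpha> n / \<beta>"
    have b0: "?b \<longlonglongrightarrow> 0" using tendsto_divide[OF \<alpha>0 tendsto_const, of \<beta>] params by simp
    have bpos: "?b n > 0" for n using params by simp
    have lim: "(\<lambda>n. (E (R (X (K n)) (?b n *\<^sub>R dir (K n))) - E (X (K n))) / ?b n) \<longlonglongrightarrow> \<delta>"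
      using retraction_difference_quotient[OF retraction c XK UK b0 bpos E slope_tendsto[OF c]]
      unfolding tK \<delta>_def .
    have "\<forall>\<^sub>F n in sequentially. ?\<alpha> n < 1" by (rule order_tendstoD(2)[OF \<alpha>0]) simp
    then have ev: "\<forall>\<^sub>F n in sequentially. \<epsilon> * ?d n \<le> (E (R (X (K n)) (?b n *\<^sub>R dir (K n))) - E (X (K n))) / ?b n"
    proof (rule eventually_mono)
      fix n assume "?\<alpha> n < 1"
      then obtain i where i: "steps (K n) = Suc i" by (cases "steps (K n)") auto
      have b: "\<beta>^i = ?b n" using params i by simp
      have "E (X (K n)) + \<epsilon> * ?b n * ?d n < E (R (X (K n)) (?b n *\<^sub>R dir (K n)))"
        using not_armijo[of i "K n"] i unfolding armijo_iff FE[OF K0] b by simp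
      then have "\<epsilon> * ?d n * ?b n \<le> E (R (X (K n)) (?b n *\<^sub>R dir (K n))) - E (X (K n))"
        by (simp add: algebra_simps)
      then show "\<epsilon> * ?d n \<le> (E (R (X (K n)) (?b n *\<^sub>R dir (K n))) - E (X (K n))) / ?b n"
        using pos_le_divide_eq[OF bpos] by blast
    qed
    have "\<epsilon> * \<delta> \<le> \<delta>"
      by (rule tendsto_le[OF _ lim tendsto_mult_left[OF d] ev]) simp
    then show False using mult_strict_right_mono_neg[OF params(4) \<delta>] by simp
  qed
  ultimately have d0: "?d \<longlonglongrightarrow> 0" using d by simp
  let ?p = "\<lambda>n. rnorm G (X (K n)) (dir (K n))"
  have "(\<lambda>n. (?p n)\<^sup>2) \<longlonglongrightarrow> 0"
  proof (rule Lim_null_comparison[OF always_eventually], rule allI)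
    show "(\<lambda>n. \<nu> * - ?d n) \<longlonglongrightarrow> 0" using tendsto_mult_left[OF tendsto_minus[OF d0], of \<nu>] by simp
    show "norm ((?p n)\<^sup>2) \<le> \<nu> * - ?d n" for n
      using slope_le[OF K0, of n] \<nu>_pos by (simp add: field_simps)
  qed
  then have "(\<lambda>n. sqrt ((?p n)\<^sup>2)) \<longlonglongrightarrow> sqrt 0" by (rule tendsto_real_sqrt)
  then have p0: "?p \<longlonglongrightarrow> 0" using dir_in by simp
  \<comment> \<open>The coefficient left by \<open>merit_slope_bound\<close> when the differentials
    of the constraints are bounded by \<open>Bg\<close> and \<open>Bh\<close>.\<close>
  define M where "M = \<nu> + (1 / s) * (Bg * Bg) + (1 / s) * (Bh * Bh)"
  have grad_small: "rnorm G (X (K n)) (grad A G E (X (K n))) \<le> M * ?p n" for n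
  proof (rule rnorm_grad_le[OF E])
    fix v assume v: "v \<in> TM (X (K n))"
    let ?v = "rnorm G (X (K n)) v"
    have nn: "?p n \<ge> 0" "?v \<ge> 0" using dir_in v by auto
    have Dg: "norm (mdiff A g (X (K n)) (dir (K n))) * norm (mdiff A g (X (K n)) v) \<le> (Bg * ?p n) * (Bg * ?v)"
      using N(3)[of "r2 n + N", folded KN] dir_in v nn Bg(1) by (intro mult_mono) auto
    have Dh: "norm (mdiff A h (X (K n)) (dir (K n))) * norm (mdiff A h (X (K n)) v) \<le> (Bh * ?p n) * (Bh * ?v)"
      using N(4)[of "r2 n + N", folded KN] dir_in v nn Bh(1) by (intro mult_mono) auto
    have "\<bar>mdiff A E (X (K n)) v\<bar> \<le> \<nu> * ?p n * ?v
      + (1 / s) * (norm (mdiff A g (X (K n)) (dir (K n))) * norm (mdiff A g (X (K n)) v))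
      + (1 / s) * (norm (mdiff A h (X (K n)) (dir (K n))) * norm (mdiff A h (X (K n)) v))"
      using merit_slope_bound[OF v] const[OF K0] FE[OF K0] by simp
    also have "\<dots> \<le> \<nu> * ?p n * ?v + (1 / s) * ((Bg * ?p n) * (Bg * ?v)) + (1 / s) * ((Bh * ?p n) * (Bh * ?v))"
      using s Dg Dh by (intro add_mono mult_left_mono order.refl) auto
    also have "\<dots> = M * ?p n * ?v" by (simp add: M_def algebra_simps)
    finally show "\<bar>mdiff A E (X (K n)) v\<bar> \<le> M * ?p n * ?v" .
  qed
  have "(\<lambda>n. M * ?p n) \<longlonglongrightarrow> 0" using tendsto_mult_left[OF p0, of M] by simp
  then have "\<forall>\<^sub>F n in sequentially. M * ?p n < \<gamma>" by (rule order_tendstoD(2)[OF _ \<gamma>])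
  then obtain n where "M * ?p n < \<gamma>"
    by (rule exE[OF eventually_happens'[OF sequentially_bot]])
  then show False using grad_small[of n] grad_large[of "k0 + r1 (r2 n + N)"] unfolding KN by simp
qed

theorem convergence:
  "\<exists>x. (\<exists>r. strict_mono r \<and> (\<lambda>n. X (r n)) \<longlonglongrightarrow> x) \<and>
      (KKT_point A G f g h x \<or>
       (AKKT_point A G f g h x \<and> (\<exists>r. strict_mono r \<and>
           AKKT_sequence A G f g h x (\<lambda>n. X (r n)) (\<lambda>n. st_y (S (r n))) (\<lambda>n. st_z (S (r n))))) \<or>
       (\<not> feasible g h x \<and> grad A G (violation g h) x = 0)) \<and>
      (ERCQ A g h x \<longrightarrow> KKT_point A G f g h x)"
proof -
  \<comment> \<open>The conditions record the order in which the algorithm tries its cases, so in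
    the fourth alternative only Step 4.4 remains from some index on.\<close>
  consider "infinite {k. c1 k}" | "infinite {k. \<not> c1 k \<and> c2 k}"
    | "infinite {k. \<not> c1 k \<and> \<not> c2 k \<and> c3 k}"
    | "finite ({k. c1 k} \<union> {k. \<not> c1 k \<and> c2 k} \<union> {k. \<not> c1 k \<and> \<not> c2 k \<and> c3 k})"
    by blast
  then show ?thesis
  proof cases
    case 1
    then show ?thesis using step41_infinitely_often by blast
  next
    case 2
    then show ?thesis using step42_infinitely_often by blast
  next
    case 3
    then show ?thesis using step43_infinitely_often by blast
  next
    case 4
    then obtain k0 where k0: "\<forall>k\<in>{k. c1 k} \<union> {k. \<not> c1 k \<and> c2 k} \<union> {k. \<not> c1 k \<and> \<not> c2 k \<and> c3 k}. k < k0"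
      unfolding finite_nat_set_iff_bounded by (elim exE)
    have "\<not> c1 k \<and> \<not> c2 k \<and> \<not> c3 k" if "k \<ge> k0" for k
    proof -
      have "k \<notin> {k. c1 k} \<union> {k. \<not> c1 k \<and> c2 k} \<union> {k. \<not> c1 k \<and> \<not> c2 k \<and> c3 k}"
        using k0 that leD by blast
      then show ?thesis by blast
    qed
    then show ?thesis using no_stall by blast
  qed
qed

end

theorem theorem4p1:
  fixes A :: "('p::{t2_space,second_countable_topology}, 'e::euclidean_space) chart set"
    and G :: "('p, 'e) metric_tensor"
    and R :: "'p \<Rightarrow> ('p, 'e) tvec \<Rightarrow> 'p"
    and f :: "'p \<Rightarrow> real"
    and g :: "'p \<Rightarrow> real^'m"
    and h :: "'p \<Rightarrow> real^'l"
    and \<beta> \<epsilon> \<theta> :: real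
    and C :: "(real^'m) set"
    and D :: "(real^'l) set"
    and H :: "nat \<Rightarrow> ('p, 'e) tvec \<Rightarrow> ('p, 'e) tvec"
    and S :: "nat \<Rightarrow> ('p, 'm::finite, 'l::finite) rssqp_state"
  assumes "smooth_atlas A"
    and "riemannian_metric A G"
    and "connected (UNIV :: 'p set)"
    and "Metric_space.mcomplete UNIV (rdist A G)"
    and "manifold_retraction A R"
    and A1: "Ck_map 2 A f" "Ck_map 2 A g" "Ck_map 2 A h"
    and run: "rssqp_run A G R f g h \<beta> \<epsilon> \<theta> C D H S"
    and sigma_pos: "\<And>k. st_sigma (S k) > 0"
    and A2: "\<exists>\<nu>>0. \<forall>k. \<forall>u\<in>tangent_space A (st_x (S k)). \<forall>v\<in>tangent_space A (st_x (S k)).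
        1/\<nu> * (rnorm G (st_x (S k)) u)\<^sup>2 \<le> G (st_x (S k)) (M_op A G g (H k) (S k) u) u \<and>
        \<bar>G (st_x (S k)) (H k u) v\<bar> \<le> \<nu> * rnorm G (st_x (S k)) u * rnorm G (st_x (S k)) v"
    and bounded: "Metric_space.mbounded UNIV (rdist A G) (range (\<lambda>k. st_x (S k)))"
  shows "\<exists>x.
      (\<exists>r::nat \<Rightarrow> nat. strict_mono r \<and> (\<lambda>n. st_x (S (r n))) \<longlonglongrightarrow> x) \<and>
      (KKT_point A G f g h x \<or>
       (AKKT_point A G f g h x \<and>
        (\<exists>r::nat \<Rightarrow> nat. strict_mono r \<and>
           AKKT_sequence A G f g h x (\<lambda>n. st_x (S (r n))) (\<lambda>n. st_y (S (r n)))
             (\<lambda>n. st_z (S (r n))))) \<or>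
       (\<not> feasible g h x \<and> grad A G (violation g h) x = 0)) \<and>
      (ERCQ A g h x \<longrightarrow> KKT_point A G f g h x)"
proof -
  from A2 obtain \<nu> where \<nu>: "\<nu> > 0"
    "\<And>k u v. u \<in> tangent_space A (st_x (S k)) \<Longrightarrow> v \<in> tangent_space A (st_x (S k)) \<Longrightarrow>
        1/\<nu> * (rnorm G (st_x (S k)) u)\<^sup>2 \<le> G (st_x (S k)) (M_op A G g (H k) (S k) u) u \<and>
        \<bar>G (st_x (S k)) (H k u) v\<bar> \<le> \<nu> * rnorm G (st_x (S k)) u * rnorm G (st_x (S k)) v"
    by blast
  interpret rssqp A G f g h R \<beta> \<epsilon> \<theta> C D H S \<nu>
  proof
    show "Ck_map (Suc 0) A f" "Ck_map (Suc 0) A g" "Ck_map (Suc 0) A h"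
      using A1 by (auto simp: numeral_2_eq_2 simp del: Ck_on.simps
          intro: smooth_manifold.Ck_map_Suc_imp[OF smooth_manifold.intro[OF assms(1)]])
  qed (use assms \<nu> in blast)+
  show ?thesis by (rule convergence)
qed

end
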